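(* Consider the iterates $\{x_k\}$ generated by TR-SQP-STORM (described in the context). Suppose the regularity assumption, the merit-parameter stabilization assumption and the probabilistic accuracy conditions given in the context hold, and let $\nu\in(0,1)$ be a constant satisfying $$\frac{\nu}{1-\nu}\ge\max\left\{\frac{4\gamma^3\max\{1,\Delta_{\max}\}}{\min\{\eta^3\kappa_{fcd},\Upsilon_3\}},\frac{2\gamma}{\eta}\right\}.$$ If $$p_h+p_g+2p_f\le\frac{(1-\nu)^2}{16\nu^2}\left(1-\frac1\gamma\right)^2,$$ then $\liminf_{k\to\infty}\|\nabla\mathcal L_k\|=0$ almost surely, and (for the method run with $\alpha=1$) $\liminf_{k\to\infty}\tau_k^+=0$ almost surely.
   Context: **Problem and notation.** $\min_{x\in\mathbb R^d} f(x)=\mathbb E[F(x;\xi)]$ subject to $c(x)=0$, where $c=(c^1,\dots,c^m):\mathbb R^d\to\mathbb R^m$ is deterministic. $\|\cdot\|$ is the Euclidean norm (vectors) or operator norm (matrices). $G(x)=\nabla c(x)\in\mathbb R^{m\times d}$ is the Jacobian. Subscript $k$ denotes evaluation at $x_k$: $f_k$, $g_k=\nabla f(x_k)$, $\nabla^2f_k$, $c_k$, $G_k$, $\nabla^2c^i_k$. $Z_k\in\mathbb R^{d\times(d-m)}$ has orthonormal columns spanning $\ker G_k$. True quantities: $\lambda_k=-[G_kG_k^T]^{-1}G_kg_k$, $\nabla\mathcal L_k=(g_k+G_k^T\lambda_k,\,c_k)$, $\nabla_x^2\mathcal L_k=\nabla^2f_k+\sum_{i=1}^m\lambda_k^i\nabla^2c_k^i$,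 $\tau_k$ = smallest eigenvalue of $Z_k^T\nabla_x^2\mathcal L_kZ_k$, $\tau_k^+=|\min\{\tau_k,0\}|$. **Algorithm TR-SQP-STORM.** Parameters: $\alpha\in\{0,1\}$ ($\alpha=0$: aim at first-order stationarity; $\alpha=1$: second-order); $p_h,p_g,p_f,\eta\in(0,1)$; $\kappa_{fcd}\in(0,1]$; $r,\Delta_{\max},\kappa_h,\kappa_g>0$; $0<\kappa_f\le\kappa_{fcd}\eta^3/(16\max\{1,\Delta_{\max}\})$; $\rho,\gamma>1$; initial $x_0$, $\Delta_0\in(0,\Delta_{\max})$, $\bar\epsilon_0,\bar\mu_0>0$. Iteration $k$, given $(x_k,\Delta_k,\bar\epsilon_k,\bar\mu_k)$: (1) Obtain an estimate $\bar g_k$ of $g_k$; set $\bar\lambda_k=-[G_kG_k^T]^{-1}G_k\bar g_k$, $\bar\nabla_x\mathcal L_k=\bar g_k+G_k^T\bar\lambda_k$, $\bar\nabla\mathcal L_k=(\bar\nabla_x\mathcal L_k,c_k)$. If $\alpha=0$, take any matrix $\bar H_k$ approximating $\nabla_x^2\mathcal L_k$ and set $\bar\tau_k^+=0$. If $\alpha=1$, obtain an estimate $\bar\nabla^2f_k$ of $\nabla^2f_k$, set $\bar H_k=\bar\nabla^2f_k+\sum_i\bar\lambda_k^i\nabla^2c_k^i$, let $\bar\tau_k$ be the smallest eigenvalue of $Z_k^T\bar H_kZ_k$ and $\bar\tau_k^+=|\min\{\bar\tau_k,0\}|$. (2) If $\max\{\|\bar\nabla\mathcal L_k\|/\max\{1,\|\bar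 H_k\|\},\,\bar\tau_k^+\}\ge\eta\Delta_k$ fails, the iteration is *unsuccessful*: $x_{k+1}=x_k$, $\Delta_{k+1}=\Delta_k/\gamma$, $\bar\epsilon_{k+1}=\bar\epsilon_k/\gamma$, $\bar\mu_{k+1}=\bar\mu_k$, and the iteration ends. Otherwise compute a trial step $\Delta x_k=w_k+Z_ku_k$, $w_k=\bar\gamma_kv_k$, $v_k=-G_k^T[G_kG_k^T]^{-1}c_k$, $\bar\gamma_k=\min\{\breve\Delta_k/\|v_k\|,1\}$ (its value is immaterial if $v_k=0$). Put $c_k^{RS}=c_k/\|G_k\|$, $\bar\nabla_x\mathcal L_k^{RS}=\bar\nabla_x\mathcal L_k/\|\bar H_k\|$, $\bar\nabla\mathcal L_k^{RS}=(\bar\nabla_x\mathcal L_k^{RS},c_k^{RS})$, $\bar\tau_k^{RS+}=\bar\tau_k^+/\|\bar H_k\|$ (nonzero $\bar H_k$ implicit), and $m(u)=\frac12(Z_ku)^T\bar H_kZ_ku+(\bar g_k+\bar H_kw_k)^TZ_ku$. If $\|\bar\nabla\mathcal L_k\|\min\{\Delta_k,\|\bar\nabla\mathcal L_k\|/\|\bar H_k\|\}\ge\bar\tau_k^+\Delta_k(\Delta_k+\|c_k\|)$, take a *gradient step*: $\breve\Delta_k=\Delta_k\|c_k^{RS}\|/\|\bar\nabla\mathcal L_k^{RS}\|$, $\tilde\Delta_k=\Delta_k\|\bar\nabla_x\mathcal L_k^{RS}\|/\|\bar\nabla\mathcal L_k^{RS}\|$, and $u_k$ is any vector with $\|u_k\|\le\tilde\Delta_k$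 and $m(u_k)-m(0)\le-\frac{\kappa_{fcd}}2\|q_k\|\min\{\tilde\Delta_k,\|q_k\|/\|Z_k^T\bar H_kZ_k\|\}$, $q_k=Z_k^T(\bar g_k+\bar H_kw_k)$. Otherwise take an *eigen step*: $\breve\Delta_k=\Delta_k\|c_k^{RS}\|/\|(c_k^{RS},\bar\tau_k^{RS+})\|$, $\tilde\Delta_k=\Delta_k\bar\tau_k^{RS+}/\|(c_k^{RS},\bar\tau_k^{RS+})\|$, and $u_k$ is any vector with $(\bar g_k+\bar H_kw_k)^TZ_ku_k\le0$, $\|u_k\|\le\tilde\Delta_k$, $(Z_ku_k)^T\bar H_k(Z_ku_k)\le-\kappa_{fcd}\bar\tau_k^+\tilde\Delta_k^2$. (3) Let $\mathrm{Pred}_k=\bar g_k^T\Delta x_k+\frac12\Delta x_k^T\bar H_k\Delta x_k+\bar\mu_k(\|c_k+G_k\Delta x_k\|-\|c_k\|)$; replace $\bar\mu_k\leftarrow\rho\bar\mu_k$ until $\mathrm{Pred}_k\le-\frac{\kappa_{fcd}}2\max\{\|\bar\nabla\mathcal L_k\|\min\{\Delta_k,\|\bar\nabla\mathcal L_k\|/\|\bar H_k\|\},\,\bar\tau_k^+\Delta_k(\Delta_k+\|c_k\|)\}$. Below $\bar\mu_k$ denotes the value after this update, and $\bar\mu_{k+1}$ is initialized as $\bar\mu_k$. Set $x_{s_k}=x_k+\Delta x_k$, obtain estimates $\bar f_k,\bar f_{s_k}$ of $f_k,f_{s_k}=f(x_{s_k})$, and let $\mathrm{Ared}_k=\bar f_{s_k}-\bar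 f_k+\bar\mu_k(\|c(x_{s_k})\|-\|c_k\|)$. (4) If $\mathrm{Ared}_k/\mathrm{Pred}_k\ge\eta$, the iteration is *successful*: $x_{k+1}=x_{s_k}$, $\Delta_{k+1}=\min\{\gamma\Delta_k,\Delta_{\max}\}$; if moreover $-\mathrm{Pred}_k\ge\bar\epsilon_k$ it is *reliable* and $\bar\epsilon_{k+1}=\gamma\bar\epsilon_k$, otherwise *unreliable* and $\bar\epsilon_{k+1}=\bar\epsilon_k/\gamma$. If $\mathrm{Ared}_k/\mathrm{Pred}_k<\eta$, $\alpha=1$ and $\|c_k\|\le r$, perform the second-order correction (SOC) step: $d_k=-G_k^T[G_kG_k^T]^{-1}\{c(x_k+\Delta x_k)-c_k-G_k\Delta x_k\}$, reset $x_{s_k}=x_k+\Delta x_k+d_k$, re-estimate $\bar f_{s_k}$, recompute $\mathrm{Ared}_k$; if now $\mathrm{Ared}_k/\mathrm{Pred}_k\ge\eta$, the iteration is successful with the updates just described. In all remaining cases it is *unsuccessful*: $x_{k+1}=x_k$, $\Delta_{k+1}=\Delta_k/\gamma$, $\bar\epsilon_{k+1}=\bar\epsilon_k/\gamma$. **Accuracy events.** $\mathcal A_k=\{\|\bar\nabla^2f_k-\nabla^2f_k\|\le\kappa_h\Delta_k\}$ (taken to hold always if $\alpha=0$); $\mathcal B_k=\{\|\bar g_k-g_k\|\le\kappa_g\Delta_k^{\alpha+1}\}$; $\mathcal C_k=\{\max(|\bar f_k-f_k|,|\bar f_{s_k}-f_{s_k}|)\le\kappa_f\Delta_k^{\alpha+2}\}$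 for $x_{s_k}=x_k+\Delta x_k$; $\mathcal C_k'$ is the same event for the SOC trial point with its re-estimated value (taken to hold if no SOC step is computed). If no trial step is computed, $\mathcal C_k,\mathcal C_k'$ are taken to hold and the function-value errors are taken to be $0$. **Probabilistic accuracy conditions.** $\mathcal F_{k-1}$ is the $\sigma$-algebra of all randomness before iteration $k$ ($x_0,\dots,x_k,\Delta_k,\bar\epsilon_k$ are $\mathcal F_{k-1}$-measurable); $\mathcal F_{k-0.5}$ additionally contains $\bar g_k,\bar\nabla^2f_k$ (so $\Delta x_k,\bar\lambda_k,\bar\mu_k,d_k$ are $\mathcal F_{k-0.5}$-measurable). For all $k$: $P(\mathcal A_k\mid\mathcal F_{k-1})\ge1-p_h$ (for $\alpha=1$), $P(\mathcal B_k\mid\mathcal F_{k-1})\ge1-p_g$, $P(\mathcal C_k\mid\mathcal F_{k-0.5})\ge1-p_f$, $P(\mathcal C_k'\mid\mathcal F_{k-0.5})\ge1-p_f$, and $\max\{\mathbb E[|\bar f_k-f_k|^2\mid\mathcal F_{k-0.5}],\mathbb E[|\bar f_{s_k}-f_{s_k}|^2\mid\mathcal F_{k-0.5}]\}\le\bar\epsilon_k^2$ (also for the re-estimated $\bar f_{s_k}$). **Regularity assumption.** There is an open convex set $\Omega\subseteq\mathbb R^d$ containing all iterates and trial points on which: $f$ is twice continuously differentiable and bounded below by $f_{\inf}$; $\nabla f,\nabla^2f$ are Lipschitz with constants $L_{\nabla f},L_{\nabla^2f}$; $c$ is twice continuously differentiable; $G$ is Lipschitz with constant $L_G$; each $\nabla^2c^i$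 is Lipschitz with constant $L_{\nabla^2c}$. There are constants $\kappa_c,\kappa_{\nabla f},\kappa_{1,G},\kappa_{2,G}>0$ with $\|c_k\|\le\kappa_c$, $\|g_k\|\le\kappa_{\nabla f}$, $\kappa_{1,G}I\preceq G_kG_k^T\preceq\kappa_{2,G}I$ for all $k\ge0$. If $\alpha=0$, $\|\bar H_k\|\le\kappa_B$ for a constant $\kappa_B\ge1$. If $\alpha=1$, put $\kappa_B=\max\{1,\kappa_h\Delta_{\max}+L_{\nabla f}+\frac{\sqrt m L_G}{\sqrt{\kappa_{1,G}}}(\kappa_g\Delta_{\max}^2+\kappa_{\nabla f})\}$. **Merit-parameter stabilization assumption.** There are a (possibly random) $\bar K<\infty$ and a deterministic constant $\hat\mu$ with $\bar\mu_k=\bar\mu_{\bar K}\le\hat\mu$ for all $k\ge\bar K$. **Constants.** $\Upsilon_1=\kappa_g\max\{1,\Delta_{\max}\}+\frac12(L_{\nabla f}+\kappa_B+\hat\mu L_G)$ and $\Upsilon_3=\frac{3\kappa_{fcd}}8\max\left\{\frac{\kappa_B}{\kappa_g\max\{1,\Delta_{\max}\}+\kappa_B},\frac{4\kappa_f\max\{1,\Delta_{\max}\}+8\Upsilon_1}{\{(1-\eta)\kappa_{fcd}\kappa_g+4\kappa_f\}\max\{1,\Delta_{\max}\}+8\Upsilon_1}\right\}$. *)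

theory Defs
  imports "HOL-Probability.Probability"
begin

section \<open>Linear algebra and calculus\<close>

text \<open>The type class norm on \<^typ>\<open>real^'n^'m\<close> is the Frobenius norm, so the operator
  norm has to be named separately.\<close>

definition opnorm :: "real^'n^'m \<Rightarrow> real" where
  "opnorm A = onorm ((*v) A)"

definition op_lipschitz_on :: "real \<Rightarrow> (real^'n) set \<Rightarrow> (real^'n \<Rightarrow> real^'p^'q) \<Rightarrow> bool" where
  "op_lipschitz_on L S A \<longleftrightarrow> 0 \<le> L \<and> (\<forall>x\<in>S. \<forall>y\<in>S. opnorm (A x - A y) \<le> L * norm (x - y))"

definition loewner_le :: "real^'n^'n \<Rightarrow> real^'n^'n \<Rightarrow> bool" where
  "loewner_le A B \<longleftrightarrow> (\<forall>v. 0 \<le> v \<bullet> ((B - A) *v v))"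

text \<open>Only used for symmetric matrices, whose set of real eigenvalues is finite and nonempty.\<close>

definition smallest_eigenvalue :: "real^'n^'n \<Rightarrow> real" where
  "smallest_eigenvalue A = Min {t. \<exists>v. v \<noteq> 0 \<and> A *v v = t *\<^sub>R v}"

definition neg_part :: "real \<Rightarrow> real" where
  "neg_part t = \<bar>min t 0\<bar>"

definition orthonormal_kernel_basis :: "real^'d^'m \<Rightarrow> real^'z^'d \<Rightarrow> bool" where
  "orthonormal_kernel_basis G Z \<longleftrightarrow>
     transpose Z ** Z = mat 1 \<and> range ((*v) Z) = {v. G *v v = 0}"

definition grad :: "(real^'d \<Rightarrow> real) \<Rightarrow> real^'d \<Rightarrow> real^'d" where
  "grad f x = (THE D. GDERIV f x :> D)"

definition jac :: "(real^'d \<Rightarrow> real^'m) \<Rightarrow> real^'d \<Rightarrow> real^'d^'m" where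
  "jac c x = jacobian c (at x)"

definition hess :: "(real^'d \<Rightarrow> real) \<Rightarrow> real^'d \<Rightarrow> real^'d^'d" where
  "hess f x = jac (grad f) x"

definition twice_cont_diff_on :: "(real^'d) set \<Rightarrow> (real^'d \<Rightarrow> real) \<Rightarrow> bool" where
  "twice_cont_diff_on S f \<longleftrightarrow>
     (\<forall>x\<in>S. f differentiable (at x)) \<and> (\<forall>x\<in>S. grad f differentiable (at x)) \<and>
     continuous_on S (hess f)"

section \<open>True Lagrangian quantities\<close>

text \<open>The least-squares multiplier as a function of the Jacobian \<open>G\<close> and a (true or estimated)
  gradient \<open>g\<close>.\<close>

definition multiplier :: "real^'d^'m \<Rightarrow> real^'d \<Rightarrow> real^'m" where
  "multiplier G g = - (matrix_inv (G ** transpose G) *v (G *v g))"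

text \<open>The product norm is Euclidean, so the norm of this pair is that of the stacked vector.\<close>

definition grad_Lagr :: "(real^'d \<Rightarrow> real) \<Rightarrow> (real^'d \<Rightarrow> real^'m) \<Rightarrow> real^'d \<Rightarrow> (real^'d) \<times> (real^'m)" where
  "grad_Lagr f c x =
     (grad f x + transpose (jac c x) *v multiplier (jac c x) (grad f x), c x)"

definition add_constraint_hess :: "real^'d^'d \<Rightarrow> (real^'d \<Rightarrow> real^'m) \<Rightarrow> real^'m \<Rightarrow> real^'d \<Rightarrow> real^'d^'d" where
  "add_constraint_hess H c l x = H + (\<Sum>i\<in>UNIV. (l $ i) *\<^sub>R hess (\<lambda>y. c y $ i) x)"

definition hess_Lagr :: "(real^'d \<Rightarrow> real) \<Rightarrow> (real^'d \<Rightarrow> real^'m) \<Rightarrow> real^'d \<Rightarrow> real^'d^'d" where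
  "hess_Lagr f c x = add_constraint_hess (hess f x) c (multiplier (jac c x) (grad f x)) x"

definition reduced :: "real^'d^'d \<Rightarrow> real^'z^'d \<Rightarrow> real^'z^'z" where
  "reduced H Z = transpose Z ** H ** Z"

definition tau_plus :: "(real^'d \<Rightarrow> real) \<Rightarrow> (real^'d \<Rightarrow> real^'m) \<Rightarrow> real^'d \<Rightarrow> real^'z^'d \<Rightarrow> real" where
  "tau_plus f c x Z = neg_part (smallest_eigenvalue (reduced (hess_Lagr f c x) Z))"

definition stochastic_objective ::
    "'xi measure \<Rightarrow> (real^'d \<Rightarrow> 'xi \<Rightarrow> real) \<Rightarrow> (real^'d \<Rightarrow> real) \<Rightarrow> bool" where
  "stochastic_objective D F f \<longleftrightarrow>
     prob_space D \<and> (\<forall>x. integrable D (F x) \<and> f x = (\<integral>\<xi>. F x \<xi> \<partial>D))"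

section \<open>TR-SQP-STORM\<close>

record 'd storm_params =
  alpha :: nat
  p_h :: real
  p_g :: real
  p_f :: real
  eta :: real
  kappa_fcd :: real
  radius :: real
  Delta_max :: real
  kappa_h :: real
  kappa_g :: real
  kappa_f :: real
  rho :: real
  gamma :: real
  x_init :: "real^'d"
  Delta_init :: real
  eps_init :: real
  mu_init :: real

definition valid_params :: "('d::finite) storm_params \<Rightarrow> bool" where
  "valid_params P \<longleftrightarrow>
     alpha P \<in> {0, 1} \<and>
     p_h P \<in> {0<..<1} \<and> p_g P \<in> {0<..<1} \<and> p_f P \<in> {0<..<1} \<and> eta P \<in> {0<..<1} \<and>
     kappa_fcd P \<in> {0<..1} \<and>
     radius P > 0 \<and> Delta_max P > 0 \<and> kappa_h P > 0 \<and> kappa_g P > 0 \<and>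
     0 < kappa_f P \<and> kappa_f P \<le> kappa_fcd P * eta P ^ 3 / (16 * max 1 (Delta_max P)) \<and>
     rho P > 1 \<and> gamma P > 1 \<and>
     Delta_init P \<in> {0<..<Delta_max P} \<and> eps_init P > 0 \<and> mu_init P > 0"

text \<open>The data of one iteration along one sample path. The number \<open>d - m\<close> of columns of
  the null space basis is the cardinality of \<open>'z\<close>. \<open>it_mu_in\<close> is the merit parameter entering the
  iteration, \<open>it_mu\<close> its value after the update. \<open>it_fsb_soc\<close> is the re-estimated objective
  value at the trial point of the second-order correction. \<open>it_dx\<close>, \<open>it_fb\<close>, \<open>it_fsb\<close>
  (and \<open>it_fsb_soc\<close>) are meaningful only if a trial step (a correction) is computed and are otherwise
  unconstrained; \<open>it_Hfb\<close> is meaningful only if \<open>alpha = 1\<close>.\<close>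

record ('d, 'z) storm_iter =
  it_x :: "real^'d"
  it_Delta :: real
  it_eps :: real
  it_mu_in :: real
  it_mu :: real
  it_gb :: "real^'d"
  it_Hfb :: "real^'d^'d"
  it_Hb :: "real^'d^'d"
  it_Z :: "real^'z^'d"
  it_dx :: "real^'d"
  it_fb :: real
  it_fsb :: real
  it_fsb_soc :: real

type_synonym ('d, 'm) constraint = "real^'d \<Rightarrow> real^'m"

subsection \<open>Step (1): estimated Lagrangian quantities\<close>

definition lambda_bar :: "('d::finite, 'm::finite) constraint \<Rightarrow> ('d, 'z::finite) storm_iter \<Rightarrow> real^'m" where
  "lambda_bar c s = multiplier (jac c (it_x s)) (it_gb s)"

definition gradx_bar :: "('d::finite, 'm::finite) constraint \<Rightarrow> ('d, 'z::finite) storm_iter \<Rightarrow> real^'d" where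
  "gradx_bar c s = it_gb s + transpose (jac c (it_x s)) *v lambda_bar c s"

definition grad_bar :: "('d::finite, 'm::finite) constraint \<Rightarrow> ('d, 'z::finite) storm_iter \<Rightarrow> (real^'d) \<times> (real^'m)" where
  "grad_bar c s = (gradx_bar c s, c (it_x s))"

definition tau_bar_plus :: "'d::finite storm_params \<Rightarrow> ('d, 'z::finite) storm_iter \<Rightarrow> real" where
  "tau_bar_plus P s =
     (if alpha P = 1 then neg_part (smallest_eigenvalue (reduced (it_Hb s) (it_Z s))) else 0)"

text \<open>An estimate of a Hessian is a symmetric matrix (otherwise the smallest eigenvalue would be
  meaningless).\<close>

definition estimates_ok ::
    "'d::finite storm_params \<Rightarrow> ('d, 'm::finite) constraint \<Rightarrow> ('d, 'z::finite) storm_iter \<Rightarrow> bool" where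
  "estimates_ok P c s \<longleftrightarrow>
     orthonormal_kernel_basis (jac c (it_x s)) (it_Z s) \<and>
     (alpha P = 1 \<longrightarrow>
        transpose (it_Hfb s) = it_Hfb s \<and>
        it_Hb s = add_constraint_hess (it_Hfb s) c (lambda_bar c s) (it_x s))"

subsection \<open>Step (2): trial step\<close>

definition computes_trial ::
    "'d::finite storm_params \<Rightarrow> ('d, 'm::finite) constraint \<Rightarrow> ('d, 'z::finite) storm_iter \<Rightarrow> bool" where
  "computes_trial P c s \<longleftrightarrow>
     max (norm (grad_bar c s) / max 1 (opnorm (it_Hb s))) (tau_bar_plus P s) \<ge> eta P * it_Delta s"

definition grad_measure ::
    "('d::finite, 'm::finite) constraint \<Rightarrow> ('d, 'z::finite) storm_iter \<Rightarrow> real" where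
  "grad_measure c s =
     norm (grad_bar c s) * min (it_Delta s) (norm (grad_bar c s) / opnorm (it_Hb s))"

definition eigen_measure ::
    "'d::finite storm_params \<Rightarrow> ('d, 'm::finite) constraint \<Rightarrow> ('d, 'z::finite) storm_iter \<Rightarrow> real" where
  "eigen_measure P c s = tau_bar_plus P s * it_Delta s * (it_Delta s + norm (c (it_x s)))"

definition c_RS :: "('d::finite, 'm::finite) constraint \<Rightarrow> ('d, 'z::finite) storm_iter \<Rightarrow> real^'m" where
  "c_RS c s = c (it_x s) /\<^sub>R opnorm (jac c (it_x s))"

definition gradx_RS :: "('d::finite, 'm::finite) constraint \<Rightarrow> ('d, 'z::finite) storm_iter \<Rightarrow> real^'d" where
  "gradx_RS c s = gradx_bar c s /\<^sub>R opnorm (it_Hb s)"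

definition grad_RS :: "('d::finite, 'm::finite) constraint \<Rightarrow> ('d, 'z::finite) storm_iter \<Rightarrow> (real^'d) \<times> (real^'m)" where
  "grad_RS c s = (gradx_RS c s, c_RS c s)"

definition tau_RS :: "'d::finite storm_params \<Rightarrow> ('d, 'z::finite) storm_iter \<Rightarrow> real" where
  "tau_RS P s = tau_bar_plus P s / opnorm (it_Hb s)"

text \<open>\<open>- G\<^sup>T (G G\<^sup>T)\<^sup>-\<^sup>1 b\<close>: the direction \<open>v\<close> for \<open>b = c\<close>, the correction \<open>d\<close> for the linearization
  error \<open>b\<close>.\<close>

definition normal_dir :: "real^'d^'m \<Rightarrow> real^'m \<Rightarrow> real^'d" where
  "normal_dir G b = - (transpose G *v (matrix_inv (G ** transpose G) *v b))"

text \<open>The normal step \<open>w\<close> for the radius \<open>D\<close> allotted to it.\<close>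

definition normal_step ::
    "('d::finite, 'm::finite) constraint \<Rightarrow> ('d, 'z::finite) storm_iter \<Rightarrow> real \<Rightarrow> real^'d" where
  "normal_step c s D =
     (let v = normal_dir (jac c (it_x s)) (c (it_x s)) in min (D / norm v) 1 *\<^sub>R v)"

definition tangential_model :: "('d::finite, 'z::finite) storm_iter \<Rightarrow> real^'d \<Rightarrow> real^'z \<Rightarrow> real" where
  "tangential_model s w u =
     (it_Z s *v u) \<bullet> (it_Hb s *v (it_Z s *v u)) / 2
     + (it_gb s + it_Hb s *v w) \<bullet> (it_Z s *v u)"

text \<open>\<open>min {D, a / b}\<close> with \<open>a / 0\<close> read as infinity.\<close>

definition min_ratio :: "real \<Rightarrow> real \<Rightarrow> real \<Rightarrow> real" where
  "min_ratio D a b = (if b = 0 then D else min D (a / b))"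

definition is_gradient_step ::
    "'d::finite storm_params \<Rightarrow> ('d, 'm::finite) constraint \<Rightarrow> ('d, 'z::finite) storm_iter \<Rightarrow> bool" where
  "is_gradient_step P c s \<longleftrightarrow>
     (let D1 = it_Delta s * norm (c_RS c s) / norm (grad_RS c s);
          D2 = it_Delta s * norm (gradx_RS c s) / norm (grad_RS c s);
          w = normal_step c s D1;
          q = transpose (it_Z s) *v (it_gb s + it_Hb s *v w)
      in \<exists>u. it_dx s = w + it_Z s *v u \<and> norm u \<le> D2 \<and>
             tangential_model s w u - tangential_model s w 0
               \<le> - (kappa_fcd P / 2) * norm q
                   * min_ratio D2 (norm q) (opnorm (reduced (it_Hb s) (it_Z s))))"

definition is_eigen_step ::
    "'d::finite storm_params \<Rightarrow> ('d, 'm::finite) constraint \<Rightarrow> ('d, 'z::finite) storm_iter \<Rightarrow> bool" where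
  "is_eigen_step P c s \<longleftrightarrow>
     (let D1 = it_Delta s * norm (c_RS c s) / norm (c_RS c s, tau_RS P s);
          D2 = it_Delta s * tau_RS P s / norm (c_RS c s, tau_RS P s);
          w = normal_step c s D1
      in \<exists>u. it_dx s = w + it_Z s *v u \<and> norm u \<le> D2 \<and>
             (it_gb s + it_Hb s *v w) \<bullet> (it_Z s *v u) \<le> 0 \<and>
             (it_Z s *v u) \<bullet> (it_Hb s *v (it_Z s *v u))
               \<le> - kappa_fcd P * tau_bar_plus P s * D2\<^sup>2)"

text \<open>The rescaled quantities divide by the norm of the model Hessian, which is therefore nonzero
  whenever a step is computed.\<close>

definition trial_step_ok ::
    "'d::finite storm_params \<Rightarrow> ('d, 'm::finite) constraint \<Rightarrow> ('d, 'z::finite) storm_iter \<Rightarrow> bool" where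
  "trial_step_ok P c s \<longleftrightarrow>
     it_Hb s \<noteq> 0 \<and>
     (if grad_measure c s \<ge> eigen_measure P c s then is_gradient_step P c s else is_eigen_step P c s)"

subsection \<open>Step (3): merit parameter\<close>

text \<open>\<open>Pred\<close> for the value \<open>\<mu>\<close> of the merit parameter.\<close>

definition pred_red ::
    "('d::finite, 'm::finite) constraint \<Rightarrow> ('d, 'z::finite) storm_iter \<Rightarrow> real \<Rightarrow> real" where
  "pred_red c s \<mu> =
     it_gb s \<bullet> it_dx s + it_dx s \<bullet> (it_Hb s *v it_dx s) / 2
     + \<mu> * (norm (c (it_x s) + jac c (it_x s) *v it_dx s) - norm (c (it_x s)))"

definition sufficient_pred ::
    "'d::finite storm_params \<Rightarrow> ('d, 'm::finite) constraint \<Rightarrow> ('d, 'z::finite) storm_iter \<Rightarrow> real \<Rightarrow> bool" where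
  "sufficient_pred P c s \<mu> \<longleftrightarrow>
     pred_red c s \<mu> \<le> - (kappa_fcd P / 2) * max (grad_measure c s) (eigen_measure P c s)"

definition merit_update ::
    "'d::finite storm_params \<Rightarrow> ('d, 'm::finite) constraint \<Rightarrow> ('d, 'z::finite) storm_iter \<Rightarrow> bool" where
  "merit_update P c s \<longleftrightarrow>
     (\<exists>n. it_mu s = rho P ^ n * it_mu_in s \<and> sufficient_pred P c s (it_mu s) \<and>
          (\<forall>j<n. \<not> sufficient_pred P c s (rho P ^ j * it_mu_in s)))"

subsection \<open>Step (4): acceptance and updates\<close>

abbreviation Pred :: "('d::finite, 'm::finite) constraint \<Rightarrow> ('d, 'z::finite) storm_iter \<Rightarrow> real" where
  "Pred c s \<equiv> pred_red c s (it_mu s)"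

definition trial_point :: "('d::finite, 'z::finite) storm_iter \<Rightarrow> real^'d" where
  "trial_point s = it_x s + it_dx s"

definition soc_step :: "('d::finite, 'm::finite) constraint \<Rightarrow> ('d, 'z::finite) storm_iter \<Rightarrow> real^'d" where
  "soc_step c s =
     normal_dir (jac c (it_x s)) (c (trial_point s) - c (it_x s) - jac c (it_x s) *v it_dx s)"

definition soc_point :: "('d::finite, 'm::finite) constraint \<Rightarrow> ('d, 'z::finite) storm_iter \<Rightarrow> real^'d" where
  "soc_point c s = it_x s + it_dx s + soc_step c s"

text \<open>\<open>Ared\<close> for the candidate \<open>y\<close> with objective estimate \<open>fy\<close>.\<close>

definition actual_red ::
    "('d::finite, 'm::finite) constraint \<Rightarrow> ('d, 'z::finite) storm_iter \<Rightarrow> real^'d \<Rightarrow> real \<Rightarrow> real" where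
  "actual_red c s y fy = fy - it_fb s + it_mu s * (norm (c y) - norm (c (it_x s)))"

definition accepts_trial ::
    "'d::finite storm_params \<Rightarrow> ('d, 'm::finite) constraint \<Rightarrow> ('d, 'z::finite) storm_iter \<Rightarrow> bool" where
  "accepts_trial P c s \<longleftrightarrow>
     computes_trial P c s \<and> actual_red c s (trial_point s) (it_fsb s) / Pred c s \<ge> eta P"

definition computes_soc ::
    "'d::finite storm_params \<Rightarrow> ('d, 'm::finite) constraint \<Rightarrow> ('d, 'z::finite) storm_iter \<Rightarrow> bool" where
  "computes_soc P c s \<longleftrightarrow>
     computes_trial P c s \<and> actual_red c s (trial_point s) (it_fsb s) / Pred c s < eta P \<and>
     alpha P = 1 \<and> norm (c (it_x s)) \<le> radius P"

definition accepts_soc ::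
    "'d::finite storm_params \<Rightarrow> ('d, 'm::finite) constraint \<Rightarrow> ('d, 'z::finite) storm_iter \<Rightarrow> bool" where
  "accepts_soc P c s \<longleftrightarrow>
     computes_soc P c s \<and> actual_red c s (soc_point c s) (it_fsb_soc s) / Pred c s \<ge> eta P"

definition iteration_ok ::
    "'d::finite storm_params \<Rightarrow> ('d, 'm::finite) constraint \<Rightarrow> ('d, 'z::finite) storm_iter \<Rightarrow> bool" where
  "iteration_ok P c s \<longleftrightarrow>
     estimates_ok P c s \<and>
     (if computes_trial P c s then trial_step_ok P c s \<and> merit_update P c s
      else it_mu s = it_mu_in s)"

definition transition ::
    "'d::finite storm_params \<Rightarrow> ('d, 'm::finite) constraint \<Rightarrow>
     ('d, 'z::finite) storm_iter \<Rightarrow> ('d, 'z) storm_iter \<Rightarrow> bool" where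
  "transition P c s s' \<longleftrightarrow>
     it_mu_in s' = it_mu s \<and>
     (if accepts_trial P c s \<or> accepts_soc P c s
      then it_x s' = (if accepts_trial P c s then trial_point s else soc_point c s) \<and>
           it_Delta s' = min (gamma P * it_Delta s) (Delta_max P) \<and>
           it_eps s' = (if - Pred c s \<ge> it_eps s then gamma P * it_eps s else it_eps s / gamma P)
      else it_x s' = it_x s \<and>
           it_Delta s' = it_Delta s / gamma P \<and>
           it_eps s' = it_eps s / gamma P)"

definition storm_path ::
    "'d::finite storm_params \<Rightarrow> ('d, 'm::finite) constraint \<Rightarrow> (nat \<Rightarrow> ('d, 'z::finite) storm_iter) \<Rightarrow> bool" where
  "storm_path P c s \<longleftrightarrow>
     it_x (s 0) = x_init P \<and> it_Delta (s 0) = Delta_init P \<and>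
     it_eps (s 0) = eps_init P \<and> it_mu_in (s 0) = mu_init P \<and>
     (\<forall>k. iteration_ok P c (s k) \<and> transition P c (s k) (s (Suc k)))"

section \<open>Probabilistic structure\<close>

text \<open>\<open>Fpre k\<close> and \<open>Fmid k\<close> stand for the sigma-algebras before iteration \<open>k\<close> (index \<open>k - 1\<close>) and after
  the derivative estimates of iteration \<open>k\<close> (index \<open>k - 0.5\<close>). Any such family to which the process is
  adapted is allowed, in particular the generated one.\<close>

definition storm_filtration ::
    "'w measure \<Rightarrow> (nat \<Rightarrow> 'w measure) \<Rightarrow> (nat \<Rightarrow> 'w measure) \<Rightarrow> bool" where
  "storm_filtration M Fpre Fmid \<longleftrightarrow>
     (\<forall>k. subalgebra M (Fpre k) \<and> subalgebra M (Fmid k) \<and>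
          subalgebra (Fmid k) (Fpre k) \<and> subalgebra (Fpre (Suc k)) (Fmid k))"

definition storm_adapted ::
    "'d::finite storm_params \<Rightarrow> ('d, 'm::finite) constraint \<Rightarrow>
     (nat \<Rightarrow> 'w measure) \<Rightarrow> (nat \<Rightarrow> 'w measure) \<Rightarrow> (nat \<Rightarrow> 'w \<Rightarrow> ('d, 'z::finite) storm_iter) \<Rightarrow> bool" where
  "storm_adapted P c Fpre Fmid S \<longleftrightarrow> (\<forall>k.
     (\<lambda>\<omega>. it_x (S k \<omega>)) \<in> borel_measurable (Fpre k) \<and>
     (\<lambda>\<omega>. it_Delta (S k \<omega>)) \<in> borel_measurable (Fpre k) \<and>
     (\<lambda>\<omega>. it_eps (S k \<omega>)) \<in> borel_measurable (Fpre k) \<and>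
     (\<lambda>\<omega>. it_mu_in (S k \<omega>)) \<in> borel_measurable (Fpre k) \<and>
     (\<lambda>\<omega>. it_gb (S k \<omega>)) \<in> borel_measurable (Fmid k) \<and>
     (alpha P = 1 \<longrightarrow> (\<lambda>\<omega>. it_Hfb (S k \<omega>)) \<in> borel_measurable (Fmid k)) \<and>
     (\<lambda>\<omega>. it_Hb (S k \<omega>)) \<in> borel_measurable (Fmid k) \<and>
     (\<lambda>\<omega>. it_dx (S k \<omega>)) \<in> borel_measurable (Fmid k) \<and>
     (\<lambda>\<omega>. lambda_bar c (S k \<omega>)) \<in> borel_measurable (Fmid k) \<and>
     (\<lambda>\<omega>. it_mu (S k \<omega>)) \<in> borel_measurable (Fmid k) \<and>
     (\<lambda>\<omega>. if computes_trial P c (S k \<omega>) then soc_step c (S k \<omega>) else 0) \<in> borel_measurable (Fmid k) \<and>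
     (\<lambda>\<omega>. it_fb (S k \<omega>)) \<in> borel_measurable (Fpre (Suc k)) \<and>
     (\<lambda>\<omega>. it_fsb (S k \<omega>)) \<in> borel_measurable (Fpre (Suc k)) \<and>
     (\<lambda>\<omega>. it_fsb_soc (S k \<omega>)) \<in> borel_measurable (Fpre (Suc k)))"

definition event_A ::
    "'d::finite storm_params \<Rightarrow> (real^'d \<Rightarrow> real) \<Rightarrow> ('d, 'z::finite) storm_iter \<Rightarrow> bool" where
  "event_A P f s \<longleftrightarrow>
     (alpha P = 1 \<longrightarrow> opnorm (it_Hfb s - hess f (it_x s)) \<le> kappa_h P * it_Delta s)"

definition event_B ::
    "'d::finite storm_params \<Rightarrow> (real^'d \<Rightarrow> real) \<Rightarrow> ('d, 'z::finite) storm_iter \<Rightarrow> bool" where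
  "event_B P f s \<longleftrightarrow>
     norm (it_gb s - grad f (it_x s)) \<le> kappa_g P * it_Delta s ^ (alpha P + 1)"

text \<open>Estimation errors of the objective values at the iterate, at the trial point, and at the corrected
  trial point, equal to 0 if the respective value is not computed.\<close>

definition err_f ::
    "'d::finite storm_params \<Rightarrow> (real^'d \<Rightarrow> real) \<Rightarrow> ('d, 'm::finite) constraint \<Rightarrow>
     ('d, 'z::finite) storm_iter \<Rightarrow> real" where
  "err_f P f c s = (if computes_trial P c s then \<bar>it_fb s - f (it_x s)\<bar> else 0)"

definition err_fs ::
    "'d::finite storm_params \<Rightarrow> (real^'d \<Rightarrow> real) \<Rightarrow> ('d, 'm::finite) constraint \<Rightarrow>
     ('d, 'z::finite) storm_iter \<Rightarrow> real" where
  "err_fs P f c s = (if computes_trial P c s then \<bar>it_fsb s - f (trial_point s)\<bar> else 0)"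

definition err_soc ::
    "'d::finite storm_params \<Rightarrow> (real^'d \<Rightarrow> real) \<Rightarrow> ('d, 'm::finite) constraint \<Rightarrow>
     ('d, 'z::finite) storm_iter \<Rightarrow> real" where
  "err_soc P f c s = (if computes_soc P c s then \<bar>it_fsb_soc s - f (soc_point c s)\<bar> else 0)"

definition event_C ::
    "'d::finite storm_params \<Rightarrow> (real^'d \<Rightarrow> real) \<Rightarrow> ('d, 'm::finite) constraint \<Rightarrow>
     ('d, 'z::finite) storm_iter \<Rightarrow> bool" where
  "event_C P f c s \<longleftrightarrow>
     (computes_trial P c s \<longrightarrow>
        max (err_f P f c s) (err_fs P f c s) \<le> kappa_f P * it_Delta s ^ (alpha P + 2))"

definition event_C' ::
    "'d::finite storm_params \<Rightarrow> (real^'d \<Rightarrow> real) \<Rightarrow> ('d, 'm::finite) constraint \<Rightarrow>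
     ('d, 'z::finite) storm_iter \<Rightarrow> bool" where
  "event_C' P f c s \<longleftrightarrow>
     (computes_soc P c s \<longrightarrow>
        max (err_f P f c s) (err_soc P f c s) \<le> kappa_f P * it_Delta s ^ (alpha P + 2))"

definition cond_prob_ge :: "'w measure \<Rightarrow> 'w measure \<Rightarrow> ('w \<Rightarrow> bool) \<Rightarrow> real \<Rightarrow> bool" where
  "cond_prob_ge M F E p \<longleftrightarrow>
     {\<omega> \<in> space M. E \<omega>} \<in> sets M \<and>
     (AE \<omega> in M. real_cond_exp M F (indicat_real {\<omega> \<in> space M. E \<omega>}) \<omega> \<ge> p)"

text \<open>The nonnegative conditional expectation is used because square integrability of the error
  is part of what is being asserted.\<close>

definition cond_second_moment_le :: "'w measure \<Rightarrow> 'w measure \<Rightarrow> ('w \<Rightarrow> real) \<Rightarrow> ('w \<Rightarrow> real) \<Rightarrow> bool" where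
  "cond_second_moment_le M F X B \<longleftrightarrow>
     X \<in> borel_measurable M \<and>
     (AE \<omega> in M. nn_cond_exp M F (\<lambda>\<omega>. ennreal ((X \<omega>)\<^sup>2)) \<omega> \<le> ennreal (B \<omega>))"

definition probabilistic_accuracy ::
    "'d::finite storm_params \<Rightarrow> (real^'d \<Rightarrow> real) \<Rightarrow> ('d, 'm::finite) constraint \<Rightarrow> 'w measure \<Rightarrow>
     (nat \<Rightarrow> 'w measure) \<Rightarrow> (nat \<Rightarrow> 'w measure) \<Rightarrow> (nat \<Rightarrow> 'w \<Rightarrow> ('d, 'z::finite) storm_iter) \<Rightarrow> bool" where
  "probabilistic_accuracy P f c M Fpre Fmid S \<longleftrightarrow> (\<forall>k.
     (alpha P = 1 \<longrightarrow> cond_prob_ge M (Fpre k) (\<lambda>\<omega>. event_A P f (S k \<omega>)) (1 - p_h P)) \<and>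
     cond_prob_ge M (Fpre k) (\<lambda>\<omega>. event_B P f (S k \<omega>)) (1 - p_g P) \<and>
     cond_prob_ge M (Fmid k) (\<lambda>\<omega>. event_C P f c (S k \<omega>)) (1 - p_f P) \<and>
     cond_prob_ge M (Fmid k) (\<lambda>\<omega>. event_C' P f c (S k \<omega>)) (1 - p_f P) \<and>
     cond_second_moment_le M (Fmid k) (\<lambda>\<omega>. err_f P f c (S k \<omega>)) (\<lambda>\<omega>. (it_eps (S k \<omega>))\<^sup>2) \<and>
     cond_second_moment_le M (Fmid k) (\<lambda>\<omega>. err_fs P f c (S k \<omega>)) (\<lambda>\<omega>. (it_eps (S k \<omega>))\<^sup>2) \<and>
     cond_second_moment_le M (Fmid k) (\<lambda>\<omega>. err_soc P f c (S k \<omega>)) (\<lambda>\<omega>. (it_eps (S k \<omega>))\<^sup>2))"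

section \<open>Regularity and merit parameter assumptions\<close>

record reg_consts =
  f_inf :: real
  L_grad_f :: real
  L_hess_f :: real
  L_G :: real
  L_hess_c :: real
  kappa_c :: real
  kappa_grad_f :: real
  kappa_1G :: real
  kappa_2G :: real
  kappa_B :: real

definition regularity ::
    "'d::finite storm_params \<Rightarrow> (real^'d \<Rightarrow> real) \<Rightarrow> ('d, 'm::finite) constraint \<Rightarrow> reg_consts \<Rightarrow>
     (real^'d) set \<Rightarrow> 'w measure \<Rightarrow> (nat \<Rightarrow> 'w \<Rightarrow> ('d, 'z::finite) storm_iter) \<Rightarrow> bool" where
  "regularity P f c R \<Omega> M S \<longleftrightarrow>
     open \<Omega> \<and> convex \<Omega> \<and>
     (\<forall>\<omega>\<in>space M. \<forall>k.
        it_x (S k \<omega>) \<in> \<Omega> \<and>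
        (computes_trial P c (S k \<omega>) \<longrightarrow> trial_point (S k \<omega>) \<in> \<Omega>) \<and>
        (computes_soc P c (S k \<omega>) \<longrightarrow> soc_point c (S k \<omega>) \<in> \<Omega>)) \<and>
     twice_cont_diff_on \<Omega> f \<and> (\<forall>x\<in>\<Omega>. f_inf R \<le> f x) \<and>
     (L_grad_f R)-lipschitz_on \<Omega> (grad f) \<and>
     op_lipschitz_on (L_hess_f R) \<Omega> (hess f) \<and>
     (\<forall>i. twice_cont_diff_on \<Omega> (\<lambda>x. c x $ i)) \<and>
     op_lipschitz_on (L_G R) \<Omega> (jac c) \<and>
     (\<forall>i. op_lipschitz_on (L_hess_c R) \<Omega> (hess (\<lambda>x. c x $ i))) \<and>
     kappa_c R > 0 \<and> kappa_grad_f R > 0 \<and> kappa_1G R > 0 \<and> kappa_2G R > 0 \<and>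
     (\<forall>\<omega>\<in>space M. \<forall>k.
        let x = it_x (S k \<omega>); G = jac c x in
          norm (c x) \<le> kappa_c R \<and> norm (grad f x) \<le> kappa_grad_f R \<and>
          loewner_le (mat (kappa_1G R)) (G ** transpose G) \<and>
          loewner_le (G ** transpose G) (mat (kappa_2G R))) \<and>
     (alpha P = 0 \<longrightarrow>
        kappa_B R \<ge> 1 \<and> (\<forall>\<omega>\<in>space M. \<forall>k. opnorm (it_Hb (S k \<omega>)) \<le> kappa_B R)) \<and>
     (alpha P = 1 \<longrightarrow>
        kappa_B R = max 1 (kappa_h P * Delta_max P + L_grad_f R
          + sqrt (real CARD('m)) * L_G R / sqrt (kappa_1G R)
            * (kappa_g P * (Delta_max P)\<^sup>2 + kappa_grad_f R)))"

definition merit_stabilization ::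
    "'w measure \<Rightarrow> (nat \<Rightarrow> 'w \<Rightarrow> ('d::finite, 'z::finite) storm_iter) \<Rightarrow> real \<Rightarrow> bool" where
  "merit_stabilization M S \<mu>hat \<longleftrightarrow>
     (AE \<omega> in M. \<exists>K. \<forall>k\<ge>K. it_mu (S k \<omega>) = it_mu (S K \<omega>) \<and> it_mu (S K \<omega>) \<le> \<mu>hat)"

definition Upsilon1 :: "'d::finite storm_params \<Rightarrow> reg_consts \<Rightarrow> real \<Rightarrow> real" where
  "Upsilon1 P R \<mu>hat =
     kappa_g P * max 1 (Delta_max P) + (L_grad_f R + kappa_B R + \<mu>hat * L_G R) / 2"

definition Upsilon3 :: "'d::finite storm_params \<Rightarrow> reg_consts \<Rightarrow> real \<Rightarrow> real" where
  "Upsilon3 P R \<mu>hat =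
     (let D = max 1 (Delta_max P) in
      3 * kappa_fcd P / 8 *
      max (kappa_B R / (kappa_g P * D + kappa_B R))
          ((4 * kappa_f P * D + 8 * Upsilon1 P R \<mu>hat)
           / (((1 - eta P) * kappa_fcd P * kappa_g P + 4 * kappa_f P) * D + 8 * Upsilon1 P R \<mu>hat)))"

end

theory Submission
  imports Defs
begin

text \<open>
  The Lyapunov function \<open>\<nu> (f + \<mu> \<parallel>c\<parallel>) + a \<Delta>\<^sup>\<alpha>\<^sup>+\<^sup>2 + (1 - \<nu>) \<epsilon>\<close> decreases in every iteration, up to the
  estimation errors of accepted steps with inaccurate function values. Their expectation is at most
  \<open>4 \<surd>p\<^sub>f \<epsilon>\<close> and is absorbed by the decrease of the \<open>\<epsilon>\<close>-term, so \<open>\<Sum> \<Delta>\<^sup>\<alpha>\<^sup>+\<^sup>2\<close> has finite expectation and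
  \<open>\<Delta>\<close> tends to 0 almost surely. No accuracy of the derivative estimates enters here.

  Conversely, at points that are uniformly non-stationary every accurate iteration with a small radius
  is successful: the predicted reduction is of order \<open>\<Delta>\<close> (first order) or \<open>\<Delta> (\<Delta> + \<parallel>c\<parallel>)\<close> (second
  order), whereas the model error is of order \<open>\<Delta>\<^sup>2\<close>, and of order \<open>\<Delta>\<^sup>3\<close> after the second-order correction. As
  inaccurate iterations are rare, \<open>1 / \<Delta>\<close> then contracts in expectation as long as the radius stays small, so
  the radius almost surely does not stay small forever. This contradicts \<open>\<Delta> \<rightarrow> 0\<close>.
\<close>

section \<open>Matrices\<close>

text \<open>Two random quantities shape the argument. The merit parameter settles only at a random
  index. Since it never decreases along a path, its final bound holds at all indices, and pairing it
  with \<open>norm (c x) - kappa_c R\<close>, which is at most 0, makes every increase harmless to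
  the Lyapunov function. Descent therefore starts at iteration 0 from a deterministic value, without
  conditioning on the stabilization index. Whether the iterates remain non-stationary is not decided
  at any finite time. The contraction argument hence weights 1 / \<Delta> by the indicator of having
  stayed so far in a fixed set of non-stationary points with small radius. This weight is known
  before each iteration, and it stays bounded below on paths that never leave. For the indicator to
  be measurable the set must be Borel, although the null space basis is chosen arbitrarily in each
  iteration and smoothness is available only on the domain. The non-stationary sets are therefore
  described by relatively closed conditions that avoid the basis and matrix inverses.\<close>

declare transpose_matrix_vector [simp del]

lemma norm_matrix_vector_le_opnorm: "norm (A *v x) \<le> opnorm A * norm (x::real^'n)" for A :: "real^'n^'m"
  unfolding opnorm_def by (rule onorm) simp

lemma opnorm_nonneg [simp]: "0 \<le> opnorm A"
  unfolding opnorm_def by (rule onorm_pos_le) simp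

lemma opnorm_leI: "(\<And>x. norm (A *v x) \<le> B * norm x) \<Longrightarrow> opnorm A \<le> B" for A :: "real^'n^'m"
  unfolding opnorm_def by (rule onorm_le)

lemma opnorm_add_le: "opnorm (A + B) \<le> opnorm A + opnorm B" for A B :: "real^'n^'m"
proof (rule opnorm_leI)
  fix x :: "real^'n"
  have "norm ((A + B) *v x) \<le> norm (A *v x) + norm (B *v x)"
    by (simp add: matrix_vector_mult_add_rdistrib norm_triangle_ineq)
  also have "\<dots> \<le> (opnorm A + opnorm B) * norm x"
    using norm_matrix_vector_le_opnorm[of A x] norm_matrix_vector_le_opnorm[of B x]
    by (simp add: algebra_simps)
  finally show "norm ((A + B) *v x) \<le> (opnorm A + opnorm B) * norm x" .
qed

lemma opnorm_scaleR_le: "opnorm (a *\<^sub>R A) \<le> \<bar>a\<bar> * opnorm A" for A :: "real^'n^'m"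
proof (rule opnorm_leI)
  fix x :: "real^'n"
  have "norm ((a *\<^sub>R A) *v x) = \<bar>a\<bar> * norm (A *v x)"
    by (simp add: scaleR_matrix_vector_assoc[symmetric])
  also have "\<dots> \<le> \<bar>a\<bar> * (opnorm A * norm x)"
    by (intro mult_left_mono norm_matrix_vector_le_opnorm) simp
  finally show "norm ((a *\<^sub>R A) *v x) \<le> \<bar>a\<bar> * opnorm A * norm x" by (simp add: mult.assoc)
qed

lemma opnorm_zero [simp]: "opnorm 0 = 0"
  by (rule antisym[OF opnorm_leI]) auto

lemma opnorm_sum_le: "opnorm (\<Sum>i\<in>I. A i) \<le> (\<Sum>i\<in>I. opnorm (A i))" for A :: "'i \<Rightarrow> real^'n^'m"
proof (induction I rule: infinite_finite_induct)
  case (insert i I)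
  then show ?case using opnorm_add_le[of "A i" "\<Sum>i\<in>I. A i"] by simp
qed simp_all

lemma opnorm_pos: "A \<noteq> 0 \<Longrightarrow> 0 < opnorm A" for A :: "real^'n^'m"
proof -
  assume "A \<noteq> 0"
  then obtain x where "A *v x \<noteq> 0" by (metis matrix_eq matrix_vector_mult_0)
  then have "0 < norm (A *v x)" by simp
  also have "\<dots> \<le> opnorm A * norm x" by (rule norm_matrix_vector_le_opnorm)
  finally show ?thesis using opnorm_nonneg[of A] by (metis less_eq_real_def less_irrefl mult_zero_left)
qed

text \<open>Apply \<open>A\<close> to its own row: the \<open>i\<close>-th component of the image is
  the squared norm of that row.\<close>

lemma norm_row_le_opnorm: "norm (A $ i) \<le> opnorm A" for A :: "real^'n^'m"
proof -
  have "norm (A $ i) * norm (A $ i) = (A *v (A $ i)) $ i"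
    by (simp add: matrix_vector_mul_component dot_square_norm power2_eq_square)
  also have "\<dots> \<le> norm (A *v (A $ i))" using component_le_norm_cart[of "A *v (A $ i)" i] by simp
  also have "\<dots> \<le> opnorm A * norm (A $ i)" by (rule norm_matrix_vector_le_opnorm)
  finally show ?thesis by (cases "norm (A $ i) = 0") auto
qed

lemma transpose_add: "transpose (A + B) = transpose A + transpose B"
  by (simp add: transpose_def vec_eq_iff)

lemma transpose_sum: "transpose (\<Sum>i\<in>I. A i) = (\<Sum>i\<in>I. transpose (A i))"
  by (simp add: transpose_def vec_eq_iff)

lemma mat_vector: "mat k *v v = k *\<^sub>R v" for v :: "real^'n"
  by (simp add: matrix_vector_mult_def mat_def vec_eq_iff if_distribR if_distrib[of "\<lambda>x. x * _"] sum.delta cong: if_cong)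

lemma matrix_vector_mult_minus: "A *v (- x) = - (A *v x)" for A :: "real^'p^'q"
  using matrix_vector_mult_diff_distrib[of A 0 x] by simp

lemma sum_matrix_vector: "(\<Sum>i\<in>I. A i) *v v = (\<Sum>i\<in>I. A i *v v)" for A :: "'i \<Rightarrow> real^'n^'m"
  by (induction I rule: infinite_finite_induct) (simp_all add: matrix_vector_mult_add_rdistrib)

lemma inner_transpose_vector: "(transpose A *v x) \<bullet> y = x \<bullet> (A *v y)" for A :: "real^'n^'m"
  by (simp add: transpose_matrix_vector dot_lmul_matrix)

lemma abs_inner_matrix_le: "\<bar>x \<bullet> (A *v y)\<bar> \<le> opnorm A * norm x * norm y" for A :: "real^'n^'m"
proof -
  have "\<bar>x \<bullet> (A *v y)\<bar> \<le> norm x * norm (A *v y)" by (rule Cauchy_Schwarz_ineq2)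
  also have "\<dots> \<le> norm x * (opnorm A * norm y)"
    by (intro mult_left_mono norm_matrix_vector_le_opnorm) simp
  finally show ?thesis by (simp add: algebra_simps)
qed

text \<open>Topological facts refer to the type class norm, the Lipschitz assumptions to the
  operator norm. This comparison, with a crude dimension factor, transfers continuity from one to
  the other.\<close>

lemma norm_le_opnorm_cart: "norm A \<le> real CARD('m) * opnorm A" for A :: "real^'n^'m"
proof -
  have "norm A \<le> (\<Sum>i\<in>UNIV. norm (A $ i))" by (simp add: norm_vec_def L2_set_le_sum)
  also have "\<dots> \<le> (\<Sum>i\<in>(UNIV::'m set). opnorm A)" by (intro sum_mono norm_row_le_opnorm)
  finally show ?thesis by simp
qed

lemma op_lipschitz_on_continuous:
  assumes "op_lipschitz_on L S A"
  shows "continuous_on S A"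
proof -
  have "(real CARD('c) * L)-lipschitz_on S A"
  proof (rule lipschitz_onI)
    show "0 \<le> real CARD('c) * L" using assms by (simp add: op_lipschitz_on_def)
    fix x y assume xy: "x \<in> S" "y \<in> S"
    have "dist (A x) (A y) \<le> real CARD('c) * opnorm (A x - A y)"
      unfolding dist_norm by (rule norm_le_opnorm_cart)
    also have "\<dots> \<le> real CARD('c) * (L * norm (x - y))"
      using assms xy by (intro mult_left_mono) (auto simp: op_lipschitz_on_def)
    finally show "dist (A x) (A y) \<le> real CARD('c) * L * dist x y" by (simp add: dist_norm mult.assoc)
  qed
  then show ?thesis by (rule lipschitz_on_continuous_on)
qed

section \<open>The Gram matrix of the Jacobian\<close>

text \<open>The Loewner bound is a quantitative full-rank condition on \<open>G\<close>: it makes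
  the Gram matrix invertible and bounds normal directions and multipliers by
  \<open>1 / sqrt \<kappa>\<close> times the norm of their data.\<close>

locale gram_bounds =
  fixes G :: "real^'d^'m" and \<kappa> :: real
  assumes kappa_pos: "\<kappa> > 0" and lower: "loewner_le (mat \<kappa>) (G ** transpose G)"
begin

lemma gram_form: "v \<bullet> ((G ** transpose G) *v w) = (transpose G *v v) \<bullet> (transpose G *v w)"
  by (simp add: inner_transpose_vector matrix_vector_mul_assoc[symmetric])

lemma norm_transpose_ge: "\<kappa> * (norm v)\<^sup>2 \<le> (norm (transpose G *v v))\<^sup>2"
proof -
  have "0 \<le> v \<bullet> ((G ** transpose G) *v v) - v \<bullet> (mat \<kappa> *v v)"
    using lower by (simp add: loewner_le_def matrix_vector_mult_diff_rdistrib inner_diff_right)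
  then show ?thesis by (simp add: mat_vector gram_form dot_square_norm)
qed

lemma invertible_gram: "invertible (G ** transpose G)"
proof -
  have "v = 0" if "(G ** transpose G) *v v = 0" for v
  proof -
    have "(norm (transpose G *v v))\<^sup>2 = 0" using gram_form[of v v] that by (simp add: dot_square_norm)
    then have "\<kappa> * (norm v)\<^sup>2 \<le> 0" using norm_transpose_ge[of v] by simp
    then show ?thesis using kappa_pos by (simp add: mult_le_0_iff)
  qed
  then show ?thesis
    unfolding invertible_left_inverse matrix_left_invertible_ker by blast
qed

lemma matrix_inv_gram:
  "(G ** transpose G) ** matrix_inv (G ** transpose G) = mat 1"
  "matrix_inv (G ** transpose G) ** (G ** transpose G) = mat 1"
proof -
  have "\<exists>B. (G ** transpose G) ** B = mat 1 \<and> B ** (G ** transpose G) = mat 1"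
    using invertible_gram by (simp add: invertible_def)
  from someI_ex[OF this] show
    "(G ** transpose G) ** matrix_inv (G ** transpose G) = mat 1"
    "matrix_inv (G ** transpose G) ** (G ** transpose G) = mat 1"
    by (simp_all add: matrix_inv_def)
qed

lemma gram_inverse: "(G ** transpose G) *v (matrix_inv (G ** transpose G) *v b) = b"
  by (simp only: matrix_vector_mul_assoc matrix_inv_gram matrix_vector_mul_lid)

lemma gram_inverse_left: "matrix_inv (G ** transpose G) *v ((G ** transpose G) *v b) = b"
  by (simp only: matrix_vector_mul_assoc matrix_inv_gram matrix_vector_mul_lid)

lemma gram_inj: "(G ** transpose G) *v a = (G ** transpose G) *v b \<Longrightarrow> a = b"
  by (rule box_equals[OF arg_cong[where f = "(*v) (matrix_inv (G ** transpose G))"] gram_inverse_left gram_inverse_left])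

lemma gram_vector: "(G ** transpose G) *v a = G *v (transpose G *v a)"
  by (simp add: matrix_vector_mul_assoc)

lemma G_normal_dir: "G *v normal_dir G b = - b"
  using gram_inverse[of b] by (simp add: normal_dir_def gram_vector matrix_vector_mult_minus)

text \<open>With \<open>y\<close> the inverse Gram matrix applied to \<open>b\<close>, the square of
  \<open>norm (transpose G *v y)\<close> equals \<open>y \<bullet> b\<close>. Cauchy-Schwarz and
  \<open>norm_transpose_ge\<close> bound it by that norm times
  \<open>norm b / sqrt \<kappa>\<close>, and one factor cancels.\<close>

lemma norm_normal_dir_le: "norm (normal_dir G b) \<le> norm b / sqrt \<kappa>"
proof -
  define y where "y = matrix_inv (G ** transpose G) *v b"
  let ?n = "norm (transpose G *v y)"
  have "?n\<^sup>2 = y \<bullet> b"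
    using gram_form[of y y] gram_inverse[of b] by (simp add: y_def dot_square_norm)
  also have "\<dots> \<le> norm y * norm b" by (rule norm_cauchy_schwarz)
  finally have 1: "?n\<^sup>2 \<le> norm y * norm b" .
  have "sqrt (\<kappa> * (norm y)\<^sup>2) \<le> sqrt (?n\<^sup>2)" using norm_transpose_ge by (rule real_sqrt_le_mono)
  then have "sqrt \<kappa> * norm y \<le> ?n" by (simp add: real_sqrt_mult)
  then have "norm y \<le> ?n / sqrt \<kappa>" using kappa_pos by (simp add: field_simps)
  then have "?n\<^sup>2 \<le> ?n / sqrt \<kappa> * norm b" using 1 by (meson mult_right_mono norm_ge_zero order_trans)
  then have "?n * ?n \<le> ?n * (norm b / sqrt \<kappa>)" by (simp add: power2_eq_square)
  then have "?n \<le> norm b / sqrt \<kappa>"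
    using kappa_pos by (cases "?n = 0") (simp, metis mult_le_cancel_left_pos norm_ge_zero less_eq_real_def)
  then show ?thesis by (simp add: normal_dir_def y_def)
qed

lemma multiplier_normal: "(G ** transpose G) *v multiplier G g = - (G *v g)"
  using gram_inverse[of "G *v g"] by (simp add: multiplier_def matrix_vector_mult_minus)

lemma G_residual: "G *v (g + transpose G *v multiplier G g) = 0"
  using multiplier_normal[of g] by (simp add: matrix_vector_right_distrib gram_vector)

text \<open>The residual at \<open>multiplier G g\<close> lies in the kernel of \<open>G\<close>,
  hence is orthogonal to the range of \<open>transpose G\<close>. So the multiplier solves the
  least-squares problem and the residual is the orthogonal projection of \<open>g\<close> onto the
  kernel. The case \<open>y = 0\<close> yields the norm bounds below, the general case a description
  of non-stationary points without matrix inverses.\<close>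

lemma residual_pythagoras:
  "(norm (g + transpose G *v y))\<^sup>2 =
   (norm (g + transpose G *v multiplier G g))\<^sup>2 + (norm (transpose G *v (y - multiplier G g)))\<^sup>2"
proof -
  let ?r = "g + transpose G *v multiplier G g" and ?t = "transpose G *v (y - multiplier G g)"
  have "?t \<bullet> ?r = 0" by (simp add: inner_transpose_vector G_residual)
  then have "(norm (?r + ?t))\<^sup>2 = (norm ?r)\<^sup>2 + (norm ?t)\<^sup>2"
    by (intro norm_add_Pythagorean) (simp add: orthogonal_def inner_commute)
  moreover have "g + transpose G *v y = ?r + ?t" by (simp add: matrix_vector_mult_diff_distrib)
  ultimately show ?thesis by (simp only:)
qed

lemma multiplier_diff: "multiplier G g - multiplier G h = multiplier G (g - h)"
  by (simp add: multiplier_def matrix_vector_mult_diff_distrib)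

lemma norm_residual_le: "norm (g + transpose G *v multiplier G g) \<le> norm g"
proof -
  have "(norm (g + transpose G *v multiplier G g))\<^sup>2 \<le> (norm g)\<^sup>2"
    using residual_pythagoras[of g 0] by simp
  then show ?thesis by (rule power2_le_imp_le) simp
qed

text \<open>Projections are nonexpansive, so a gradient error passes to the projected gradient
  without a constant.\<close>

lemma norm_residual_diff_le:
  "norm ((g + transpose G *v multiplier G g) - (h + transpose G *v multiplier G h)) \<le> norm (g - h)"
  using norm_residual_le[of "g - h"]
  by (simp add: multiplier_diff[symmetric] matrix_vector_mult_diff_distrib algebra_simps)

lemma norm_multiplier_le: "norm (multiplier G g) \<le> norm g / sqrt \<kappa>"
proof -
  let ?l = "multiplier G g"
  have "(norm (transpose G *v ?l))\<^sup>2 \<le> (norm g)\<^sup>2"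
    using residual_pythagoras[of g 0] by (simp add: matrix_vector_mult_minus)
  then have "sqrt (\<kappa> * (norm ?l)\<^sup>2) \<le> sqrt ((norm g)\<^sup>2)"
    using norm_transpose_ge[of ?l] by (intro real_sqrt_le_mono) linarith
  then show ?thesis using kappa_pos by (simp add: real_sqrt_mult field_simps)
qed

text \<open>Self-adjointness of the Gram matrix. For \<open>b\<close> the linearization error of the
  constraints, it shows that the first-order effect of the correction on the objective is the
  multiplier paired with \<open>b\<close>; this later supplies the constraint part of the Lagrangian
  Hessian.\<close>

lemma inner_normal_dir: "g \<bullet> normal_dir G b = multiplier G g \<bullet> b"
proof -
  let ?y = "matrix_inv (G ** transpose G) *v b"
  have "multiplier G g \<bullet> b = multiplier G g \<bullet> ((G ** transpose G) *v ?y)" by (simp add: gram_inverse)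
  also have "\<dots> = ((G ** transpose G) *v multiplier G g) \<bullet> ?y"
    unfolding gram_form using gram_form[of ?y "multiplier G g"] by (simp add: inner_commute)
  also have "\<dots> = - (g \<bullet> (transpose G *v ?y))"
    by (simp add: multiplier_normal inner_commute[of g] inner_transpose_vector) (simp add: inner_commute)
  finally show ?thesis by (simp add: normal_dir_def)
qed

end

section \<open>Smallest eigenvalues of symmetric matrices\<close>

lemma inner_symmetric_matrix:
  fixes A :: "real^'n^'n" assumes "transpose A = A" shows "x \<bullet> (A *v y) = y \<bullet> (A *v x)"
  by (metis assms inner_commute inner_transpose_vector)

text \<open>\<open>smallest_eigenvalue\<close> is a \<open>Min\<close>, which is informative only
  for finite sets. Choosing one eigenvector per eigenvalue gives an orthogonal, hence independent,
  hence finite family.\<close>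

lemma finite_eigenvalues:
  fixes A :: "real^'n^'n" assumes sym: "transpose A = A"
  shows "finite {t. \<exists>v. v \<noteq> 0 \<and> A *v v = t *\<^sub>R v}"
proof -
  let ?T = "{t. \<exists>v. v \<noteq> 0 \<and> A *v v = t *\<^sub>R v}"
  define e where "e t = (SOME v. v \<noteq> 0 \<and> A *v v = t *\<^sub>R v)" for t
  have e: "e t \<noteq> 0 \<and> A *v e t = t *\<^sub>R e t" if "t \<in> ?T" for t
    unfolding e_def by (rule someI_ex) (use that in blast)
  have orth: "e s \<bullet> e t = 0" if "s \<in> ?T" "t \<in> ?T" "s \<noteq> t" for s t
  proof -
    have "t * (e s \<bullet> e t) = s * (e s \<bullet> e t)"
      using inner_symmetric_matrix[OF sym, of "e s" "e t"] e that by (simp add: inner_commute)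
    then show ?thesis using that by simp
  qed
  have inj: "inj_on e ?T"
  proof (rule inj_onI)
    fix s t assume st: "s \<in> ?T" "t \<in> ?T" "e s = e t"
    then show "s = t" using orth[of s t] e[of t] by auto
  qed
  have "pairwise orthogonal (e ` ?T)"
    using orth by (auto simp: pairwise_def orthogonal_def)
  moreover have "0 \<notin> e ` ?T" using e by force
  ultimately have "independent (e ` ?T)" by (rule pairwise_orthogonal_independent)
  then have "finite (e ` ?T)" by (rule independent_imp_finite)
  then show ?thesis using inj by (simp add: finite_image_iff)
qed

text \<open>The quadratic form attains its infimum on the unit sphere. A minimizer is an
  eigenvector, since otherwise a move along the residual \<open>A *v v - t *\<^sub>R v\<close> would
  violate minimality.\<close>

lemma rayleigh_minimizer:
  fixes A :: "real^'n^'n" assumes sym: "transpose A = A"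
  obtains t v where "v \<noteq> 0" "A *v v = t *\<^sub>R v" "\<And>u. t * (norm u)\<^sup>2 \<le> u \<bullet> (A *v u)"
proof -
  have "compact (sphere (0::real^'n) 1)" "sphere (0::real^'n) 1 \<noteq> {}"
    by auto
  moreover have "continuous_on (sphere 0 1) (\<lambda>u. u \<bullet> (A *v u))"
    by (intro continuous_on_inner continuous_on_id linear_continuous_on matrix_vector_mul_bounded_linear)
  ultimately obtain v where v: "v \<in> sphere 0 1"
    and min: "\<And>u. u \<in> sphere 0 1 \<Longrightarrow> v \<bullet> (A *v v) \<le> u \<bullet> (A *v u)"
    using continuous_attains_inf[of "sphere 0 1" "\<lambda>u. u \<bullet> (A *v u)"] by blast
  define t where "t = v \<bullet> (A *v v)"
  have v1: "norm v = 1" "v \<noteq> 0" "v \<bullet> v = 1" using v by (auto simp: dot_square_norm)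
  have bound: "t * (norm u)\<^sup>2 \<le> u \<bullet> (A *v u)" for u
  proof (cases "u = 0")
    case False
    let ?w = "u /\<^sub>R norm u"
    have "t \<le> ?w \<bullet> (A *v ?w)" unfolding t_def by (rule min) (use False in simp)
    also have "\<dots> = (u \<bullet> (A *v u)) / (norm u)\<^sup>2"
      using False by (simp add: matrix_vector_mult_scaleR power2_eq_square field_simps)
    finally show ?thesis using False by (simp add: field_simps)
  qed simp
  have "A *v v = t *\<^sub>R v"
  proof (rule ccontr)
    define z where "z = A *v v - t *\<^sub>R v"
    assume "A *v v \<noteq> t *\<^sub>R v"
    then have z0: "z \<bullet> z > 0" by (simp add: z_def)
    define K where "K = z \<bullet> (A *v z) - t * (z \<bullet> z)"
    \<comment> \<open>Testing the Rayleigh bound at \<open>v + s *\<^sub>R z\<close> leaves a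
      quadratic in \<open>s\<close> without constant term and with linear coefficient
      \<open>2 * (z \<bullet> z)\<close>.\<close>
    have ineq: "0 \<le> 2 * s * (z \<bullet> z) + s\<^sup>2 * K" for s
    proof -
      have *: "t * (norm (v + s *\<^sub>R z))\<^sup>2 \<le> (v + s *\<^sub>R z) \<bullet> (A *v (v + s *\<^sub>R z))" by (rule bound)
      have a: "(v + s *\<^sub>R z) \<bullet> (A *v (v + s *\<^sub>R z)) = t + 2 * s * (z \<bullet> (A *v v)) + s\<^sup>2 * (z \<bullet> (A *v z))"
        using inner_symmetric_matrix[OF sym, of v z]
        by (simp add: t_def matrix_vector_right_distrib matrix_vector_mult_scaleR inner_add_left
            inner_add_right power2_eq_square distrib_left)
      have b: "(norm (v + s *\<^sub>R z))\<^sup>2 = 1 + 2 * s * (z \<bullet> v) + s\<^sup>2 * (z \<bullet> z)"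
        using v1 inner_commute[of v z]
        by (simp only: power2_norm_eq_inner inner_add_left inner_add_right inner_scaleR_left inner_scaleR_right)
          (simp add: power2_eq_square distrib_left)
      have "A *v v = z + t *\<^sub>R v" by (simp add: z_def)
      then have c: "z \<bullet> (A *v v) = z \<bullet> z + t * (z \<bullet> v)" by (simp add: inner_add_right)
      show ?thesis using * unfolding a b c K_def by (simp add: algebra_simps)
    qed
    \<comment> \<open>\<open>s = -1\<close> forces \<open>K\<close> to be positive; the quadratic is
      then negative at its minimizer \<open>- (z \<bullet> z) / K\<close>.\<close>
    have "K > 0" using ineq[of "-1"] z0 by (simp del: inner_gt_zero_iff)
    then have "2 * (- (z \<bullet> z) / K) * (z \<bullet> z) + (- (z \<bullet> z) / K)\<^sup>2 * K = - (z \<bullet> z)\<^sup>2 / K"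
      by (simp add: field_simps power2_eq_square)
    then have "0 \<le> - (z \<bullet> z)\<^sup>2 / K" using ineq[of "- (z \<bullet> z) / K"] by simp
    moreover have "(z \<bullet> z)\<^sup>2 / K > 0" using z0 \<open>K > 0\<close> by simp
    ultimately show False by simp
  qed
  then show ?thesis using that bound v1 by blast
qed

lemma smallest_eigenvalue_attained:
  fixes A :: "real^'n^'n" assumes sym: "transpose A = A"
  obtains v where "norm v = 1" "v \<bullet> (A *v v) = smallest_eigenvalue A"
proof -
  obtain t v where "v \<noteq> 0" "A *v v = t *\<^sub>R v" by (rule rayleigh_minimizer[OF sym])
  then have "smallest_eigenvalue A \<in> {t. \<exists>v. v \<noteq> 0 \<and> A *v v = t *\<^sub>R v}"
    unfolding smallest_eigenvalue_def by (intro Min_in finite_eigenvalues[OF sym]) auto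
  then obtain v where v: "v \<noteq> 0" "A *v v = smallest_eigenvalue A *\<^sub>R v" by auto
  let ?w = "v /\<^sub>R norm v"
  have "norm ?w = 1" using v by simp
  moreover have "A *v ?w = smallest_eigenvalue A *\<^sub>R ?w"
    by (simp add: matrix_vector_mult_scaleR v(2))
  ultimately have "?w \<bullet> (A *v ?w) = smallest_eigenvalue A" by (simp only: inner_scaleR_right dot_square_norm) simp
  with \<open>norm ?w = 1\<close> show ?thesis by (rule that)
qed

text \<open>The minimal Rayleigh value is itself an eigenvalue, so \<open>Min\<close> cannot exceed
  it.\<close>

lemma smallest_eigenvalue_le:
  fixes A :: "real^'n^'n" assumes sym: "transpose A = A" and u: "norm u = 1"
  shows "smallest_eigenvalue A \<le> u \<bullet> (A *v u)"
proof -
  obtain t v where "v \<noteq> 0" "A *v v = t *\<^sub>R v" and bound: "\<And>u. t * (norm u)\<^sup>2 \<le> u \<bullet> (A *v u)"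
    by (rule rayleigh_minimizer[OF sym]) blast
  then have "smallest_eigenvalue A \<le> t"
    unfolding smallest_eigenvalue_def by (intro Min_le finite_eigenvalues[OF sym]) auto
  then show ?thesis using bound[of u] u by simp
qed

section \<open>Calculus\<close>

text \<open>\<open>grad\<close> is a definite description, so existence and uniqueness are both
  needed: the adjoint of the derivative, applied to 1, represents it, and the inner product
  separates vectors.\<close>

lemma has_derivative_grad:
  assumes "f differentiable (at x)"
  shows "(f has_derivative (\<lambda>h. h \<bullet> grad f x)) (at x)"
proof -
  obtain f' where f': "(f has_derivative f') (at x)" using assms by (auto simp: differentiable_def)
  then have lin: "linear f'" by (rule has_derivative_linear)
  define D where "D = adjoint f' 1"
  have "f' h = h \<bullet> D" for h
    using adjoint_works[OF lin, of h 1] by (simp add: D_def)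
  then have "f' = (\<lambda>h. h \<bullet> D)" by blast
  then have D: "GDERIV f x :> D" using f' by (simp add: gderiv_def)
  have "GDERIV f x :> grad f x"
    unfolding grad_def
  proof (rule theI[of _ D])
    show "GDERIV f x :> D" by fact
    fix E assume "GDERIV f x :> E"
    then have "(\<lambda>h. h \<bullet> E) = (\<lambda>h. h \<bullet> D)"
      using D unfolding gderiv_def by (rule has_derivative_unique)
    then show "E = D" by (metis vector_eq_ldot)
  qed
  then show ?thesis by (simp add: gderiv_def)
qed

lemma grad_unique: "(f has_derivative (\<lambda>h. h \<bullet> D)) (at x) \<Longrightarrow> grad f x = D"
  using has_derivative_unique[OF has_derivative_grad, of f x "\<lambda>h. h \<bullet> D"]
  by (metis differentiable_def vector_eq_ldot)

lemma has_derivative_jac: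
  assumes "F differentiable (at x)"
  shows "(F has_derivative (\<lambda>h. jac F x *v h)) (at x)"
  using assms unfolding jac_def jacobian_works by (simp add: scalar_mult_eq_scaleR)

lemma grad_component:
  fixes c :: "real^'d \<Rightarrow> real^'m"
  assumes "c differentiable (at x)"
  shows "grad (\<lambda>y. c y $ i) x = jac c x $ i"
proof (rule grad_unique)
  have "((\<lambda>y. c y $ i) has_derivative (\<lambda>h. (jac c x *v h) $ i)) (at x)"
    using has_derivative_jac[OF assms]
    by (rule bounded_linear.has_derivative[OF bounded_linear_vec_nth])
  then show "((\<lambda>y. c y $ i) has_derivative (\<lambda>h. h \<bullet> jac c x $ i)) (at x)"
    by (simp add: matrix_vector_mul_component inner_commute)
qed

text \<open>Smoothness of the constraints is assumed for each component, whereas \<open>jac\<close>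
  refers to the vector-valued map.\<close>

lemma differentiable_components:
  fixes c :: "real^'d \<Rightarrow> real^'m"
  assumes "\<And>i. (\<lambda>y. c y $ i) differentiable (at x)"
  shows "c differentiable (at x)"
proof -
  have "((\<lambda>y. \<chi> i. c y $ i) has_derivative (\<lambda>h. \<chi> i. h \<bullet> grad (\<lambda>y. c y $ i) x)) (at x)"
  proof (subst has_derivative_componentwise_within, intro ballI)
    fix b :: "real^'m" assume "b \<in> Basis"
    then obtain i where b: "b = axis i 1" by (auto simp: Basis_vec_def)
    show "((\<lambda>y. (\<chi> i. c y $ i) \<bullet> b) has_derivative (\<lambda>h. (\<chi> i. h \<bullet> grad (\<lambda>y. c y $ i) x) \<bullet> b)) (at x)"
      using has_derivative_grad[OF assms, of i] by (simp add: b inner_axis)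
  qed
  then show ?thesis by (auto simp: differentiable_def)
qed

lemma norm_derivative_le_lipschitz:
  fixes F :: "'a::real_normed_vector \<Rightarrow> 'b::real_normed_vector"
  assumes "open S" "x \<in> S" "L-lipschitz_on S F" "(F has_derivative F') (at x)"
  shows "norm (F' h) \<le> L * norm h"
proof (rule field_le_epsilon)
  interpret F': bounded_linear F' using assms(4) by (rule has_derivative_bounded_linear)
  fix e :: real assume "e > 0"
  define e' where "e' = e / (norm h + 1)"
  have "e' > 0" using \<open>e > 0\<close> by (simp add: e'_def add_nonneg_pos)
  then obtain d where "d > 0"
    and d: "\<And>y. norm (y - x) < d \<Longrightarrow> norm (F y - F x - F' (y - x)) \<le> e' * norm (y - x)"
    using assms(4) unfolding has_derivative_at_alt by blast
  obtain d' where "d' > 0" and d': "ball x d' \<subseteq> S" using assms(1,2) open_contains_ball by blast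
  \<comment> \<open>This step keeps \<open>x + t *\<^sub>R h\<close> within both the linearization
    radius and the set; the added 1 covers \<open>h = 0\<close>.\<close>
  define t where "t = min d d' / (2 * (norm h + 1))"
  have t: "t > 0" using \<open>d > 0\<close> \<open>d' > 0\<close> by (simp add: t_def add_nonneg_pos)
  have "t * norm h < t * (2 * (norm h + 1))" using t by (intro mult_strict_left_mono) (auto intro: add_nonneg_pos)
  also have "\<dots> = min d d'" by (simp add: t_def add_nonneg_eq_0_iff)
  finally have th: "t * norm h < d" "t * norm h < d'" by auto
  have "x + t *\<^sub>R h \<in> S" using d' th t by (auto simp: dist_norm)
  then have "norm (F (x + t *\<^sub>R h) - F x) \<le> L * (t * norm h)"
    using lipschitz_onD[OF assms(3), of "x + t *\<^sub>R h" x] assms(2) t by (simp add: dist_norm)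
  moreover have "norm (F (x + t *\<^sub>R h) - F x - F' (t *\<^sub>R h)) \<le> e' * (t * norm h)"
    using d[of "x + t *\<^sub>R h"] th t by simp
  ultimately have "norm (F' (t *\<^sub>R h)) \<le> L * (t * norm h) + e' * (t * norm h)"
    by (smt (verit, best) norm_triangle_sub norm_minus_commute)
  then have "t * norm (F' h) \<le> t * ((L + e') * norm h)" using t by (simp add: F'.scaleR algebra_simps)
  then have "norm (F' h) \<le> (L + e') * norm h" using t by simp
  moreover have "e' * norm h \<le> e' * (norm h + 1)" using \<open>e' > 0\<close> by (intro mult_left_mono) auto
  moreover have "e' * (norm h + 1) = e" by (simp add: e'_def add_nonneg_eq_0_iff)
  ultimately show "norm (F' h) \<le> L * norm h + e" by (simp only: distrib_right)
qed

lemma opnorm_jac_le_lipschitz: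
  fixes F :: "real^'d \<Rightarrow> real^'m"
  assumes "open S" "x \<in> S" "L-lipschitz_on S F" "F differentiable (at x)"
  shows "opnorm (jac F x) \<le> L"
  using norm_derivative_le_lipschitz[OF assms(1-3) has_derivative_jac[OF assms(4)]]
  unfolding opnorm_def by (intro onorm_le) simp

text \<open>Mean value inequality for the linearization error along the segment. The constant is
  \<open>L\<close> rather than \<open>L / 2\<close>; only the order in the step length matters
  later.\<close>

lemma jac_taylor:
  fixes F :: "real^'d \<Rightarrow> real^'m"
  assumes S: "convex S" "x \<in> S" "y \<in> S" and diff: "\<And>z. z \<in> S \<Longrightarrow> F differentiable (at z)"
    and lip: "op_lipschitz_on L S (jac F)"
  shows "norm (F y - F x - jac F x *v (y - x)) \<le> L * (norm (y - x))\<^sup>2"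
proof -
  have seg: "closed_segment x y \<subseteq> S" using S by (simp add: closed_segment_subset)
  have "norm (F y - F x - jac F x *v (y - x)) \<le> norm (y - x) * (L * norm (y - x))"
  proof (rule differentiable_bound_linearization[where S = "closed_segment x y" and f' = "\<lambda>z h. jac F z *v h"])
    show "x + t *\<^sub>R (y - x) \<in> closed_segment x y" if "t \<in> {0..1}" for t
      using that by (auto simp: in_segment algebra_simps intro!: exI[of _ t])
    show "(F has_derivative (*v) (jac F z)) (at z within closed_segment x y)" if "z \<in> closed_segment x y" for z
      using has_derivative_at_withinI[OF has_derivative_jac[OF diff]] that seg by blast
    have "onorm ((*v) (jac F z - jac F x)) \<le> L * norm (y - x)" if "z \<in> closed_segment x y" for z
    proof -
      have "opnorm (jac F z - jac F x) \<le> L * norm (z - x)"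
        using lip that seg S by (auto simp: op_lipschitz_on_def)
      also have "\<dots> \<le> L * norm (y - x)"
        using lip segment_bound[OF that] by (intro mult_left_mono) (auto simp: op_lipschitz_on_def)
      finally show ?thesis by (simp add: opnorm_def)
    qed
    then show "onorm ((*v) (jac F z) - (*v) (jac F x)) \<le> L * norm (y - x)" if "z \<in> closed_segment x y" for z
      using that by (simp only: fun_diff_def matrix_vector_mult_diff_rdistrib[symmetric])
  qed auto
  then show ?thesis by (simp add: power2_eq_square algebra_simps)
qed

lemma mvt_segment:
  fixes f :: "real^'d \<Rightarrow> real"
  assumes "\<And>z. z \<in> closed_segment x y \<Longrightarrow> f differentiable (at z)"
  obtains t where "0 < t" "t < 1" "f y - f x = (y - x) \<bullet> grad f (x + t *\<^sub>R (y - x))"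
proof -
  let ?p = "\<lambda>t. x + t *\<^sub>R (y - x)"
  have p: "?p t \<in> closed_segment x y" if "0 \<le> t" "t \<le> 1" for t
    using that by (auto simp: in_segment algebra_simps intro!: exI[of _ t])
  have der: "((\<lambda>t. f (?p t)) has_derivative (\<lambda>s. s * ((y - x) \<bullet> grad f (?p t)))) (at t within {0..1})"
    if "0 \<le> t" "t \<le> 1" for t
  proof -
    have "(f has_derivative (\<lambda>h. h \<bullet> grad f (?p t))) (at (?p t))"
      using has_derivative_grad[OF assms[OF p[OF that]]] .
    then have "((\<lambda>t. f (?p t)) has_derivative (\<lambda>s. (s *\<^sub>R (y - x)) \<bullet> grad f (?p t))) (at t within {0..1})"
      by (rule has_derivative_compose[rotated]) (auto intro!: derivative_eq_intros)
    then show ?thesis by simp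
  qed
  obtain t where "0 < t" "t < 1" "f (?p 1) - f (?p 0) = (1 - 0) * ((y - x) \<bullet> grad f (?p t))"
    using mvt_simple[of 0 1 "\<lambda>t. f (?p t)", OF _ der] by auto
  then show ?thesis using that by simp
qed

lemma grad_taylor:
  fixes f :: "real^'d \<Rightarrow> real"
  assumes S: "convex S" "x \<in> S" "y \<in> S" and diff: "\<And>z. z \<in> S \<Longrightarrow> f differentiable (at z)"
    and lip: "L-lipschitz_on S (grad f)"
  shows "\<bar>f y - f x - grad f x \<bullet> (y - x)\<bar> \<le> L * (norm (y - x))\<^sup>2"
proof -
  have seg: "closed_segment x y \<subseteq> S" using S by (simp add: closed_segment_subset)
  obtain t where t: "0 < t" "t < 1" and eq: "f y - f x = (y - x) \<bullet> grad f (x + t *\<^sub>R (y - x))"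
    using mvt_segment[of x y f] diff seg by blast
  let ?z = "x + t *\<^sub>R (y - x)"
  have z: "?z \<in> S" using seg t by (auto simp: in_segment algebra_simps intro!: subsetD[OF seg] exI[of _ t])
  have "\<bar>f y - f x - grad f x \<bullet> (y - x)\<bar> = \<bar>(y - x) \<bullet> (grad f ?z - grad f x)\<bar>"
    by (simp add: eq inner_diff_right inner_commute)
  also have "\<dots> \<le> norm (y - x) * norm (grad f ?z - grad f x)" by (rule Cauchy_Schwarz_ineq2)
  also have "\<dots> \<le> norm (y - x) * (L * (t * norm (y - x)))"
    using lipschitz_onD[OF lip z S(2)] t by (intro mult_left_mono) (auto simp: dist_norm)
  also have "\<dots> \<le> norm (y - x) * (L * (1 * norm (y - x)))"
    using t lipschitz_on_nonneg[OF lip] by (intro mult_left_mono mult_right_mono) auto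
  finally show ?thesis by (simp add: power2_eq_square algebra_simps)
qed

lemma hess_taylor:
  fixes f :: "real^'d \<Rightarrow> real"
  assumes S: "convex S" "x \<in> S" "y \<in> S" and diff: "\<And>z. z \<in> S \<Longrightarrow> f differentiable (at z)"
    and diff2: "\<And>z. z \<in> S \<Longrightarrow> grad f differentiable (at z)"
    and lip: "op_lipschitz_on L S (hess f)"
  shows "\<bar>f y - f x - grad f x \<bullet> (y - x) - (y - x) \<bullet> (hess f x *v (y - x)) / 2\<bar> \<le> L * norm (y - x) ^ 3"
proof -
  let ?h = "y - x"
  let ?p = "\<lambda>t. x + t *\<^sub>R ?h"
  \<comment> \<open>The objective along the segment minus the first- and second-order terms of its
    Taylor polynomial. The derivative \<open>?q'\<close> is the linearization error of the gradient
    paired with \<open>?h\<close>, which \<open>jac_taylor\<close> bounds.\<close>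
  let ?q = "\<lambda>t. f (?p t) - t * (grad f x \<bullet> ?h) - t\<^sup>2 * (?h \<bullet> (hess f x *v ?h)) / 2"
  let ?q' = "\<lambda>t. ?h \<bullet> (grad f (?p t) - grad f x - hess f x *v (t *\<^sub>R ?h))"
  have L: "0 \<le> L" using lip by (simp add: op_lipschitz_on_def)
  have seg: "closed_segment x y \<subseteq> S" using S by (simp add: closed_segment_subset)
  have p: "?p t \<in> S" if "0 \<le> t" "t \<le> 1" for t
    by (rule subsetD[OF seg]) (use that in \<open>auto simp: in_segment algebra_simps intro!: exI[of _ t]\<close>)
  have der: "(?q has_derivative (\<lambda>s. s * ?q' t)) (at t within {0..1})" if "0 \<le> t" "t \<le> 1" for t
  proof -
    have "(f has_derivative (\<lambda>h. h \<bullet> grad f (?p t))) (at (?p t))"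
      using has_derivative_grad[OF diff[OF p[OF that]]] .
    then have [derivative_intros]:
      "((\<lambda>t. f (?p t)) has_derivative (\<lambda>s. (s *\<^sub>R ?h) \<bullet> grad f (?p t))) (at t within {0..1})"
      by (rule has_derivative_compose[rotated]) (auto intro!: derivative_eq_intros)
    have "(?q has_derivative (\<lambda>s. (s *\<^sub>R ?h) \<bullet> grad f (?p t) - s * (grad f x \<bullet> ?h)
        - (2 * s * t) * (?h \<bullet> (hess f x *v ?h)) / 2)) (at t within {0..1})"
      by (intro derivative_intros) (auto intro!: derivative_eq_intros)
    moreover have "(s *\<^sub>R h) \<bullet> b - s * (a \<bullet> h) - (2 * s * t) * (h \<bullet> (H *v h)) / 2
        = s * (h \<bullet> (b - a - H *v (t *\<^sub>R h)))" for s and h a b :: "real^'d" and H :: "real^'d^'d"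
      by (simp add: inner_diff_right matrix_vector_mult_scaleR inner_commute[of a] algebra_simps)
    ultimately show ?thesis by (simp only:)
  qed
  obtain t where t: "0 < t" "t < 1" "?q 1 - ?q 0 = (1 - 0) * ?q' t"
    using mvt_simple[of 0 1 ?q, OF _ der] by auto
  have "\<bar>?q' t\<bar> \<le> norm ?h * norm (grad f (?p t) - grad f x - hess f x *v (t *\<^sub>R ?h))"
    by (rule Cauchy_Schwarz_ineq2)
  also have "\<dots> \<le> norm ?h * (L * (norm (t *\<^sub>R ?h))\<^sup>2)"
    using jac_taylor[OF S(1,2) p, of t "grad f"] diff2 lip t
    by (intro mult_left_mono) (auto simp: hess_def[abs_def])
  also have "\<dots> = L * norm ?h ^ 3 * t\<^sup>2"
    by (simp add: power_mult_distrib power2_eq_square power3_eq_cube)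
  also have "\<dots> \<le> L * norm ?h ^ 3 * 1"
    using t L by (intro mult_left_mono) (auto simp: power_le_one)
  finally show ?thesis using t by simp
qed

text \<open>Schwarz's theorem: both orders of the second difference at scale \<open>t\<close> are \<open>t\<^sup>2\<close> times the
  respective mixed derivative up to \<open>o(t\<^sup>2)\<close>.\<close>

lemma second_difference_bound:
  fixes f :: "real^'d \<Rightarrow> real"
  assumes diff: "\<And>z. z \<in> ball x r \<Longrightarrow> f differentiable (at z)"
    and lin: "\<And>z. z \<in> ball x r \<Longrightarrow> norm (grad f z - grad f x - hess f x *v (z - x)) \<le> e * norm (z - x)"
    and small: "norm h + norm k < r"
  shows "\<bar>f (x + h + k) - f (x + h) - f (x + k) + f x - h \<bullet> (hess f x *v k)\<bar>
           \<le> 2 * e * (norm h + norm k)\<^sup>2"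
proof -
  let ?s = "norm h + norm k"
  let ?d = "\<lambda>z. grad f z - grad f x - hess f x *v (z - x)"
  have e: "0 \<le> e * norm (z - x)" if "z \<in> ball x r" for z using lin[OF that] norm_ge_zero order_trans by blast
  \<comment> \<open>The second difference is the increment of \<open>?g\<close> along
    \<open>h\<close>. The mean value theorem turns it into a difference of two gradients, each of
    which is replaced by its linearization at \<open>x\<close>.\<close>
  let ?g = "\<lambda>z. f (z + k) - f z"
  have near: "x + t *\<^sub>R h \<in> ball x r" "x + t *\<^sub>R h + k \<in> ball x r"
    "norm (t *\<^sub>R h) \<le> ?s" "norm (t *\<^sub>R h + k) \<le> ?s" if "0 \<le> t" "t \<le> 1" for t
  proof -
    have *: "norm (t *\<^sub>R h) \<le> norm h" using that by (simp add: mult_left_le_one_le)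
    then have "norm (t *\<^sub>R h + k) \<le> ?s" using norm_triangle_ineq[of "t *\<^sub>R h" k] by linarith
    moreover have "x - (x + t *\<^sub>R h + k) = - (t *\<^sub>R h + k)" by simp
    ultimately show "x + t *\<^sub>R h \<in> ball x r" "x + t *\<^sub>R h + k \<in> ball x r"
      "norm (t *\<^sub>R h) \<le> ?s" "norm (t *\<^sub>R h + k) \<le> ?s"
      using * small norm_ge_zero[of k]
      by (auto simp only: mem_ball dist_norm norm_minus_cancel) (simp del: norm_ge_zero; linarith)
  qed
  have der: "(?g has_derivative (\<lambda>u. u \<bullet> (grad f (z + k) - grad f z))) (at z)"
    if zin: "z \<in> closed_segment x (x + h)" for z
  proof -
    obtain t where t: "0 \<le> t" "t \<le> 1" "z = (1 - t) *\<^sub>R x + t *\<^sub>R (x + h)"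
      using zin by (auto simp: in_segment)
    then have "z = x + t *\<^sub>R h" by (simp add: algebra_simps)
    note t = t(1,2) this
    have "((\<lambda>z. f (z + k)) has_derivative (\<lambda>u. u \<bullet> grad f (z + k))) (at z)"
      by (rule has_derivative_compose[where g = f and f = "\<lambda>z. z + k" and f' = "\<lambda>u. u"])
        (use near[OF t(1,2)] diff t in \<open>auto intro!: derivative_eq_intros has_derivative_grad\<close>)
    moreover have "(f has_derivative (\<lambda>u. u \<bullet> grad f z)) (at z)"
      using near[OF t(1,2)] diff t by (intro has_derivative_grad) auto
    ultimately show ?thesis by (simp add: inner_diff_right has_derivative_diff)
  qed
  obtain t where t: "0 < t" "t < 1" and eq: "?g (x + h) - ?g x = (x + h - x) \<bullet> grad ?g (x + t *\<^sub>R (x + h - x))"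
    by (rule mvt_segment[of x "x + h" ?g]) (use der in \<open>auto simp: differentiable_def\<close>)
  have in_seg: "x + t *\<^sub>R h \<in> closed_segment x (x + h)"
    using t by (auto simp: in_segment algebra_simps intro!: exI[of _ t])
  have "?g (x + h) - ?g x = h \<bullet> (grad f (x + t *\<^sub>R h + k) - grad f (x + t *\<^sub>R h))"
    using eq grad_unique[OF der[OF in_seg]] by simp
  then have "f (x + h + k) - f (x + h) - f (x + k) + f x - h \<bullet> (hess f x *v k)
      = h \<bullet> (?d (x + t *\<^sub>R h + k) - ?d (x + t *\<^sub>R h))"
    by (simp add: inner_diff_right inner_add_right matrix_vector_right_distrib matrix_vector_mult_diff_distrib algebra_simps)
  then have "\<bar>f (x + h + k) - f (x + h) - f (x + k) + f x - h \<bullet> (hess f x *v k)\<bar>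
      \<le> norm h * norm (?d (x + t *\<^sub>R h + k) - ?d (x + t *\<^sub>R h))"
    by (simp only: Cauchy_Schwarz_ineq2)
  also have "\<dots> \<le> ?s * (e * ?s + e * ?s)"
  proof (intro mult_mono)
    have "norm (?d (x + t *\<^sub>R h + k)) \<le> e * norm (t *\<^sub>R h + k)"
      using lin[OF near(2)[of t]] t by (simp add: add.assoc)
    moreover have "norm (?d (x + t *\<^sub>R h)) \<le> e * norm (t *\<^sub>R h)"
      using lin[OF near(1)[of t]] t by simp
    moreover have "e * norm (t *\<^sub>R h + k) \<le> e * ?s \<and> e * norm (t *\<^sub>R h) \<le> e * ?s"
    proof (cases "0 \<le> e")
      case True
      then show ?thesis using near[of t] t by (simp add: mult_left_mono)
    next
      \<comment> \<open>No sign of \<open>e\<close> is assumed. A negative \<open>e\<close> makes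
        the linearization bound force every point of the ball to coincide with \<open>x\<close>, so
        that \<open>h\<close> and \<open>k\<close> vanish.\<close>
      case False
      have "h = 0" "k = 0"
      proof -
        have "norm (z - x) = 0" if "z \<in> ball x r" for z
          using e[OF that] False by (simp add: zero_le_mult_iff)
        moreover have "x + h \<in> ball x r" "x + k \<in> ball x r"
          using small norm_ge_zero[of h] norm_ge_zero[of k] by (auto simp: dist_norm simp del: norm_ge_zero)
        ultimately show "h = 0" "k = 0" by fastforce+
      qed
      then show ?thesis by simp
    qed
    ultimately show "norm (?d (x + t *\<^sub>R h + k) - ?d (x + t *\<^sub>R h)) \<le> e * ?s + e * ?s"
      using norm_triangle_ineq4[of "?d (x + t *\<^sub>R h + k)" "?d (x + t *\<^sub>R h)"] by linarith
  qed auto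
  finally show ?thesis by (simp add: power2_eq_square algebra_simps)
qed

lemma hess_form_symmetric:
  fixes f :: "real^'d \<Rightarrow> real"
  assumes S: "open S" "x \<in> S" and diff: "\<And>z. z \<in> S \<Longrightarrow> f differentiable (at z)"
    and diff2: "grad f differentiable (at x)"
  shows "h \<bullet> (hess f x *v k) = k \<bullet> (hess f x *v h)"
proof -
  let ?a = "h \<bullet> (hess f x *v k)" and ?b = "k \<bullet> (hess f x *v h)"
  let ?s = "norm h + norm k"
  have "\<bar>?a - ?b\<bar> \<le> 0 + e" if "e > 0" for e :: real
  proof -
    \<comment> \<open>Each order of differencing errs by \<open>2 * e'\<close> times the squared
      scale; after division by the square of \<open>t\<close> the two errors together stay below
      \<open>e\<close>.\<close>
    define e' where "e' = e / (4 * (?s\<^sup>2 + 1))"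
    have s1: "?s\<^sup>2 + 1 > 0" by (simp add: add_nonneg_pos)
    have "e' > 0" using \<open>e > 0\<close> s1 by (simp add: e'_def)
    then obtain d where "d > 0"
      and d: "\<And>z. norm (z - x) < d \<Longrightarrow> norm (grad f z - grad f x - hess f x *v (z - x)) \<le> e' * norm (z - x)"
      using has_derivative_jac[OF diff2] unfolding has_derivative_at_alt hess_def by blast
    obtain d' where "d' > 0" and d': "ball x d' \<subseteq> S" using S open_contains_ball by blast
    define r where "r = min d d'"
    define t where "t = r / (2 * (?s + 1))"
    have s2: "?s + 1 > 0" by (simp add: add_nonneg_pos)
    have r: "r > 0" using \<open>d > 0\<close> \<open>d' > 0\<close> by (simp add: r_def)
    then have t: "t > 0" using s2 by (simp add: t_def)
    have "t * ?s < t * (2 * (?s + 1))" using t s2 by (intro mult_strict_left_mono) auto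
    also have "\<dots> = r" using s2 by (simp add: t_def)
    finally have small: "norm (t *\<^sub>R h) + norm (t *\<^sub>R k) < r" using t by (simp add: algebra_simps)
    have 1: "f differentiable (at z)" if "z \<in> ball x r" for z
      using that d' diff by (auto simp: r_def)
    have 2: "norm (grad f z - grad f x - hess f x *v (z - x)) \<le> e' * norm (z - x)" if "z \<in> ball x r" for z
      using that d[of z] by (simp add: r_def dist_norm norm_minus_commute)
    let ?D = "f (x + t *\<^sub>R h + t *\<^sub>R k) - f (x + t *\<^sub>R h) - f (x + t *\<^sub>R k) + f x"
    have A: "\<bar>?D - t\<^sup>2 * ?a\<bar> \<le> 2 * e' * (t * ?s)\<^sup>2"
      using second_difference_bound[OF 1 2 small] t
      by (simp add: matrix_vector_mult_scaleR power2_eq_square algebra_simps)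
    have small': "norm (t *\<^sub>R k) + norm (t *\<^sub>R h) < r" using small by simp
    have B: "\<bar>?D - t\<^sup>2 * ?b\<bar> \<le> 2 * e' * (t * ?s)\<^sup>2"
      using second_difference_bound[OF 1 2 small'] t
      by (simp add: matrix_vector_mult_scaleR power2_eq_square algebra_simps)
    have "t\<^sup>2 * \<bar>?a - ?b\<bar> = \<bar>t\<^sup>2 * ?a - t\<^sup>2 * ?b\<bar>"
      by (simp add: right_diff_distrib[symmetric] abs_mult)
    also have "\<dots> \<le> 4 * e' * (t * ?s)\<^sup>2" using A B by linarith
    also have "\<dots> = t\<^sup>2 * (4 * e' * ?s\<^sup>2)" by (simp add: power_mult_distrib)
    finally have "\<bar>?a - ?b\<bar> \<le> 4 * e' * ?s\<^sup>2" using t by (simp add: mult_le_cancel_left_pos)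
    also have "\<dots> \<le> e" using \<open>e > 0\<close> s1 by (simp add: e'_def field_simps)
    finally show ?thesis by simp
  qed
  then have "\<bar>?a - ?b\<bar> \<le> 0" by (rule field_le_epsilon)
  then show ?thesis by simp
qed

lemma transpose_hess:
  fixes f :: "real^'d \<Rightarrow> real"
  assumes "open S" "x \<in> S" "\<And>z. z \<in> S \<Longrightarrow> f differentiable (at z)" "grad f differentiable (at x)"
  shows "transpose (hess f x) = hess f x"
proof -
  have "transpose (hess f x) *v h = hess f x *v h" for h
  proof (rule vector_eq_rdot[THEN iffD1, OF allI])
    fix k
    show "(transpose (hess f x) *v h) \<bullet> k = (hess f x *v h) \<bullet> k"
      unfolding inner_transpose_vector using hess_form_symmetric[OF assms, of h k] by (simp add: inner_commute)
  qed
  then show ?thesis by (simp add: matrix_eq)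
qed

section \<open>One iteration of the method\<close>

text \<open>With \<open>principal A\<close> as filter, Landau symbols express uniform bounds over
  the set \<open>A\<close> of iterations, so their calculus applies to the error terms of single
  iterations.\<close>

lemma bigo_principal:
  fixes X h :: "'a \<Rightarrow> real"
  shows "X \<in> O[principal A](h) \<longleftrightarrow> (\<exists>C>0. \<forall>s\<in>A. \<bar>X s\<bar> \<le> C * \<bar>h s\<bar>)"
  by (auto simp: bigo_def eventually_principal)

lemma bigo_principal_le:
  fixes X Y h :: "'a \<Rightarrow> real"
  assumes "Y \<in> O[principal A](h)" "\<And>s. s \<in> A \<Longrightarrow> \<bar>X s\<bar> \<le> Y s"
  shows "X \<in> O[principal A](h)"
  by (rule landau_o.big_trans[OF landau_o.big_mono assms(1)])
    (use assms(2) in \<open>auto simp: eventually_principal intro: order_trans[OF _ abs_ge_self]\<close>)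

lemma ratio_ge_of_model_error:
  fixes a p e :: real
  assumes "p < 0" "a - p \<le> (1 - e) * (- p)"
  shows "e \<le> a / p"
proof -
  have "a \<le> e * p" using assms(2) by (simp add: algebra_simps)
  then show ?thesis using assms(1) by (simp add: neg_le_divide_eq)
qed

lemma orthonormal_kernel_basisD:
  assumes "orthonormal_kernel_basis G Z"
  shows "(Z *v u) \<bullet> (Z *v w) = u \<bullet> w" "norm (Z *v u) = norm u" "G *v (Z *v u) = 0"
    and "G *v v = 0 \<Longrightarrow> \<exists>u. v = Z *v u"
proof -
  have inner: "(Z *v u) \<bullet> (Z *v w) = u \<bullet> w" for u w
    using assms by (simp add: orthonormal_kernel_basis_def inner_transpose_vector[symmetric] inner_commute
        matrix_vector_mul_assoc)
  then show "(Z *v u) \<bullet> (Z *v w) = u \<bullet> w" "norm (Z *v u) = norm u"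
    by (simp_all add: norm_eq_sqrt_inner)
  show "G *v (Z *v u) = 0" "G *v v = 0 \<Longrightarrow> \<exists>u. v = Z *v u"
    using assms by (auto simp: orthonormal_kernel_basis_def)
qed

lemma reduced_form: "u \<bullet> (reduced H Z *v u) = (Z *v u) \<bullet> (H *v (Z *v u))"
proof -
  have "reduced H Z *v u = transpose Z *v (H *v (Z *v u))"
    by (simp add: reduced_def matrix_vector_mul_assoc matrix_mul_assoc)
  then show ?thesis
    using inner_transpose_vector[of Z "H *v (Z *v u)" u] by (simp add: inner_commute)
qed

lemma transpose_reduced: "transpose H = H \<Longrightarrow> transpose (reduced H Z) = reduced H Z"
  by (simp add: reduced_def matrix_transpose_mul matrix_mul_assoc)

lemma neg_part_nonneg [simp]: "0 \<le> neg_part t"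
  by (simp add: neg_part_def)

lemma tau_bar_plus_nonneg [simp]: "0 \<le> tau_bar_plus P s"
  by (simp add: tau_bar_plus_def)

lemma component_norm_le:
  "norm (a :: 'a::real_inner) \<le> norm (a, b :: 'b::real_inner)" "norm b \<le> norm (a, b)"
  by (simp_all add: norm_Pair real_sqrt_sum_squares_ge1 real_sqrt_sum_squares_ge2)

text \<open>The rescaled norm \<open>n\<close> may vanish; division by zero then yields radius 0 and
  both bounds remain valid.\<close>

lemma scaled_component_le:
  assumes "0 \<le> D" "0 \<le> t" "t \<le> n" shows "D * t / n \<le> (D :: real)" "0 \<le> D * t / n"
proof -
  show "D * t / n \<le> D"
  proof (cases "n = 0")
    case False
    then have "n > 0" using assms by linarith
    then show ?thesis using assms by (simp add: pos_divide_le_eq mult_left_mono)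
  qed (use assms in simp)
  show "0 \<le> D * t / n" using assms by simp
qed

lemma norm_normal_step_le: "0 \<le> D \<Longrightarrow> norm (normal_step c s D) \<le> D"
  by (cases "normal_dir (jac c (it_x s)) (c (it_x s)) = 0")
    (auto simp: normal_step_def Let_def min_def field_simps)

text \<open>The normal and the tangential radius are each at most \<open>it_Delta s\<close>, and the
  null space basis acts isometrically. The factor 2 from the triangle inequality is
  harmless.\<close>

lemma norm_trial_step_le:
  assumes "trial_step_ok P c s" "orthonormal_kernel_basis (jac c (it_x s)) (it_Z s)" "0 \<le> it_Delta s"
  shows "norm (it_dx s) \<le> 2 * it_Delta s"
proof -
  have *: "norm (it_dx s) \<le> 2 * it_Delta s"
    if "it_dx s = normal_step c s D1 + it_Z s *v u" "norm u \<le> D2"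
      "0 \<le> D1" "D1 \<le> it_Delta s" "D2 \<le> it_Delta s" for D1 D2 u
    using norm_triangle_ineq[of "normal_step c s D1" "it_Z s *v u"] norm_normal_step_le[of D1 c s]
      orthonormal_kernel_basisD(2)[OF assms(2), of u] that by simp
  have tau: "0 \<le> tau_RS P s" by (simp add: tau_RS_def)
  show ?thesis
  proof (cases "is_gradient_step P c s")
    case True
    then show ?thesis
      unfolding is_gradient_step_def Let_def
      using scaled_component_le[OF assms(3) norm_ge_zero component_norm_le(2), of "c_RS c s" "gradx_RS c s"]
        scaled_component_le[OF assms(3) norm_ge_zero component_norm_le(1), of "gradx_RS c s" "c_RS c s"]
      by (auto simp: grad_RS_def intro!: *)
  next
    case False
    then have "is_eigen_step P c s" using assms(1) by (auto simp: trial_step_ok_def split: if_splits)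
    then show ?thesis
      unfolding is_eigen_step_def Let_def
      using scaled_component_le[OF assms(3) norm_ge_zero component_norm_le(1), of "c_RS c s" "tau_RS P s"]
        scaled_component_le[OF assms(3) tau, of "norm (c_RS c s, tau_RS P s)"]
        component_norm_le(2)[where b = "tau_RS P s" and a = "c_RS c s"] tau
      by (auto intro!: *)
  qed
qed

text \<open>The part of the assumptions that does not mention samples. \<open>\<mu>hat\<close> is a
  bare parameter without a sign condition; it enters through the set \<open>accurate\<close>, and
  error bounds use \<open>max 0 \<mu>hat\<close>.\<close>

locale storm_regularity =
  fixes P :: "'d::finite storm_params" and f :: "real^'d \<Rightarrow> real" and c :: "real^'d \<Rightarrow> real^'m::finite"
    and R :: reg_consts and \<Omega> :: "(real^'d) set" and \<mu>hat :: real
  assumes params: "valid_params P"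
    and domain: "open \<Omega>" "convex \<Omega>"
    and f_C2: "twice_cont_diff_on \<Omega> f" and f_lower: "\<And>x. x \<in> \<Omega> \<Longrightarrow> f_inf R \<le> f x"
    and lip_grad_f: "(L_grad_f R)-lipschitz_on \<Omega> (grad f)"
    and lip_hess_f: "op_lipschitz_on (L_hess_f R) \<Omega> (hess f)"
    and c_C2: "\<And>i. twice_cont_diff_on \<Omega> (\<lambda>x. c x $ i)"
    and lip_jac_c: "op_lipschitz_on (L_G R) \<Omega> (jac c)"
    and lip_hess_c: "\<And>i. op_lipschitz_on (L_hess_c R) \<Omega> (hess (\<lambda>x. c x $ i))"
    and constants_pos: "0 < kappa_c R" "0 < kappa_grad_f R" "0 < kappa_1G R"
begin

section \<open>Parameter ranges and smoothness on the domain\<close>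

lemma parameter_bounds:
  "alpha P = 0 \<or> alpha P = 1" "0 < eta P" "eta P < 1" "0 < kappa_fcd P" "kappa_fcd P \<le> 1"
  "0 < radius P" "0 < Delta_max P" "0 < kappa_h P" "0 < kappa_g P" "0 < kappa_f P" "1 < gamma P"
  "1 < rho P"
  "kappa_f P \<le> kappa_fcd P * eta P ^ 3 / (16 * max 1 (Delta_max P))"
  using params by (auto simp: valid_params_def)

lemma differentiability:
  assumes "x \<in> \<Omega>"
  shows "f differentiable (at x)" "grad f differentiable (at x)" "c differentiable (at x)"
    "(\<lambda>y. c y $ i) differentiable (at x)" "grad (\<lambda>y. c y $ i) differentiable (at x)"
  using assms f_C2 c_C2 by (auto simp: twice_cont_diff_on_def intro!: differentiable_components)

lemma grad_constraint: "x \<in> \<Omega> \<Longrightarrow> grad (\<lambda>y. c y $ i) x = jac c x $ i"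
  by (rule grad_component) (rule differentiability)

text \<open>A row of the Jacobian difference is dominated by its operator norm. This is what bounds
  the Hessians of the constraint components by \<open>L_G R\<close>.\<close>

lemma lip_grad_c: "(L_G R)-lipschitz_on \<Omega> (grad (\<lambda>y. c y $ i))"
proof (rule lipschitz_onI)
  show "0 \<le> L_G R" using lip_jac_c by (simp add: op_lipschitz_on_def)
  fix x y assume xy: "x \<in> \<Omega>" "y \<in> \<Omega>"
  have "dist (grad (\<lambda>y. c y $ i) x) (grad (\<lambda>y. c y $ i) y) = norm ((jac c x - jac c y) $ i)"
    using xy by (simp add: grad_constraint dist_norm)
  also have "\<dots> \<le> opnorm (jac c x - jac c y)" by (rule norm_row_le_opnorm)
  also have "\<dots> \<le> L_G R * dist x y" using lip_jac_c xy by (simp add: op_lipschitz_on_def dist_norm)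
  finally show "dist (grad (\<lambda>y. c y $ i) x) (grad (\<lambda>y. c y $ i) y) \<le> L_G R * dist x y" .
qed

lemma L_G_nonneg: "0 \<le> L_G R" and L_hess_f_nonneg: "0 \<le> L_hess_f R" and L_hess_c_nonneg: "0 \<le> L_hess_c R"
  and L_grad_f_nonneg: "0 \<le> L_grad_f R"
  using lip_jac_c lip_hess_f lip_hess_c lipschitz_on_nonneg[OF lip_grad_f]
  by (auto simp: op_lipschitz_on_def)

lemma opnorm_hess_f_le: "x \<in> \<Omega> \<Longrightarrow> opnorm (hess f x) \<le> L_grad_f R"
  unfolding hess_def by (rule opnorm_jac_le_lipschitz[OF domain(1) _ lip_grad_f]) (auto intro: differentiability)

lemma opnorm_hess_c_le: "x \<in> \<Omega> \<Longrightarrow> opnorm (hess (\<lambda>y. c y $ i) x) \<le> L_G R"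
  unfolding hess_def by (rule opnorm_jac_le_lipschitz[OF domain(1) _ lip_grad_c]) (auto intro: differentiability)

lemma transpose_add_constraint_hess:
  assumes "x \<in> \<Omega>" "transpose H = H"
  shows "transpose (add_constraint_hess H c l x) = add_constraint_hess H c l x"
proof -
  have "transpose (hess (\<lambda>y. c y $ i) x) = hess (\<lambda>y. c y $ i) x" for i
    using assms(1) by (intro transpose_hess[OF domain(1)]) (auto intro: differentiability)
  then show ?thesis
    by (simp add: add_constraint_hess_def transpose_add transpose_sum transpose_scalar assms(2))
qed

lemma transpose_hess_Lagr: "x \<in> \<Omega> \<Longrightarrow> transpose (hess_Lagr f c x) = hess_Lagr f c x"
  unfolding hess_Lagr_def
  by (intro transpose_add_constraint_hess transpose_hess[OF domain(1)]) (auto intro: differentiability)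

text \<open>The facts that hold for each iteration on every path, as a predicate on a single record.
  Estimates stated for such records are automatically uniform over indices and samples.\<close>

definition regular_iter :: "('d, 'z::finite) storm_iter \<Rightarrow> bool" where
  "regular_iter s \<longleftrightarrow>
     it_x s \<in> \<Omega> \<and> (computes_trial P c s \<longrightarrow> trial_point s \<in> \<Omega>) \<and>
     (computes_soc P c s \<longrightarrow> soc_point c s \<in> \<Omega>) \<and>
     norm (c (it_x s)) \<le> kappa_c R \<and> norm (grad f (it_x s)) \<le> kappa_grad_f R \<and>
     loewner_le (mat (kappa_1G R)) (jac c (it_x s) ** transpose (jac c (it_x s))) \<and>
     (alpha P = 0 \<longrightarrow> opnorm (it_Hb s) \<le> kappa_B R) \<and>
     0 < it_Delta s \<and> it_Delta s \<le> Delta_max P \<and> 0 < it_eps s \<and> 0 < it_mu s \<and>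
     iteration_ok P c s"

lemma regular_iterD:
  assumes "regular_iter s"
  shows "it_x s \<in> \<Omega>" "computes_trial P c s \<Longrightarrow> trial_point s \<in> \<Omega>"
    "computes_soc P c s \<Longrightarrow> soc_point c s \<in> \<Omega>"
    "norm (c (it_x s)) \<le> kappa_c R" "norm (grad f (it_x s)) \<le> kappa_grad_f R"
    "gram_bounds (jac c (it_x s)) (kappa_1G R)"
    "alpha P = 0 \<Longrightarrow> opnorm (it_Hb s) \<le> kappa_B R"
    "0 < it_Delta s" "it_Delta s \<le> Delta_max P" "0 < it_eps s" "0 < it_mu s"
    "orthonormal_kernel_basis (jac c (it_x s)) (it_Z s)"
    "computes_trial P c s \<Longrightarrow> trial_step_ok P c s" "computes_trial P c s \<Longrightarrow> merit_update P c s"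
    "alpha P = 1 \<Longrightarrow> transpose (it_Hfb s) = it_Hfb s"
    "alpha P = 1 \<Longrightarrow> it_Hb s = add_constraint_hess (it_Hfb s) c (lambda_bar c s) (it_x s)"
  using assms constants_pos
  by (auto simp: regular_iter_def gram_bounds_def iteration_ok_def estimates_ok_def)

lemma Delta_power_le:
  assumes "regular_iter s" shows "it_Delta s ^ (alpha P + 2) \<le> max 1 (Delta_max P) * it_Delta s ^ 2"
proof -
  have "it_Delta s ^ alpha P \<le> max 1 (Delta_max P)"
    using parameter_bounds(1) regular_iterD(9)[OF assms] by auto
  then show ?thesis unfolding power_add by (intro mult_right_mono) auto
qed

lemma pred_le_measures:
  assumes s: "regular_iter s" and trial: "computes_trial P c s"
  shows "Pred c s \<le> - (kappa_fcd P / 2) * grad_measure c s"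
    "Pred c s \<le> - (kappa_fcd P / 2) * eigen_measure P c s"
    "0 < opnorm (it_Hb s)"
proof -
  have "sufficient_pred P c s (it_mu s)"
    using regular_iterD(14)[OF s trial] by (auto simp: merit_update_def)
  then have *: "Pred c s \<le> - (kappa_fcd P / 2) * max (grad_measure c s) (eigen_measure P c s)"
    by (simp add: sufficient_pred_def)
  have mono: "kappa_fcd P / 2 * a \<le> kappa_fcd P / 2 * b" if "a \<le> b" for a b
    using parameter_bounds that by (intro mult_left_mono) auto
  from * mono[OF max.cobounded1, of "grad_measure c s" "eigen_measure P c s"]
    mono[OF max.cobounded2, of "eigen_measure P c s" "grad_measure c s"]
  show "Pred c s \<le> - (kappa_fcd P / 2) * grad_measure c s"
    "Pred c s \<le> - (kappa_fcd P / 2) * eigen_measure P c s" by auto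
  show "0 < opnorm (it_Hb s)"
    using regular_iterD(13)[OF s trial] by (auto simp: trial_step_ok_def intro: opnorm_pos)
qed

text \<open>The trial test succeeds for one of two reasons. Through the gradient, both factors of
  \<open>grad_measure\<close> are at least \<open>eta P * it_Delta s\<close>. Through the curvature,
  which forces \<open>alpha P = 1\<close>, \<open>eigen_measure\<close> is at least
  \<open>eta P * it_Delta s ^ 3\<close>. Division by \<open>max 1 (Delta_max P)\<close> merges both
  into the power \<open>alpha P + 2\<close>; the third factor \<open>eta P\<close> is the acceptance
  ratio.\<close>

lemma pred_decrease:
  assumes s: "regular_iter s" and trial: "computes_trial P c s"
  shows "eta P * Pred c s \<le> - (kappa_fcd P * eta P ^ 3 * it_Delta s ^ (alpha P + 2) / max 1 (Delta_max P)) / 2"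
proof -
  define D where "D = max 1 (Delta_max P)"
  define d where "d = it_Delta s"
  have D: "D \<ge> 1" "d \<le> D" "d > 0" using regular_iterD(8,9)[OF s] by (auto simp: D_def d_def)
  note pb = parameter_bounds
  have eta_sq: "eta P ^ 2 \<le> eta P" using pb by (simp add: power2_eq_square mult_left_le)
  have "kappa_fcd P / 2 * (eta P ^ 2 * d ^ (alpha P + 2) / D) \<le> - Pred c s"
  proof (cases "norm (grad_bar c s) / max 1 (opnorm (it_Hb s)) \<ge> eta P * d")
    case True
    have Hpos: "0 < opnorm (it_Hb s)" by (rule pred_le_measures[OF s trial])
    let ?n = "norm (grad_bar c s)"
    have n1: "eta P * d * max 1 (opnorm (it_Hb s)) \<le> ?n" using True by (simp add: field_simps)
    have "eta P * d * 1 \<le> eta P * d * max 1 (opnorm (it_Hb s))"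
      using pb D by (intro mult_left_mono) auto
    then have n2: "eta P * d \<le> ?n" using n1 by simp
    have "eta P * d * opnorm (it_Hb s) \<le> eta P * d * max 1 (opnorm (it_Hb s))"
      using pb D by (intro mult_left_mono) auto
    then have "eta P * d \<le> ?n / opnorm (it_Hb s)" using n1 Hpos by (simp add: pos_le_divide_eq)
    moreover have "eta P * d \<le> d" using pb D by (simp add: mult_left_le_one_le)
    ultimately have n3: "eta P * d \<le> min d (?n / opnorm (it_Hb s))" by simp
    have "eta P ^ 2 * d ^ (alpha P + 2) / D \<le> eta P ^ 2 * d ^ 2"
      using Delta_power_le[OF s] pb D by (simp add: field_simps D_def d_def mult_left_mono)
    also have "\<dots> = (eta P * d) * (eta P * d)" by (simp add: power2_eq_square algebra_simps)
    also have "\<dots> \<le> grad_measure c s"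
      unfolding grad_measure_def d_def[symmetric] using n2 n3 pb D by (intro mult_mono) auto
    finally have "kappa_fcd P / 2 * (eta P ^ 2 * d ^ (alpha P + 2) / D) \<le> kappa_fcd P / 2 * grad_measure c s"
      using pb by (intro mult_left_mono) auto
    then show ?thesis using pred_le_measures(1)[OF s trial] by linarith
  next
    case False
    then have tau: "tau_bar_plus P s \<ge> eta P * d"
      using trial by (simp add: computes_trial_def d_def le_max_iff_disj)
    moreover have "eta P * d > 0" using pb D by simp
    ultimately have a1: "alpha P = 1" by (auto simp: tau_bar_plus_def split: if_splits)
    have "eta P ^ 2 * d ^ (alpha P + 2) / D \<le> eta P ^ 2 * d ^ (alpha P + 2) / 1"
      using D pb by (intro divide_left_mono) auto
    also have "\<dots> \<le> eta P * d ^ 3" using a1 eta_sq D by (simp add: mult_right_mono eval_nat_numeral)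
    also have "\<dots> = (eta P * d) * d * (d + 0)" by (simp add: power3_eq_cube)
    also have "\<dots> \<le> eigen_measure P c s"
      unfolding eigen_measure_def d_def[symmetric] using tau pb D by (intro mult_mono) auto
    finally have "kappa_fcd P / 2 * (eta P ^ 2 * d ^ (alpha P + 2) / D) \<le> kappa_fcd P / 2 * eigen_measure P c s"
      using pb by (intro mult_left_mono) auto
    then show ?thesis using pred_le_measures(2)[OF s trial] by linarith
  qed
  then have "eta P * (kappa_fcd P / 2 * (eta P ^ 2 * d ^ (alpha P + 2) / D)) \<le> eta P * (- Pred c s)"
    using pb by (intro mult_left_mono) auto
  moreover have "eta P * (kappa_fcd P / 2 * (eta P ^ 2 * d ^ (alpha P + 2) / D))
      = (kappa_fcd P * eta P ^ 3 * d ^ (alpha P + 2) / D) / 2"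
    by (simp add: power2_eq_square power3_eq_cube mult_ac)
  ultimately show ?thesis by (simp add: D_def d_def)
qed

lemma Pred_neg:
  assumes s: "regular_iter s" and trial: "computes_trial P c s"
  shows "Pred c s < 0"
proof -
  define y where "y = kappa_fcd P * eta P ^ 3 * it_Delta s ^ (alpha P + 2) / max 1 (Delta_max P)"
  have "0 < y"
    unfolding y_def using parameter_bounds regular_iterD(8)[OF s] by (intro divide_pos_pos mult_pos_pos) auto
  then have "eta P * Pred c s < 0" using pred_decrease[OF s trial, folded y_def] by linarith
  then show ?thesis using parameter_bounds by (simp add: mult_less_0_iff)
qed

subsection \<open>Decrease of the Lyapunov function\<close>

text \<open>Errors within the tolerance are absorbed by the decrease itself, so only accepted steps
  with inaccurate values are charged. The two summands are never nonzero together, by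
  \<open>trial_soc_exclusive\<close>.\<close>

definition accepted_error :: "('d, 'z::finite) storm_iter \<Rightarrow> real" where
  "accepted_error s =
     (if accepts_trial P c s \<and> \<not> event_C P f c s then err_f P f c s + err_fs P f c s else 0)
     + (if accepts_soc P c s \<and> \<not> event_C' P f c s then err_f P f c s + err_soc P f c s else 0)"

lemma trial_soc_exclusive: "accepts_soc P c s \<Longrightarrow> \<not> accepts_trial P c s"
  by (auto simp: accepts_soc_def accepts_trial_def computes_soc_def)

text \<open>Acceptance bounds the estimated reduction by \<open>eta P * Pred c s\<close>; passing to
  true values costs two errors. The upper bound on \<open>kappa_f\<close> makes each accurate error
  at most \<open>y / 16\<close>; inaccurate ones are kept in \<open>accepted_error\<close>.\<close>

lemma merit_decrease:
  fixes s s' :: "('d, 'z::finite) storm_iter"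
  assumes s: "regular_iter s" and trans: "transition P c s s'"
    and acc: "accepts_trial P c s \<or> accepts_soc P c s"
  shows "f (it_x s') - f (it_x s) + it_mu s * (norm (c (it_x s')) - norm (c (it_x s)))
    \<le> eta P * Pred c s + kappa_fcd P * eta P ^ 3 * it_Delta s ^ (alpha P + 2) / max 1 (Delta_max P) / 8
      + accepted_error s"
proof -
  define y where "y = kappa_fcd P * eta P ^ 3 * it_Delta s ^ (alpha P + 2) / max 1 (Delta_max P)"
  have trial: "computes_trial P c s" using acc by (auto simp: accepts_trial_def accepts_soc_def computes_soc_def)
  have neg: "Pred c s < 0" by (rule Pred_neg[OF s trial])
  have "kappa_f P * it_Delta s ^ (alpha P + 2)
      \<le> kappa_fcd P * eta P ^ 3 / (16 * max 1 (Delta_max P)) * it_Delta s ^ (alpha P + 2)"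
    using parameter_bounds regular_iterD(8)[OF s] by (intro mult_right_mono) auto
  then have noise: "kappa_f P * it_Delta s ^ (alpha P + 2) \<le> y / 16" by (simp add: y_def)
  have y: "0 \<le> y" using parameter_bounds regular_iterD(8)[OF s] by (simp add: y_def)
  have *: "f z - f (it_x s) + it_mu s * (norm (c z) - norm (c (it_x s))) \<le> eta P * Pred c s + (e1 + e2)"
    if "actual_red c s z fz / Pred c s \<ge> eta P" "\<bar>it_fb s - f (it_x s)\<bar> = e1" "\<bar>fz - f z\<bar> = e2"
    for z fz e1 e2
  proof -
    have "actual_red c s z fz \<le> eta P * Pred c s" using that neg by (simp add: neg_le_divide_eq)
    then show ?thesis using that unfolding actual_red_def by (simp add: abs_real_def split: if_splits)
  qed
  show ?thesis
  proof (cases "accepts_trial P c s")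
    case True
    then have soc: "\<not> accepts_soc P c s" using trial_soc_exclusive by blast
    have x': "it_x s' = trial_point s" using trans True by (simp add: transition_def)
    have "actual_red c s (trial_point s) (it_fsb s) / Pred c s \<ge> eta P"
      using True by (simp add: accepts_trial_def)
    from *[OF this refl refl]
    have dec: "f (it_x s') - f (it_x s) + it_mu s * (norm (c (it_x s')) - norm (c (it_x s)))
        \<le> eta P * Pred c s + (err_f P f c s + err_fs P f c s)"
      using trial by (simp add: x' err_f_def err_fs_def)
    show ?thesis
    proof (cases "event_C P f c s")
      case C: True
      then have "err_f P f c s + err_fs P f c s \<le> y / 8"
        using noise trial by (simp add: event_C_def)
      then show ?thesis using dec C soc by (simp add: accepted_error_def y_def)
    next
      case False
      then show ?thesis using dec soc True y by (simp add: accepted_error_def y_def)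
    qed
  next
    case False
    then have soc: "accepts_soc P c s" using acc by simp
    then have csoc: "computes_soc P c s" by (simp add: accepts_soc_def)
    have x': "it_x s' = soc_point c s" using trans False soc by (simp add: transition_def)
    have "actual_red c s (soc_point c s) (it_fsb_soc s) / Pred c s \<ge> eta P"
      using soc by (simp add: accepts_soc_def)
    from *[OF this refl refl]
    have dec: "f (it_x s') - f (it_x s) + it_mu s * (norm (c (it_x s')) - norm (c (it_x s)))
        \<le> eta P * Pred c s + (err_f P f c s + err_soc P f c s)"
      using trial csoc by (simp add: x' err_f_def err_soc_def)
    show ?thesis
    proof (cases "event_C' P f c s")
      case C: True
      then have "err_f P f c s + err_soc P f c s \<le> y / 8"
        using noise csoc by (simp add: event_C'_def)
      then show ?thesis using dec C soc False by (simp add: accepted_error_def y_def)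
    next
      case C: False
      then show ?thesis using dec soc False y by (simp add: accepted_error_def y_def)
    qed
  qed
qed

text \<open>Half of the predicted decrease, less the tolerated function-value errors, is at least \<open>2 \<gamma>\<^sup>3\<close> times
  this weight times \<open>\<Delta>\<^sup>\<alpha>\<^sup>+\<^sup>2\<close> when scaled by \<open>\<nu>\<close>, which pays for the growth of the radius; the other half pays
  for the growth of \<open>\<epsilon>\<close>.\<close>

definition radius_weight :: "real \<Rightarrow> real" where
  "radius_weight \<nu> = \<nu> * kappa_fcd P * eta P ^ 3 / (16 * max 1 (Delta_max P) * gamma P ^ 3)"

text \<open>Rejection fixes the iterate and shrinks the radius and \<epsilon>. Upon acceptance, half
  of \<open>\<nu> * (eta P * Pred c s)\<close> covers the growth of \<epsilon>. The other half is at
  most \<open>- \<nu> * y / 4\<close>, split equally between the tolerated errors and the growth of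
  the radius.\<close>

lemma lyapunov_step:
  fixes s s' :: "('d, 'z::finite) storm_iter"
  assumes s: "regular_iter s" and trans: "transition P c s s'"
    and nu: "0 < \<nu>" "\<nu> < 1" "\<nu> / (1 - \<nu>) \<ge> 2 * gamma P / eta P"
  shows "\<nu> * (f (it_x s') - f (it_x s) + it_mu s * (norm (c (it_x s')) - norm (c (it_x s))))
      + radius_weight \<nu> * (it_Delta s' ^ (alpha P + 2) - it_Delta s ^ (alpha P + 2))
      + (1 - \<nu>) * (it_eps s' - it_eps s)
    \<le> - (1 - 1 / gamma P) * (radius_weight \<nu> * it_Delta s ^ (alpha P + 2) + (1 - \<nu>) * it_eps s)
      + \<nu> * accepted_error s"
proof -
  note pb = parameter_bounds
  define g where "g = gamma P"
  define d where "d = it_Delta s ^ (alpha P + 2)"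
  define d' where "d' = it_Delta s' ^ (alpha P + 2)"
  define a where "a = radius_weight \<nu>"
  define b where "b = 1 - \<nu>"
  define y where "y = kappa_fcd P * eta P ^ 3 * d / max 1 (Delta_max P)"
  have g: "g > 1" "0 < 1 / g" "1 / g < 1" using pb by (auto simp: g_def)
  have d: "d > 0" using regular_iterD(8)[OF s] by (simp add: d_def)
  have a: "a > 0" using pb nu by (simp add: a_def radius_weight_def)
  have b: "b > 0" using nu by (simp add: b_def)
  have eps: "it_eps s > 0" using regular_iterD(10)[OF s] .
  have ratio: "2 * g * b \<le> \<nu> * eta P"
    using nu pb by (simp add: b_def g_def pos_divide_le_eq pos_le_divide_eq mult_ac)
  show ?thesis
  proof (cases "accepts_trial P c s \<or> accepts_soc P c s")
    case False
    then have s': "it_x s' = it_x s" "it_Delta s' = it_Delta s / g" "it_eps s' = it_eps s / g"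
      using trans by (auto simp: transition_def g_def)
    have "accepted_error s = 0" using False by (auto simp: accepted_error_def)
    moreover have "a * (d' - d) \<le> - (1 - 1 / g) * (a * d)"
    proof -
      have "d' = d * (1 / g) ^ (alpha P + 2)"
        unfolding d'_def s' d_def by (simp only: power_divide) simp
      also have "\<dots> \<le> d * (1 / g) ^ 1" using g d by (intro mult_left_mono power_decreasing) auto
      finally have "a * d' \<le> a * (d * (1 / g))" using a by (intro mult_left_mono) auto
      then show ?thesis by (simp add: algebra_simps)
    qed
    moreover have "b * (it_eps s' - it_eps s) = - (1 - 1 / g) * (b * it_eps s)"
      by (simp add: s' algebra_simps)
    ultimately show ?thesis
      unfolding a_def[symmetric] b_def[symmetric] d_def[symmetric] d'_def[symmetric] g_def[symmetric]
      by (simp only: s'(1) distrib_left diff_self mult_zero_right add_0_left add_0_right)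
  next
    case True
    then have trial: "computes_trial P c s" by (auto simp: accepts_trial_def accepts_soc_def computes_soc_def)
    have s': "it_Delta s' = min (g * it_Delta s) (Delta_max P)"
      "it_eps s' = (if - Pred c s \<ge> it_eps s then g * it_eps s else it_eps s / g)"
      using trans True by (auto simp: transition_def g_def)
    have pred: "eta P * Pred c s \<le> - y / 2"
      using pred_decrease[OF s trial] by (simp add: y_def d_def)
    have merit: "f (it_x s') - f (it_x s) + it_mu s * (norm (c (it_x s')) - norm (c (it_x s)))
        \<le> eta P * Pred c s + y / 8 + accepted_error s"
      using merit_decrease[OF s trans True] by (simp add: y_def d_def)
    have y: "y * \<nu> = 16 * g ^ 3 * a * d"
      using g pb by (simp add: y_def a_def radius_weight_def g_def field_simps)
    have rad: "a * (d' - d) + (1 - 1 / g) * (a * d) \<le> \<nu> * y / 8"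
    proof -
      have "d' \<le> (g * it_Delta s) ^ (alpha P + 2)"
        using g regular_iterD(8)[OF s] pb unfolding d'_def by (intro power_mono) (auto simp: s')
      also have "\<dots> = g ^ (alpha P + 2) * d" by (simp add: d_def power_mult_distrib)
      also have "\<dots> \<le> g ^ 3 * d" using g d pb by (intro mult_right_mono power_increasing) auto
      finally have 1: "a * d' \<le> a * (g ^ 3 * d)" using a by (intro mult_left_mono) auto
      have "a * d * 0 \<le> a * d * (1 / g)" using a d g by (intro mult_left_mono) auto
      then have 2: "0 \<le> a * d / g" by simp
      have 3: "0 \<le> a * (g ^ 3 * d)" using a d g by simp
      show ?thesis using 1 2 3 y by (simp add: algebra_simps)
    qed
    \<comment> \<open>\<epsilon> grows only in reliable iterations, where it is at most
      \<open>- Pred c s\<close>; \<open>ratio\<close> converts its growth into half of the weighted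
      predicted reduction.\<close>
    have rel: "b * (it_eps s' - it_eps s) + (1 - 1 / g) * (b * it_eps s) \<le> - \<nu> * (eta P * Pred c s) / 2"
    proof (cases "- Pred c s \<ge> it_eps s")
      case True
      then have eps': "it_eps s' = g * it_eps s" by (simp add: s')
      have "b * (g * it_eps s - it_eps s) + (1 - 1 / g) * (b * it_eps s) = b * g * it_eps s - b * it_eps s / g"
        by (simp add: algebra_simps)
      also have "\<dots> \<le> b * g * it_eps s" using b g eps by simp
      also have "\<dots> \<le> (\<nu> * eta P / 2) * it_eps s" using ratio eps by (intro mult_right_mono) (auto simp: mult_ac)
      also have "\<dots> \<le> (\<nu> * eta P / 2) * (- Pred c s)" using True nu pb by (intro mult_left_mono) auto
      finally show ?thesis by (simp add: eps' algebra_simps)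
    next
      case False
      then have eps': "it_eps s' = it_eps s / g" using s' by simp
      have "Pred c s < 0" by (rule Pred_neg[OF s trial])
      then have "0 \<le> - \<nu> * (eta P * Pred c s) / 2" using nu pb by (simp add: mult_nonneg_nonpos)
      moreover have "b * (it_eps s / g - it_eps s) + (1 - 1 / g) * (b * it_eps s) = 0"
        by (simp add: algebra_simps)
      ultimately show ?thesis by (simp add: eps')
    qed
    have "\<nu> * (f (it_x s') - f (it_x s) + it_mu s * (norm (c (it_x s')) - norm (c (it_x s))))
        \<le> \<nu> * (eta P * Pred c s + y / 8 + accepted_error s)"
      using merit nu by (intro mult_left_mono) auto
    moreover have "\<nu> * (eta P * Pred c s) \<le> \<nu> * (- y / 2)" using pred nu by (intro mult_left_mono) auto
    ultimately have "\<nu> * (f (it_x s') - f (it_x s) + it_mu s * (norm (c (it_x s')) - norm (c (it_x s))))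
      + a * (d' - d) + b * (it_eps s' - it_eps s)
      \<le> - ((1 - 1 / g) * (a * d) + (1 - 1 / g) * (b * it_eps s)) + \<nu> * accepted_error s"
      using rad rel by (simp only: distrib_left)
    then show ?thesis
      unfolding a_def[symmetric] b_def[symmetric] d_def[symmetric] d'_def[symmetric] g_def[symmetric]
      by (simp only: mult_minus_left distrib_left)
  qed
qed

subsection \<open>Acceptance of accurate steps\<close>

text \<open>The function-value events are left out because the one required depends on which
  candidate point is considered. The bound on the merit parameter is included so that the constants
  below are deterministic.\<close>

definition accurate :: "('d, 'z::finite) storm_iter set" where
  "accurate = {s. regular_iter s \<and> it_mu s \<le> \<mu>hat \<and> event_A P f s \<and> event_B P f s}"

lemma accurateD:
  assumes "s \<in> accurate"
  shows "regular_iter s" "it_mu s \<le> \<mu>hat"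
    "alpha P = 1 \<Longrightarrow> opnorm (it_Hfb s - hess f (it_x s)) \<le> kappa_h P * it_Delta s"
    "norm (it_gb s - grad f (it_x s)) \<le> kappa_g P * it_Delta s ^ (alpha P + 1)"
  using assms by (auto simp: accurate_def event_A_def event_B_def)

lemma Delta_power_le1:
  assumes "regular_iter s" shows "it_Delta s ^ (alpha P + 1) \<le> max 1 (Delta_max P) * it_Delta s"
proof -
  have "it_Delta s ^ alpha P \<le> max 1 (Delta_max P)"
    using parameter_bounds(1) regular_iterD(9)[OF assms] by auto
  then show ?thesis
    unfolding power_add using regular_iterD(8)[OF assms] by (simp add: mult_right_mono)
qed

lemma grad_error_le:
  assumes "s \<in> accurate"
  shows "norm (it_gb s - grad f (it_x s)) \<le> kappa_g P * max 1 (Delta_max P) * it_Delta s"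
proof -
  have "kappa_g P * it_Delta s ^ (alpha P + 1) \<le> kappa_g P * (max 1 (Delta_max P) * it_Delta s)"
    using Delta_power_le1[OF accurateD(1)[OF assms]] parameter_bounds by (intro mult_left_mono) auto
  then show ?thesis using accurateD(4)[OF assms] by simp
qed

lemma norm_multiplier_true_le:
  "regular_iter s \<Longrightarrow> norm (multiplier (jac c (it_x s)) (grad f (it_x s))) \<le> kappa_grad_f R / sqrt (kappa_1G R)"
  using gram_bounds.norm_multiplier_le[OF regular_iterD(6), of s "grad f (it_x s)"]
    regular_iterD(5)[of s] constants_pos
  by (meson divide_right_mono less_imp_le order_trans real_sqrt_ge_zero)

lemma norm_multiplier_error_le:
  assumes "s \<in> accurate"
  shows "norm (lambda_bar c s - multiplier (jac c (it_x s)) (grad f (it_x s)))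
      \<le> kappa_g P * max 1 (Delta_max P) / sqrt (kappa_1G R) * it_Delta s"
proof -
  interpret gram_bounds "jac c (it_x s)" "kappa_1G R" using regular_iterD(6) accurateD(1)[OF assms] .
  have "norm (lambda_bar c s - multiplier (jac c (it_x s)) (grad f (it_x s)))
      \<le> norm (it_gb s - grad f (it_x s)) / sqrt (kappa_1G R)"
    unfolding lambda_bar_def multiplier_diff by (rule norm_multiplier_le)
  also have "\<dots> \<le> kappa_g P * max 1 (Delta_max P) * it_Delta s / sqrt (kappa_1G R)"
    using grad_error_le[OF assms] constants_pos by (intro divide_right_mono) auto
  finally show ?thesis by simp
qed

lemma opnorm_constraint_hess_le:
  assumes "x \<in> \<Omega>"
  shows "opnorm (\<Sum>i\<in>UNIV. (l $ i) *\<^sub>R hess (\<lambda>y. c y $ i) x) \<le> real CARD('m) * L_G R * norm l"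
proof -
  have "opnorm (\<Sum>i\<in>UNIV. (l $ i) *\<^sub>R hess (\<lambda>y. c y $ i) x)
      \<le> (\<Sum>i\<in>UNIV. opnorm ((l $ i) *\<^sub>R hess (\<lambda>y. c y $ i) x))" by (rule opnorm_sum_le)
  also have "\<dots> \<le> (\<Sum>i\<in>(UNIV::'m set). norm l * L_G R)"
  proof (rule sum_mono)
    fix i
    have "opnorm ((l $ i) *\<^sub>R hess (\<lambda>y. c y $ i) x) \<le> \<bar>l $ i\<bar> * opnorm (hess (\<lambda>y. c y $ i) x)"
      by (rule opnorm_scaleR_le)
    also have "\<dots> \<le> norm l * L_G R"
      using opnorm_hess_c_le[OF assms] component_le_norm_cart by (intro mult_mono) auto
    finally show "opnorm ((l $ i) *\<^sub>R hess (\<lambda>y. c y $ i) x) \<le> norm l * L_G R" .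
  qed
  finally show ?thesis by (simp add: mult_ac)
qed

text \<open>There are two sources: the objective Hessian, controlled by \<open>event_A\<close>, and
  the multiplier, controlled through \<open>event_B\<close> and weighted by bounded constraint
  Hessians.\<close>

lemma model_hess_error:
  assumes a: "alpha P = 1"
  shows "\<exists>C\<ge>0. \<forall>s\<in>(accurate :: ('d, 'z::finite) storm_iter set).
    opnorm (it_Hb s - hess_Lagr f c (it_x s)) \<le> C * it_Delta s"
proof (intro exI conjI ballI)
  let ?C = "kappa_h P + real CARD('m) * L_G R * (kappa_g P * max 1 (Delta_max P) / sqrt (kappa_1G R))"
  show "0 \<le> ?C" using parameter_bounds L_G_nonneg constants_pos by simp
  fix s :: "('d, 'z) storm_iter" assume s: "s \<in> accurate"
  note r = regular_iterD[OF accurateD(1)[OF s]]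
  let ?l = "lambda_bar c s - multiplier (jac c (it_x s)) (grad f (it_x s))"
  have "it_Hb s - hess_Lagr f c (it_x s) =
      (it_Hfb s - hess f (it_x s)) + (\<Sum>i\<in>UNIV. (?l $ i) *\<^sub>R hess (\<lambda>y. c y $ i) (it_x s))"
    using r(16)[OF a]
    by (simp add: hess_Lagr_def add_constraint_hess_def scaleR_diff_left sum_subtractf)
  then have "opnorm (it_Hb s - hess_Lagr f c (it_x s))
      \<le> opnorm (it_Hfb s - hess f (it_x s)) + opnorm (\<Sum>i\<in>UNIV. (?l $ i) *\<^sub>R hess (\<lambda>y. c y $ i) (it_x s))"
    using opnorm_add_le by simp
  also have "\<dots> \<le> kappa_h P * it_Delta s + real CARD('m) * L_G R * norm ?l"
    using accurateD(3)[OF s a] opnorm_constraint_hess_le[OF r(1), of ?l] by linarith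
  also have "\<dots> \<le> kappa_h P * it_Delta s
      + real CARD('m) * L_G R * (kappa_g P * max 1 (Delta_max P) / sqrt (kappa_1G R) * it_Delta s)"
    using norm_multiplier_error_le[OF s] L_G_nonneg by (intro add_left_mono mult_left_mono) auto
  finally show "opnorm (it_Hb s - hess_Lagr f c (it_x s)) \<le> ?C * it_Delta s" by (simp add: algebra_simps)
qed

text \<open>For \<open>alpha P = 1\<close> the model Hessian is compared with the true Lagrangian
  Hessian, which the Lipschitz constants and the multiplier bound control. A bound of at least 1
  also dominates the denominator in the trial test.\<close>

lemma model_hess_bounded:
  "\<exists>K\<ge>1. \<forall>s\<in>(accurate :: ('d, 'z::finite) storm_iter set). opnorm (it_Hb s) \<le> K"
proof (cases "alpha P = 1")
  case True
  obtain C where C: "0 \<le> C"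
    "\<And>s :: ('d, 'z) storm_iter. s \<in> accurate \<Longrightarrow> opnorm (it_Hb s - hess_Lagr f c (it_x s)) \<le> C * it_Delta s"
    using model_hess_error[OF True] by blast
  let ?K = "C * Delta_max P + (L_grad_f R + real CARD('m) * L_G R * (kappa_grad_f R / sqrt (kappa_1G R)))"
  have "opnorm (it_Hb s) \<le> max 1 ?K" if s: "s \<in> accurate" for s :: "('d, 'z) storm_iter"
  proof -
    note r = regular_iterD[OF accurateD(1)[OF s]]
    have "C * it_Delta s \<le> C * Delta_max P" using C r by (intro mult_left_mono) auto
    moreover have "opnorm (it_Hb s) \<le> opnorm (it_Hb s - hess_Lagr f c (it_x s)) + opnorm (hess_Lagr f c (it_x s))"
      using opnorm_add_le[of "it_Hb s - hess_Lagr f c (it_x s)" "hess_Lagr f c (it_x s)"] by simp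
    moreover have "opnorm (hess_Lagr f c (it_x s)) \<le> opnorm (hess f (it_x s))
        + opnorm (\<Sum>i\<in>UNIV. (multiplier (jac c (it_x s)) (grad f (it_x s)) $ i) *\<^sub>R hess (\<lambda>y. c y $ i) (it_x s))"
      unfolding hess_Lagr_def add_constraint_hess_def by (rule opnorm_add_le)
    moreover have "\<dots> \<le> L_grad_f R
        + real CARD('m) * L_G R * norm (multiplier (jac c (it_x s)) (grad f (it_x s)))"
      by (intro add_mono opnorm_hess_f_le opnorm_constraint_hess_le r)
    moreover have "real CARD('m) * L_G R * norm (multiplier (jac c (it_x s)) (grad f (it_x s)))
        \<le> real CARD('m) * L_G R * (kappa_grad_f R / sqrt (kappa_1G R))"
      using norm_multiplier_true_le[OF accurateD(1)[OF s]] L_G_nonneg by (intro mult_left_mono) auto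
    ultimately show ?thesis using C(2)[OF s] by linarith
  qed
  then show ?thesis by (intro exI[of _ "max 1 ?K"]) auto
next
  case False
  then have "alpha P = 0" using parameter_bounds(1) by simp
  then have "opnorm (it_Hb s) \<le> max 1 (kappa_B R)" if s: "s \<in> accurate" for s :: "('d, 'z) storm_iter"
    using regular_iterD(7)[OF accurateD(1)[OF s]] by simp
  then show ?thesis by (intro exI[of _ "max 1 (kappa_B R)"]) auto
qed

lemma norm_dx_le:
  assumes "regular_iter s" "computes_trial P c s"
  shows "norm (it_dx s) \<le> 2 * it_Delta s"
  using regular_iterD(13)[OF assms] regular_iterD(8,12)[OF assms(1)] by (intro norm_trial_step_le) auto

text \<open>Noise, Taylor remainders and the gradient error are all of second order. The quadratic
  term of the model is bounded rather than matched, so no higher order is reached here for either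
  value of \<open>alpha P\<close>.\<close>

lemma trial_model_error:
  "\<exists>C>0. \<forall>s\<in>(accurate :: ('d, 'z::finite) storm_iter set). computes_trial P c s \<and> event_C P f c s \<longrightarrow>
     actual_red c s (trial_point s) (it_fsb s) - Pred c s \<le> C * (it_Delta s)\<^sup>2"
proof -
  obtain K where K: "K \<ge> 1" "\<And>s :: ('d, 'z) storm_iter. s \<in> accurate \<Longrightarrow> opnorm (it_Hb s) \<le> K"
    using model_hess_bounded by blast
  define D where "D = max 1 (Delta_max P)"
  define C where "C = 2 * (kappa_f P * D) + 4 * L_grad_f R + 2 * (kappa_g P * D) + 2 * K + 4 * (max 0 \<mu>hat * L_G R)"
  have "C > 0" using parameter_bounds K L_grad_f_nonneg L_G_nonneg
    by (simp add: C_def D_def add_pos_nonneg add_nonneg_pos)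
  moreover have "actual_red c s (trial_point s) (it_fsb s) - Pred c s \<le> C * (it_Delta s)\<^sup>2"
    if s: "s \<in> accurate" and trial: "computes_trial P c s" and ev: "event_C P f c s" for s :: "('d, 'z) storm_iter"
  proof -
    note r = regular_iterD[OF accurateD(1)[OF s]]
    define x h d p where "x = it_x s" and "h = it_dx s" and "d = it_Delta s" and "p = trial_point s"
    have ph: "p - x = h" by (simp add: p_def x_def h_def trial_point_def)
    have h: "norm h \<le> 2 * d" using norm_dx_le[OF accurateD(1)[OF s] trial] by (simp add: h_def d_def)
    have d: "d > 0" using r by (simp add: d_def)
    have h2: "(norm h)\<^sup>2 \<le> 4 * d\<^sup>2" using power_mono[OF h norm_ge_zero, of 2] by (simp add: power_mult_distrib)
    have pO: "p \<in> \<Omega>" "x \<in> \<Omega>" using r trial by (auto simp: p_def x_def)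
    have "kappa_f P * d ^ (alpha P + 2) \<le> kappa_f P * (D * d\<^sup>2)"
      using Delta_power_le[OF accurateD(1)[OF s]] parameter_bounds unfolding d_def D_def by (intro mult_left_mono) auto
    then have noise: "it_fsb s - it_fb s \<le> f p - f x + 2 * (kappa_f P * (D * d\<^sup>2))"
      using ev trial unfolding event_C_def err_f_def err_fs_def p_def x_def d_def
      by (simp add: abs_real_def split: if_splits)
    have taylor_f: "f p - f x - grad f x \<bullet> h \<le> L_grad_f R * (4 * d\<^sup>2)"
    proof -
      have "\<bar>f p - f x - grad f x \<bullet> (p - x)\<bar> \<le> L_grad_f R * (norm (p - x))\<^sup>2"
        by (rule grad_taylor[OF domain(2) pO(2,1) differentiability(1) lip_grad_f])
      moreover have "L_grad_f R * (norm h)\<^sup>2 \<le> L_grad_f R * (4 * d\<^sup>2)"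
        using h2 L_grad_f_nonneg by (rule mult_left_mono)
      ultimately show ?thesis by (simp add: ph)
    qed
    have grad_err: "(grad f x - it_gb s) \<bullet> h \<le> kappa_g P * D * d * (2 * d)"
    proof -
      have "(grad f x - it_gb s) \<bullet> h \<le> norm (grad f x - it_gb s) * norm h" by (rule norm_cauchy_schwarz)
      also have "\<dots> \<le> kappa_g P * D * d * (2 * d)"
        using grad_error_le[OF s] h d parameter_bounds
        by (intro mult_mono) (auto simp: x_def D_def d_def norm_minus_commute)
      finally show ?thesis .
    qed
    have hess: "- (h \<bullet> (it_Hb s *v h)) / 2 \<le> K * (4 * d\<^sup>2) / 2"
    proof -
      have "\<bar>h \<bullet> (it_Hb s *v h)\<bar> \<le> opnorm (it_Hb s) * norm h * norm h" by (rule abs_inner_matrix_le)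
      also have "\<dots> = opnorm (it_Hb s) * (norm h)\<^sup>2" by (simp add: power2_eq_square)
      also have "\<dots> \<le> K * (4 * d\<^sup>2)" using K(2)[OF s] K(1) h2 by (intro mult_mono) auto
      finally show ?thesis by linarith
    qed
    have constr: "it_mu s * (norm (c p) - norm (c x + jac c x *v h)) \<le> max 0 \<mu>hat * (L_G R * (4 * d\<^sup>2))"
    proof -
      have "norm (c p) - norm (c x + jac c x *v h) \<le> norm (c p - c x - jac c x *v (p - x))"
        using norm_triangle_ineq2[of "c p" "c x + jac c x *v h"] by (simp add: ph algebra_simps)
      also have "\<dots> \<le> L_G R * (norm (p - x))\<^sup>2"
        by (rule jac_taylor[OF domain(2) pO(2,1) differentiability(3) lip_jac_c])
      also have "\<dots> \<le> L_G R * (4 * d\<^sup>2)" using h2 L_G_nonneg unfolding ph by (rule mult_left_mono)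
      finally have "it_mu s * (norm (c p) - norm (c x + jac c x *v h)) \<le> it_mu s * (L_G R * (4 * d\<^sup>2))"
        using r(11) by (intro mult_left_mono) auto
      also have "\<dots> \<le> max 0 \<mu>hat * (L_G R * (4 * d\<^sup>2))"
        using accurateD(2)[OF s] L_G_nonneg by (intro mult_right_mono) auto
      finally show ?thesis .
    qed
    have "actual_red c s p (it_fsb s) - Pred c s =
        (it_fsb s - it_fb s) - it_gb s \<bullet> h - h \<bullet> (it_Hb s *v h) / 2
        + it_mu s * (norm (c p) - norm (c x + jac c x *v h))"
      by (simp add: actual_red_def pred_red_def x_def h_def algebra_simps)
    also have "\<dots> \<le> 2 * (kappa_f P * (D * d\<^sup>2)) + L_grad_f R * (4 * d\<^sup>2) + kappa_g P * D * d * (2 * d)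
        + K * (4 * d\<^sup>2) / 2 + max 0 \<mu>hat * (L_G R * (4 * d\<^sup>2))"
      using noise taylor_f grad_err hess constr by (simp add: inner_diff_left)
    also have "\<dots> = C * d\<^sup>2" by (simp add: C_def algebra_simps power2_eq_square)
    finally show ?thesis by (simp add: p_def d_def)
  qed
  ultimately show ?thesis by blast
qed

lemma trial_accepted:
  fixes s :: "('d, 'z::finite) storm_iter"
  assumes s: "regular_iter s" and trial: "computes_trial P c s"
    and err: "actual_red c s (trial_point s) (it_fsb s) - Pred c s \<le> e" and e: "e \<le> (1 - eta P) * (- Pred c s)"
  shows "accepts_trial P c s"
  using ratio_ge_of_model_error[OF Pred_neg[OF s trial], of "actual_red c s (trial_point s) (it_fsb s)" "eta P"]
    trial err e by (simp add: accepts_trial_def)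

text \<open>The constraint component is exact, and the projected gradient inherits the gradient
  error by nonexpansiveness.\<close>

lemma grad_bar_error:
  assumes "s \<in> accurate"
  shows "norm (grad_Lagr f c (it_x s)) \<le> norm (grad_bar c s) + kappa_g P * max 1 (Delta_max P) * it_Delta s"
proof -
  interpret gram_bounds "jac c (it_x s)" "kappa_1G R" using regular_iterD(6) accurateD(1)[OF assms] .
  have "grad_Lagr f c (it_x s) - grad_bar c s =
      ((grad f (it_x s) + transpose (jac c (it_x s)) *v multiplier (jac c (it_x s)) (grad f (it_x s)))
       - (it_gb s + transpose (jac c (it_x s)) *v multiplier (jac c (it_x s)) (it_gb s)), 0)"
    by (simp add: grad_Lagr_def grad_bar_def gradx_bar_def lambda_bar_def)
  then have "norm (grad_Lagr f c (it_x s) - grad_bar c s) \<le> norm (it_gb s - grad f (it_x s))"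
    using norm_residual_diff_le[of "grad f (it_x s)" "it_gb s"] by (simp add: norm_Pair norm_minus_commute)
  then show ?thesis
    using grad_error_le[OF assms] norm_triangle_sub[of "grad_Lagr f c (it_x s)" "grad_bar c s"] by linarith
qed

lemma first_order_acceptance:
  assumes "\<delta> > 0"
  shows "\<exists>\<zeta>>0. \<forall>s\<in>(accurate :: ('d, 'z::finite) storm_iter set). event_C P f c s \<and>
    \<delta> \<le> norm (grad_Lagr f c (it_x s)) \<and> it_Delta s \<le> \<zeta> \<longrightarrow> accepts_trial P c s"
proof -
  note pb = parameter_bounds
  obtain K where K: "K \<ge> 1" "\<And>s :: ('d, 'z) storm_iter. s \<in> accurate \<Longrightarrow> opnorm (it_Hb s) \<le> K"
    using model_hess_bounded by blast
  obtain C where C: "C > 0" "\<And>s :: ('d, 'z) storm_iter. s \<in> accurate \<Longrightarrow> computes_trial P c s \<Longrightarrow>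
      event_C P f c s \<Longrightarrow> actual_red c s (trial_point s) (it_fsb s) - Pred c s \<le> C * (it_Delta s)\<^sup>2"
    using trial_model_error by blast
  define g where "g = kappa_g P * max 1 (Delta_max P)"
  have g: "g > 0" using pb by (simp add: g_def)
  define q where "q = (1 - eta P) * kappa_fcd P * \<delta> / 4"
  have q: "q > 0" using pb assms by (simp add: q_def)
  \<comment> \<open>In turn: half of \<delta> survives the gradient error; the trial test succeeds
    and the minimum in \<open>grad_measure\<close> is the radius; the model error
    \<open>C * d\<^sup>2\<close> stays below \<open>q * d\<close>, a lower bound for the admissible
    fraction \<open>1 - eta P\<close> of the predicted reduction.\<close>
  define \<zeta> where "\<zeta> = min (\<delta> / (2 * g)) (min (\<delta> / (2 * K)) (q / C))"
  have "\<zeta> > 0" using assms g K q C by (simp add: \<zeta>_def)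
  moreover have "accepts_trial P c s"
    if s: "s \<in> accurate" and ev: "event_C P f c s" and big: "\<delta> \<le> norm (grad_Lagr f c (it_x s))"
      and small: "it_Delta s \<le> \<zeta>" for s :: "('d, 'z) storm_iter"
  proof -
    define n where "n = norm (grad_bar c s)"
    define d where "d = it_Delta s"
    note r = regular_iterD[OF accurateD(1)[OF s]]
    have d: "d > 0" "g * d \<le> \<delta> / 2" "d \<le> \<delta> / (2 * K)" "C * d \<le> q"
      using r(8) small g C by (simp_all add: \<zeta>_def d_def field_simps)
    have n: "\<delta> / 2 \<le> n" using grad_bar_error[OF s] big d by (simp add: n_def g_def d_def)
    have n0: "0 \<le> n" by (simp add: n_def)
    have trial: "computes_trial P c s"
    proof -
      have "eta P * d \<le> 1 * (\<delta> / (2 * K))" using d pb by (intro mult_mono) auto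
      also have "\<dots> = (\<delta> / 2) / K" by simp
      also have "\<dots> \<le> n / max 1 (opnorm (it_Hb s))"
        using n n0 K K(2)[OF s] assms by (intro frac_le) auto
      finally show ?thesis by (simp add: computes_trial_def n_def d_def le_max_iff_disj)
    qed
    have Hpos: "0 < opnorm (it_Hb s)" by (rule pred_le_measures[OF accurateD(1)[OF s] trial])
    have "\<delta> / (2 * K) = (\<delta> / 2) / K" by simp
    also have "\<dots> \<le> n / opnorm (it_Hb s)" using n n0 K K(2)[OF s] assms Hpos by (intro frac_le) auto
    finally have "\<delta> / 2 * d \<le> grad_measure c s"
      unfolding grad_measure_def d_def[symmetric] n_def[symmetric] using n n0 d assms
      by (intro mult_mono) auto
    then have "kappa_fcd P / 2 * (\<delta> / 2 * d) \<le> kappa_fcd P / 2 * grad_measure c s"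
      using pb by (intro mult_left_mono) auto
    then have "kappa_fcd P / 2 * (\<delta> / 2 * d) \<le> - Pred c s"
      using pred_le_measures(1)[OF accurateD(1)[OF s] trial] by linarith
    then have "(1 - eta P) * (kappa_fcd P / 2 * (\<delta> / 2 * d)) \<le> (1 - eta P) * (- Pred c s)"
      using pb by (intro mult_left_mono) auto
    then have qd: "q * d \<le> (1 - eta P) * (- Pred c s)" by (simp add: q_def field_simps)
    have "C * d\<^sup>2 = C * d * d" by (simp add: power2_eq_square)
    also have "\<dots> \<le> q * d" using d by (intro mult_right_mono) auto
    finally have "C * d\<^sup>2 \<le> (1 - eta P) * (- Pred c s)" using qd by simp
    then show ?thesis
      using trial_accepted[OF accurateD(1)[OF s] trial C(2)[OF s trial ev]] by (simp add: d_def)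
  qed
  ultimately show ?thesis by blast
qed

text \<open>Replaces eigenvalues of the reduced Hessian by unit vectors in the kernel of the
  Jacobian. The right-hand side depends on \<open>x\<close> alone, whereas \<open>Z\<close> may vary
  with the sample without being measurable.\<close>

lemma tau_plus_witness:
  fixes Z :: "real^'z::finite^'d"
  assumes x: "x \<in> \<Omega>" and Z: "orthonormal_kernel_basis (jac c x) Z" and \<delta>: "0 < \<delta>"
  shows "\<delta> \<le> tau_plus f c x Z \<longleftrightarrow>
    (\<exists>v. norm v = 1 \<and> jac c x *v v = 0 \<and> v \<bullet> (hess_Lagr f c x *v v) \<le> - \<delta>)"
proof -
  let ?T = "reduced (hess_Lagr f c x) Z"
  have sym: "transpose ?T = ?T" by (intro transpose_reduced transpose_hess_Lagr x)
  note Zs = orthonormal_kernel_basisD[OF Z]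
  show ?thesis
  proof
    assume "\<delta> \<le> tau_plus f c x Z"
    then have le: "smallest_eigenvalue ?T \<le> - \<delta>"
      using \<delta> by (auto simp: tau_plus_def neg_part_def min_def split: if_splits)
    obtain u where "norm u = 1" "u \<bullet> (?T *v u) = smallest_eigenvalue ?T"
      by (rule smallest_eigenvalue_attained[OF sym])
    then show "\<exists>v. norm v = 1 \<and> jac c x *v v = 0 \<and> v \<bullet> (hess_Lagr f c x *v v) \<le> - \<delta>"
      using le by (intro exI[of _ "Z *v u"]) (simp add: Zs reduced_form)
  next
    assume "\<exists>v. norm v = 1 \<and> jac c x *v v = 0 \<and> v \<bullet> (hess_Lagr f c x *v v) \<le> - \<delta>"
    then obtain v where v: "norm v = 1" "jac c x *v v = 0" "v \<bullet> (hess_Lagr f c x *v v) \<le> - \<delta>" by blast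
    obtain u where u: "v = Z *v u" using Zs(4)[OF v(2)] by blast
    then have "norm u = 1" using v(1) Zs(2)[of u] by simp
    then have "smallest_eigenvalue ?T \<le> u \<bullet> (?T *v u)" by (rule smallest_eigenvalue_le[OF sym])
    also have "\<dots> \<le> - \<delta>" using v(3) by (simp add: reduced_form u)
    finally show "\<delta> \<le> tau_plus f c x Z" using \<delta> by (simp add: tau_plus_def neg_part_def)
  qed
qed

text \<open>A unit direction realizing the true negative curvature is tested in the model Hessian;
  the two quadratic forms differ by at most the operator norm of the error.\<close>

lemma tau_plus_le_tau_bar_plus:
  assumes a: "alpha P = 1" and s: "regular_iter s"
  shows "tau_plus f c (it_x s) (it_Z s) \<le> tau_bar_plus P s + opnorm (it_Hb s - hess_Lagr f c (it_x s))"
proof (cases "tau_plus f c (it_x s) (it_Z s) > 0")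
  case False
  then have "tau_plus f c (it_x s) (it_Z s) \<le> 0" by simp
  also have "\<dots> \<le> tau_bar_plus P s + opnorm (it_Hb s - hess_Lagr f c (it_x s))" by (intro add_nonneg_nonneg) auto
  finally show ?thesis .
next
  case True
  note r = regular_iterD[OF s]
  let ?t = "tau_plus f c (it_x s) (it_Z s)" and ?E = "it_Hb s - hess_Lagr f c (it_x s)"
  obtain v where v: "norm v = 1" "jac c (it_x s) *v v = 0" "v \<bullet> (hess_Lagr f c (it_x s) *v v) \<le> - ?t"
    using tau_plus_witness[OF r(1,12) True] by auto
  note Zs = orthonormal_kernel_basisD[OF r(12)]
  obtain u where u: "v = it_Z s *v u" using Zs(4)[OF v(2)] by blast
  then have u1: "norm u = 1" using v(1) Zs(2)[of u] by simp
  have sym: "transpose (reduced (it_Hb s) (it_Z s)) = reduced (it_Hb s) (it_Z s)"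
    unfolding r(16)[OF a] by (intro transpose_reduced transpose_add_constraint_hess r(1) r(15)[OF a])
  have "smallest_eigenvalue (reduced (it_Hb s) (it_Z s)) \<le> u \<bullet> (reduced (it_Hb s) (it_Z s) *v u)"
    by (rule smallest_eigenvalue_le[OF sym u1])
  also have "\<dots> = v \<bullet> (hess_Lagr f c (it_x s) *v v) + v \<bullet> (?E *v v)"
    by (simp add: reduced_form u matrix_vector_mult_diff_rdistrib inner_diff_right)
  also have "\<dots> \<le> - ?t + opnorm ?E"
    using v(3) abs_inner_matrix_le[of v ?E v] by (simp add: v(1))
  finally show ?thesis
    using a by (simp add: tau_bar_plus_def neg_part_def)
qed

text \<open>Surplus powers of the radius are absorbed into the constant, since the radius is at most
  \<open>Delta_max P\<close>; thus \<open>k\<close> may be smaller than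
  \<open>i + j\<close>.\<close>

lemma bigo_Delta_prod:
  assumes A: "A \<subseteq> Collect regular_iter" and k: "k \<le> i + j"
    and X: "X \<in> O[principal A](\<lambda>s. it_Delta s ^ i)" and Y: "Y \<in> O[principal A](\<lambda>s. it_Delta s ^ j)"
  shows "(\<lambda>s. X s * Y s) \<in> O[principal A](\<lambda>s. it_Delta s ^ k)"
proof (rule landau_o.big_trans)
  show "(\<lambda>s. X s * Y s) \<in> O[principal A](\<lambda>s. it_Delta s ^ i * it_Delta s ^ j)"
    by (rule landau_o.big.mult[OF X Y])
  show "(\<lambda>s. it_Delta s ^ i * it_Delta s ^ j) \<in> O[principal A](\<lambda>s. it_Delta s ^ k)"
    unfolding bigo_principal
  proof (intro exI conjI ballI)
    let ?C = "Delta_max P ^ (i + j - k)"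
    show "0 < ?C" using parameter_bounds by simp
    fix s assume "s \<in> A"
    then have d: "0 < it_Delta s" "it_Delta s \<le> Delta_max P" using A regular_iterD(8,9) by auto
    have "it_Delta s ^ i * it_Delta s ^ j = it_Delta s ^ (i + j - k) * it_Delta s ^ k"
      using k by (simp add: power_add[symmetric])
    also have "\<dots> \<le> ?C * it_Delta s ^ k" using d by (intro mult_right_mono power_mono) auto
    finally show "\<bar>it_Delta s ^ i * it_Delta s ^ j\<bar> \<le> ?C * \<bar>it_Delta s ^ k\<bar>" using d by simp
  qed
qed

lemma bigo_Delta_cmult:
  "X \<in> O[F](\<lambda>s. it_Delta s ^ i) \<Longrightarrow> (\<lambda>s. a * X s) \<in> O[F](\<lambda>s. it_Delta s ^ i)" for a :: real
  by simp

text \<open>After the correction the linearised constraint value is matched up to third order, and the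
  correction changes the objective by the curvature of the constraints, so that \<open>Pred\<close> becomes a
  third-order model of \<open>Ared\<close>.\<close>

lemma soc_model_error:
  assumes a: "alpha P = 1"
  shows "\<exists>C>0. \<forall>s\<in>(accurate :: ('d, 'z::finite) storm_iter set). computes_soc P c s \<and> event_C' P f c s \<longrightarrow>
     actual_red c s (soc_point c s) (it_fsb_soc s) - Pred c s \<le> C * it_Delta s ^ 3"
proof -
  define A :: "('d, 'z) storm_iter set" where "A = {s \<in> accurate. computes_soc P c s \<and> event_C' P f c s}"
  have A: "A \<subseteq> Collect regular_iter" by (auto simp: A_def dest: accurateD)
  define x h G p y e d l HL
    where "x s = it_x s" and "h s = it_dx s" and "G s = jac c (it_x s)" and "p s = trial_point s"
    and "y s = soc_point c s" and "e s = c (p s) - c (x s) - G s *v h s" and "d s = soc_step c s"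
    and "l s = multiplier (jac c (it_x s)) (grad f (it_x s))" and "HL s = hess_Lagr f c (it_x s)"
    for s :: "('d, 'z) storm_iter"
  note fold_defs = x_def h_def G_def p_def y_def e_def d_def l_def HL_def
  let ?O = "\<lambda>k. O[principal A](\<lambda>s. it_Delta s ^ k)"
  have props: "x s \<in> \<Omega>" "p s \<in> \<Omega>" "y s \<in> \<Omega>" "norm (h s) \<le> 2 * it_Delta s" "0 < it_Delta s"
    "gram_bounds (G s) (kappa_1G R)" "p s - x s = h s" "y s - p s = d s" "y s - x s = h s + d s"
    "d s = normal_dir (G s) (e s)" "s \<in> accurate" "computes_trial P c s" if "s \<in> A" for s
  proof -
    have s: "s \<in> accurate" and soc: "computes_soc P c s" and trial: "computes_trial P c s"
      using that by (auto simp: A_def computes_soc_def)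
    note r = regular_iterD[OF accurateD(1)[OF s]]
    show "x s \<in> \<Omega>" "p s \<in> \<Omega>" "y s \<in> \<Omega>" "norm (h s) \<le> 2 * it_Delta s" "0 < it_Delta s"
      "gram_bounds (G s) (kappa_1G R)" "s \<in> accurate" "computes_trial P c s"
      using r s soc trial norm_dx_le[OF accurateD(1)[OF s]] by (auto simp: fold_defs)
    show "p s - x s = h s" "y s - p s = d s" "y s - x s = h s + d s" "d s = normal_dir (G s) (e s)"
      by (simp_all add: fold_defs trial_point_def soc_point_def soc_step_def)
  qed
  have Oh: "(\<lambda>s. norm (h s)) \<in> ?O 1"
    unfolding bigo_principal by (rule exI[of _ 2]) (use props(4,5) in \<open>auto simp: abs_of_pos\<close>)
  have Ohh: "(\<lambda>s. norm (h s) * norm (h s)) \<in> ?O 2"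
    by (rule bigo_Delta_prod[OF A _ Oh Oh]) simp
  have Ohhh: "(\<lambda>s. norm (h s) * (norm (h s) * norm (h s))) \<in> ?O 3"
    by (rule bigo_Delta_prod[OF A _ Oh Ohh]) simp
  have Oe: "(\<lambda>s. norm (e s)) \<in> ?O 2"
  proof (rule bigo_principal_le[OF bigo_Delta_cmult[OF Ohh]])
    fix s assume s: "s \<in> A"
    show "\<bar>norm (e s)\<bar> \<le> L_G R * (norm (h s) * norm (h s))"
      using jac_taylor[OF domain(2) props(1,2)[OF s] differentiability(3) lip_jac_c]
      by (simp add: props(7)[OF s] power2_eq_square e_def) (simp add: fold_defs)
  qed
  have Od: "(\<lambda>s. norm (d s)) \<in> ?O 2"
  proof (rule bigo_principal_le[OF bigo_Delta_cmult[OF Oe]])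
    fix s assume s: "s \<in> A"
    show "\<bar>norm (d s)\<bar> \<le> (1 / sqrt (kappa_1G R)) * norm (e s)"
      using gram_bounds.norm_normal_dir_le[OF props(6)[OF s], of "e s"] by (simp add: props(10)[OF s])
  qed
  have Ohd: "(\<lambda>s. norm (h s) * norm (d s)) \<in> ?O 3"
    by (rule bigo_Delta_prod[OF A _ Oh Od]) simp
  have Odd: "(\<lambda>s. norm (d s) * norm (d s)) \<in> ?O 3"
    by (rule bigo_Delta_prod[OF A _ Od Od]) simp
  have Od1: "(\<lambda>s. norm (d s)) \<in> ?O 1"
  proof -
    have "(\<lambda>s. 1 * norm (d s)) \<in> ?O 1" by (rule bigo_Delta_prod[OF A _ _ Od, of _ 0]) auto
    then show ?thesis by simp
  qed
  have Ohd1: "(\<lambda>s. norm (h s) + norm (d s)) \<in> ?O 1" by (rule sum_in_bigo(1)[OF Oh Od1])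
  have Ohd2: "(\<lambda>s. (norm (h s) + norm (d s)) * (norm (h s) + norm (d s))) \<in> ?O 2"
    by (rule bigo_Delta_prod[OF A _ Ohd1 Ohd1]) simp
  have Ohd3: "(\<lambda>s. (norm (h s) + norm (d s)) * ((norm (h s) + norm (d s)) * (norm (h s) + norm (d s)))) \<in> ?O 3"
    by (rule bigo_Delta_prod[OF A _ Ohd1 Ohd2]) simp

  \<comment> \<open>\<open>G s *v d s = - e s\<close> cancels the linearization error at
    \<open>x s\<close>. What remains is the Taylor error of the constraints along \<open>d s\<close>
    and the change of the Jacobian over \<open>h s\<close>, acting on \<open>d s\<close>.\<close>
  have constr: "(\<lambda>s. it_mu s * (norm (c (y s)) - norm (c (x s) + G s *v h s))) \<in> ?O 3"
  proof (rule bigo_principal_le)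
    show "(\<lambda>s. max 0 \<mu>hat * (L_G R * (norm (d s) * norm (d s)) + L_G R * (norm (h s) * norm (d s)))) \<in> ?O 3"
      by (intro bigo_Delta_cmult sum_in_bigo(1) Odd Ohd)
    fix s assume s: "s \<in> A"
    have mu: "0 < it_mu s" "it_mu s \<le> max 0 \<mu>hat"
      using accurateD(2)[OF props(11)[OF s]] regular_iterD(11)[OF accurateD(1)[OF props(11)[OF s]]] by auto
    have Gd: "G s *v d s = - e s"
      using gram_bounds.G_normal_dir[OF props(6)[OF s], of "e s"] by (simp add: props(10)[OF s])
    have "c (y s) - (c (x s) + G s *v h s)
        = (c (y s) - c (p s) - jac c (p s) *v d s) + (jac c (p s) - G s) *v d s"
      using Gd by (simp add: matrix_vector_mult_diff_rdistrib e_def)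
    then have "norm (c (y s) - (c (x s) + G s *v h s))
        \<le> norm (c (y s) - c (p s) - jac c (p s) *v d s) + norm ((jac c (p s) - G s) *v d s)"
      by (simp only: norm_triangle_ineq)
    moreover have "norm (c (y s) - c (p s) - jac c (p s) *v d s) \<le> L_G R * (norm (d s) * norm (d s))"
      using jac_taylor[OF domain(2) props(2,3)[OF s] differentiability(3) lip_jac_c]
      by (simp add: props(8)[OF s] power2_eq_square)
    moreover have "norm ((jac c (p s) - G s) *v d s) \<le> L_G R * (norm (h s) * norm (d s))"
    proof -
      have "norm ((jac c (p s) - G s) *v d s) \<le> opnorm (jac c (p s) - G s) * norm (d s)"
        by (rule norm_matrix_vector_le_opnorm)
      also have "\<dots> \<le> (L_G R * norm (h s)) * norm (d s)"
        using lip_jac_c props(1,2)[OF s]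
        by (intro mult_right_mono) (auto simp: op_lipschitz_on_def G_def x_def[symmetric] props(7)[OF s, symmetric])
      finally show ?thesis by (simp add: mult.assoc)
    qed
    ultimately have "\<bar>norm (c (y s)) - norm (c (x s) + G s *v h s)\<bar>
        \<le> L_G R * (norm (d s) * norm (d s)) + L_G R * (norm (h s) * norm (d s))"
      using norm_triangle_ineq3[of "c (y s)" "c (x s) + G s *v h s"] by linarith
    then show "\<bar>it_mu s * (norm (c (y s)) - norm (c (x s) + G s *v h s))\<bar>
        \<le> max 0 \<mu>hat * (L_G R * (norm (d s) * norm (d s)) + L_G R * (norm (h s) * norm (d s)))"
      unfolding abs_mult using mu by (intro mult_mono) auto
  qed

  have taylor_f: "(\<lambda>s. f (y s) - f (x s) - grad f (x s) \<bullet> (h s + d s)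
      - (h s + d s) \<bullet> (hess f (x s) *v (h s + d s)) / 2) \<in> ?O 3"
  proof (rule bigo_principal_le[OF bigo_Delta_cmult[OF Ohd3]])
    fix s assume s: "s \<in> A"
    have "\<bar>f (y s) - f (x s) - grad f (x s) \<bullet> (h s + d s) - (h s + d s) \<bullet> (hess f (x s) *v (h s + d s)) / 2\<bar>
        \<le> L_hess_f R * norm (h s + d s) ^ 3"
      using hess_taylor[OF domain(2) props(1,3)[OF s] differentiability(1,2) lip_hess_f]
      by (simp only: props(9)[OF s])
    also have "\<dots> \<le> L_hess_f R * (norm (h s) + norm (d s)) ^ 3"
      using L_hess_f_nonneg norm_triangle_ineq by (intro mult_left_mono power_mono) auto
    finally show "\<bar>f (y s) - f (x s) - grad f (x s) \<bullet> (h s + d s) - (h s + d s) \<bullet> (hess f (x s) *v (h s + d s)) / 2\<bar>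
        \<le> L_hess_f R * ((norm (h s) + norm (d s)) * ((norm (h s) + norm (d s)) * (norm (h s) + norm (d s))))"
      by (simp add: power3_eq_cube)
  qed

  have cross: "(\<lambda>s. (h s + d s) \<bullet> (hess f (x s) *v (h s + d s)) - h s \<bullet> (hess f (x s) *v h s)) \<in> ?O 3"
  proof (rule bigo_principal_le)
    show "(\<lambda>s. L_grad_f R * (2 * (norm (h s) * norm (d s)) + norm (d s) * norm (d s))) \<in> ?O 3"
      by (intro bigo_Delta_cmult sum_in_bigo(1) Odd Ohd)
    fix s assume s: "s \<in> A"
    have b: "\<bar>u \<bullet> (hess f (x s) *v v)\<bar> \<le> L_grad_f R * (norm u * norm v)" for u v
    proof -
      have "\<bar>u \<bullet> (hess f (x s) *v v)\<bar> \<le> opnorm (hess f (x s)) * norm u * norm v" by (rule abs_inner_matrix_le)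
      also have "\<dots> \<le> L_grad_f R * norm u * norm v"
        using opnorm_hess_f_le[OF props(1)[OF s]] by (intro mult_right_mono) auto
      finally show ?thesis by (simp add: mult.assoc)
    qed
    have "(h s + d s) \<bullet> (hess f (x s) *v (h s + d s)) - h s \<bullet> (hess f (x s) *v h s) =
        h s \<bullet> (hess f (x s) *v d s) + d s \<bullet> (hess f (x s) *v h s) + d s \<bullet> (hess f (x s) *v d s)"
      by (simp add: matrix_vector_right_distrib inner_add_left inner_add_right)
    then show "\<bar>(h s + d s) \<bullet> (hess f (x s) *v (h s + d s)) - h s \<bullet> (hess f (x s) *v h s)\<bar>
        \<le> L_grad_f R * (2 * (norm (h s) * norm (d s)) + norm (d s) * norm (d s))"
      using b[of "h s" "d s"] b[of "d s" "h s"] b[of "d s" "d s"]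
      by (simp add: distrib_left mult.commute[of "norm (d s)" "norm (h s)"])
  qed

  \<comment> \<open>By \<open>inner_normal_dir\<close> the correction changes the objective to first
    order by \<open>l s \<bullet> e s\<close>. Each component of \<open>e s\<close> is half the
    constraint curvature along \<open>h s\<close> up to third order, so this change is the
    difference between the Lagrangian and the objective Hessian in the model.\<close>
  have curvature: "(\<lambda>s. grad f (x s) \<bullet> d s + h s \<bullet> (hess f (x s) *v h s) / 2 - h s \<bullet> (HL s *v h s) / 2) \<in> ?O 3"
  proof (rule bigo_principal_le)
    let ?L = "kappa_grad_f R / sqrt (kappa_1G R)"
    show "(\<lambda>s. (real CARD('m) * (?L * L_hess_c R)) * (norm (h s) * (norm (h s) * norm (h s)))) \<in> ?O 3"
      by (rule bigo_Delta_cmult[OF Ohhh])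
    fix s assume s: "s \<in> A"
    let ?H = "\<lambda>i. hess (\<lambda>y. c y $ i) (x s)"
    have "grad f (x s) \<bullet> d s = l s \<bullet> e s"
      using gram_bounds.inner_normal_dir[OF props(6)[OF s]] by (simp add: props(10)[OF s] l_def G_def x_def)
    moreover have "HL s *v h s = hess f (x s) *v h s + (\<Sum>i\<in>UNIV. (l s $ i) *\<^sub>R (?H i *v h s))"
      by (simp add: HL_def hess_Lagr_def add_constraint_hess_def matrix_vector_mult_add_rdistrib
          l_def x_def sum_matrix_vector scaleR_matrix_vector_assoc)
    ultimately have "grad f (x s) \<bullet> d s + h s \<bullet> (hess f (x s) *v h s) / 2 - h s \<bullet> (HL s *v h s) / 2
        = l s \<bullet> e s - (\<Sum>i\<in>UNIV. (l s $ i) * (h s \<bullet> (?H i *v h s)) / 2)"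
      by (simp add: inner_add_right inner_sum_right add_divide_distrib sum_divide_distrib)
    also have "\<dots> = (\<Sum>i\<in>UNIV. (l s $ i) * (e s $ i - h s \<bullet> (?H i *v h s) / 2))"
      by (simp add: inner_vec_def right_diff_distrib sum_subtractf)
    finally have eq: "grad f (x s) \<bullet> d s + h s \<bullet> (hess f (x s) *v h s) / 2 - h s \<bullet> (HL s *v h s) / 2
        = (\<Sum>i\<in>UNIV. (l s $ i) * (e s $ i - h s \<bullet> (?H i *v h s) / 2))" .
    have "\<bar>(l s $ i) * (e s $ i - h s \<bullet> (?H i *v h s) / 2)\<bar> \<le> ?L * (L_hess_c R * norm (h s) ^ 3)" for i
    proof -
      have "\<bar>l s $ i\<bar> \<le> ?L"
        using component_le_norm_cart[of "l s" i] norm_multiplier_true_le[OF accurateD(1)[OF props(11)[OF s]]]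
        by (simp add: l_def)
      moreover have "\<bar>e s $ i - h s \<bullet> (?H i *v h s) / 2\<bar> \<le> L_hess_c R * norm (h s) ^ 3"
      proof -
        have "e s $ i = c (p s) $ i - c (x s) $ i - grad (\<lambda>y. c y $ i) (x s) \<bullet> h s"
          by (simp add: e_def grad_constraint[OF props(1)[OF s], unfolded x_def] matrix_vector_mul_component G_def x_def)
        then show ?thesis
          using hess_taylor[OF domain(2) props(1,2)[OF s] differentiability(4,5)[of _ i] lip_hess_c[of i]]
          by (simp add: props(7)[OF s])
      qed
      ultimately show ?thesis
        unfolding abs_mult by (intro mult_mono) (auto intro: order_trans[OF abs_ge_zero])
    qed
    then have "\<bar>\<Sum>i\<in>UNIV. (l s $ i) * (e s $ i - h s \<bullet> (?H i *v h s) / 2)\<bar>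
        \<le> (\<Sum>i\<in>(UNIV::'m set). ?L * (L_hess_c R * norm (h s) ^ 3))"
      by (intro order_trans[OF sum_abs] sum_mono) auto
    then show "\<bar>grad f (x s) \<bullet> d s + h s \<bullet> (hess f (x s) *v h s) / 2 - h s \<bullet> (HL s *v h s) / 2\<bar>
        \<le> real CARD('m) * (?L * L_hess_c R) * (norm (h s) * (norm (h s) * norm (h s)))"
      unfolding eq by (simp add: power3_eq_cube mult_ac)
  qed

  \<comment> \<open>For \<open>alpha P = 1\<close> the gradient accuracy is quadratic in the radius,
    and pairing with \<open>h s\<close> supplies the third power.\<close>
  have grad_err: "(\<lambda>s. (it_gb s - grad f (x s)) \<bullet> h s) \<in> ?O 3"
  proof (rule bigo_principal_le)
    have "(\<lambda>s. it_Delta s ^ 2 * norm (h s)) \<in> ?O 3"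
      by (rule bigo_Delta_prod[OF A _ _ Oh, of _ 2]) auto
    then show "(\<lambda>s. kappa_g P * (it_Delta s ^ 2 * norm (h s))) \<in> ?O 3" by (rule bigo_Delta_cmult)
    fix s assume s: "s \<in> A"
    have "\<bar>(it_gb s - grad f (x s)) \<bullet> h s\<bar> \<le> norm (it_gb s - grad f (x s)) * norm (h s)"
      by (rule Cauchy_Schwarz_ineq2)
    also have "\<dots> \<le> kappa_g P * it_Delta s ^ 2 * norm (h s)"
      using accurateD(4)[OF props(11)[OF s]] a by (intro mult_right_mono) (auto simp: x_def numeral_2_eq_2)
    finally show "\<bar>(it_gb s - grad f (x s)) \<bullet> h s\<bar> \<le> kappa_g P * (it_Delta s ^ 2 * norm (h s))" by (simp add: mult.assoc)
  qed

  have hess_err: "(\<lambda>s. h s \<bullet> ((it_Hb s - HL s) *v h s)) \<in> ?O 3"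
  proof (rule bigo_principal_le)
    obtain C where C: "0 \<le> C"
      "\<And>s :: ('d, 'z) storm_iter. s \<in> accurate \<Longrightarrow> opnorm (it_Hb s - hess_Lagr f c (it_x s)) \<le> C * it_Delta s"
      using model_hess_error[OF a] by blast
    have OH: "(\<lambda>s. opnorm (it_Hb s - HL s)) \<in> ?O 1"
    proof (rule bigo_principal_le)
      show "(\<lambda>s. C * it_Delta s ^ 1) \<in> ?O 1" by (rule bigo_Delta_cmult) simp
    qed (use C props in \<open>auto simp: HL_def\<close>)
    show "(\<lambda>s. opnorm (it_Hb s - HL s) * (norm (h s) * norm (h s))) \<in> ?O 3"
      by (rule bigo_Delta_prod[OF A _ OH Ohh]) simp
    show "\<bar>h s \<bullet> ((it_Hb s - HL s) *v h s)\<bar> \<le> opnorm (it_Hb s - HL s) * (norm (h s) * norm (h s))" for s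
      using abs_inner_matrix_le[of "h s" "it_Hb s - HL s" "h s"] by (simp add: mult.assoc)
  qed

  have noise: "(\<lambda>s. (it_fsb_soc s - f (y s)) - (it_fb s - f (x s))) \<in> ?O 3"
  proof (rule bigo_principal_le)
    show "(\<lambda>s. (2 * kappa_f P) * it_Delta s ^ 3) \<in> ?O 3" by (rule bigo_Delta_cmult) simp
    fix s assume s: "s \<in> A"
    then have "max (err_f P f c s) (err_soc P f c s) \<le> kappa_f P * it_Delta s ^ 3"
      using a by (simp add: A_def event_C'_def eval_nat_numeral)
    then show "\<bar>(it_fsb_soc s - f (y s)) - (it_fb s - f (x s))\<bar> \<le> 2 * kappa_f P * it_Delta s ^ 3"
      using s props(12)[OF s] by (simp add: A_def err_f_def err_soc_def y_def x_def abs_real_def split: if_splits)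
  qed

  \<comment> \<open>The model error telescopes through these terms: noise, Taylor remainder of the
    objective, removal of \<open>d s\<close> from the quadratic form, exchange of its first-order
    effect for constraint curvature, gradient error, Hessian error, constraint mismatch.\<close>
  define X1 X2 X3 X4 X5 X6 X7 where
    "X1 s = (it_fsb_soc s - f (y s)) - (it_fb s - f (x s))" and
    "X2 s = f (y s) - f (x s) - grad f (x s) \<bullet> (h s + d s) - (h s + d s) \<bullet> (hess f (x s) *v (h s + d s)) / 2" and
    "X3 s = (h s + d s) \<bullet> (hess f (x s) *v (h s + d s)) - h s \<bullet> (hess f (x s) *v h s)" and
    "X4 s = grad f (x s) \<bullet> d s + h s \<bullet> (hess f (x s) *v h s) / 2 - h s \<bullet> (HL s *v h s) / 2" and
    "X5 s = (it_gb s - grad f (x s)) \<bullet> h s" and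
    "X6 s = h s \<bullet> ((it_Hb s - HL s) *v h s)" and
    "X7 s = it_mu s * (norm (c (y s)) - norm (c (x s) + G s *v h s))"
    for s
  have "(\<lambda>s. X1 s + X2 s + (1/2) * X3 s + X4 s + (-1) * X5 s + (-1/2) * X6 s + X7 s) \<in> ?O 3"
    unfolding X1_def X2_def X3_def X4_def X5_def X6_def X7_def
    by (intro sum_in_bigo(1) bigo_Delta_cmult noise taylor_f cross curvature grad_err hess_err constr)
  moreover have "actual_red c s (soc_point c s) (it_fsb_soc s) - Pred c s
      = X1 s + X2 s + (1/2) * X3 s + X4 s + (-1) * X5 s + (-1/2) * X6 s + X7 s" for s
  proof -
    have 1: "actual_red c s (soc_point c s) (it_fsb_soc s) - Pred c s
        = it_fsb_soc s - it_fb s + it_mu s * (norm (c (y s)) - norm (c (x s) + G s *v h s))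
          - it_gb s \<bullet> h s - h s \<bullet> (it_Hb s *v h s) / 2"
      by (simp add: actual_red_def pred_red_def x_def h_def y_def G_def algebra_simps)
    have 2: "X6 s = h s \<bullet> (it_Hb s *v h s) - h s \<bullet> (HL s *v h s)"
      by (simp add: X6_def matrix_vector_mult_diff_rdistrib inner_diff_right)
    have 3: "X5 s = it_gb s \<bullet> h s - grad f (x s) \<bullet> h s" by (simp add: X5_def inner_diff_left)
    have 4: "X2 s = f (y s) - f (x s) - (grad f (x s) \<bullet> h s + grad f (x s) \<bullet> d s)
        - (h s + d s) \<bullet> (hess f (x s) *v (h s + d s)) / 2"
      by (simp add: X2_def inner_add_right)
    show ?thesis unfolding 1 2 3 4 X1_def X3_def X4_def X7_def by argo
  qed
  ultimately have "(\<lambda>s. actual_red c s (soc_point c s) (it_fsb_soc s) - Pred c s) \<in> ?O 3" by simp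
  then obtain C where "C > 0" and
    C: "\<And>s. s \<in> A \<Longrightarrow> \<bar>actual_red c s (soc_point c s) (it_fsb_soc s) - Pred c s\<bar> \<le> C * \<bar>it_Delta s ^ 3\<bar>"
    unfolding bigo_principal by blast
  have "actual_red c s (soc_point c s) (it_fsb_soc s) - Pred c s \<le> C * it_Delta s ^ 3" if "s \<in> A" for s
    using C[OF that] props(5)[OF that] by simp
  then show ?thesis using \<open>C > 0\<close> unfolding A_def by blast
qed

text \<open>Two regimes meet at \<open>radius P\<close>. If the constraint value exceeds it, the
  predicted reduction is linear in the radius and beats the second-order error of the trial step.
  Otherwise a rejected trial step triggers the correction, whose third-order error is beaten by a
  quadratic reduction.\<close>

lemma second_order_acceptance:
  assumes a: "alpha P = 1" and "\<delta> > 0"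
  shows "\<exists>\<zeta>>0. \<forall>s\<in>(accurate :: ('d, 'z::finite) storm_iter set). event_C P f c s \<and> event_C' P f c s \<and>
    \<delta> \<le> tau_plus f c (it_x s) (it_Z s) \<and> it_Delta s \<le> \<zeta> \<longrightarrow> accepts_trial P c s \<or> accepts_soc P c s"
proof -
  note pb = parameter_bounds
  obtain B where B: "0 \<le> B"
    "\<And>s :: ('d, 'z) storm_iter. s \<in> accurate \<Longrightarrow> opnorm (it_Hb s - hess_Lagr f c (it_x s)) \<le> B * it_Delta s"
    using model_hess_error[OF a] by blast
  obtain C where C: "C > 0" "\<And>s :: ('d, 'z) storm_iter. s \<in> accurate \<Longrightarrow> computes_trial P c s \<Longrightarrow>
      event_C P f c s \<Longrightarrow> actual_red c s (trial_point s) (it_fsb s) - Pred c s \<le> C * (it_Delta s)\<^sup>2"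
    using trial_model_error by blast
  obtain E where E: "E > 0" "\<And>s :: ('d, 'z) storm_iter. s \<in> accurate \<Longrightarrow> computes_soc P c s \<Longrightarrow>
      event_C' P f c s \<Longrightarrow> actual_red c s (soc_point c s) (it_fsb_soc s) - Pred c s \<le> E * it_Delta s ^ 3"
    using soc_model_error[OF a] by blast
  define q where "q = (1 - eta P) * kappa_fcd P * \<delta> / 4"
  have q: "q > 0" using pb assms by (simp add: q_def)
  \<comment> \<open>In turn: half of the curvature survives the Hessian error, with
    \<open>B + 1\<close> covering \<open>B = 0\<close>; the trial test succeeds; the last two
    thresholds serve the two regimes of the constraint value.\<close>
  define \<zeta> where "\<zeta> = min (\<delta> / (2 * (B + 1))) (min (\<delta> / 2) (min (q * radius P / C) (q / E)))"
  have "\<zeta> > 0" using assms q C E B pb by (simp add: \<zeta>_def add_nonneg_pos)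
  moreover have "accepts_trial P c s \<or> accepts_soc P c s"
    if s: "s \<in> accurate" and ev: "event_C P f c s" "event_C' P f c s"
      and big: "\<delta> \<le> tau_plus f c (it_x s) (it_Z s)"
      and small: "it_Delta s \<le> \<zeta>" for s :: "('d, 'z) storm_iter"
  proof -
    define d where "d = it_Delta s"
    define n where "n = norm (c (it_x s))"
    note r = regular_iterD[OF accurateD(1)[OF s]]
    have B1: "B + 1 > 0" using B by simp
    have "d \<le> \<delta> / (2 * (B + 1))" using small by (simp add: \<zeta>_def d_def)
    then have "d * (2 * (B + 1)) \<le> \<delta>" using B1 by (simp add: pos_le_divide_eq)
    then have dB: "(B + 1) * d \<le> \<delta> / 2" by (simp add: algebra_simps)
    have d: "d > 0" "d \<le> \<delta> / 2" "C * d \<le> q * radius P" "E * d \<le> q"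
      using r(8) small C E by (simp_all add: \<zeta>_def d_def field_simps)
    have "tau_plus f c (it_x s) (it_Z s) \<le> tau_bar_plus P s + B * d"
      using tau_plus_le_tau_bar_plus[OF a accurateD(1)[OF s]] B(2)[OF s] by (simp add: d_def)
    then have tau: "\<delta> / 2 \<le> tau_bar_plus P s" using big dB d(1) by (simp add: distrib_right)
    have "eta P * d \<le> 1 * (\<delta> / 2)" using pb d by (intro mult_mono) auto
    then have trial: "computes_trial P c s" using tau by (simp add: computes_trial_def d_def le_max_iff_disj)
    have n: "0 \<le> n" by (simp add: n_def)
    have "\<delta> / 2 * d * (d + n) \<le> eigen_measure P c s"
      unfolding eigen_measure_def d_def[symmetric] n_def[symmetric]
      using tau d n by (intro mult_right_mono) auto
    then have "kappa_fcd P / 2 * (\<delta> / 2 * d * (d + n)) \<le> kappa_fcd P / 2 * eigen_measure P c s"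
      using pb by (intro mult_left_mono) auto
    then have "kappa_fcd P / 2 * (\<delta> / 2 * d * (d + n)) \<le> - Pred c s"
      using pred_le_measures(2)[OF accurateD(1)[OF s] trial] by linarith
    then have "(1 - eta P) * (kappa_fcd P / 2 * (\<delta> / 2 * d * (d + n))) \<le> (1 - eta P) * (- Pred c s)"
      using pb by (intro mult_left_mono) auto
    then have qd: "q * d * (d + n) \<le> (1 - eta P) * (- Pred c s)" by (simp add: q_def field_simps)
    show ?thesis
    proof (cases "n \<le> radius P")
      case False
      have "C * d\<^sup>2 = C * d * d" by (simp add: power2_eq_square)
      also have "\<dots> \<le> q * radius P * d" using d by (intro mult_right_mono) auto
      also have "\<dots> = q * d * radius P" by simp
      also have "\<dots> \<le> q * d * (d + n)" using False q d by (intro mult_left_mono) auto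
      finally have "C * d\<^sup>2 \<le> (1 - eta P) * (- Pred c s)" using qd by simp
      then show ?thesis
        using trial_accepted[OF accurateD(1)[OF s] trial C(2)[OF s trial ev(1)]] by (simp add: d_def)
    next
      case True
      show ?thesis
      proof (cases "accepts_trial P c s")
        case False
        then have soc: "computes_soc P c s"
          using trial a True by (auto simp: computes_soc_def accepts_trial_def n_def)
        have "E * d ^ 3 = E * d * d * d" by (simp add: power3_eq_cube)
        also have "\<dots> \<le> q * d * d" using d by (intro mult_right_mono) auto
        also have "\<dots> \<le> q * d * (d + n)" using n q d by (intro mult_left_mono) auto
        finally have "E * d ^ 3 \<le> (1 - eta P) * (- Pred c s)" using qd by simp
        then have "actual_red c s (soc_point c s) (it_fsb_soc s) - Pred c s \<le> (1 - eta P) * (- Pred c s)"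
          using E(2)[OF s soc ev(2)] by (simp add: d_def)
        then show ?thesis
          using ratio_ge_of_model_error[OF Pred_neg[OF accurateD(1)[OF s] trial]] soc
          by (auto simp: accepts_soc_def)
      qed simp
    qed
  qed
  ultimately show ?thesis by blast
qed

end

section \<open>Conditional bounds\<close>

context prob_space
begin

lemma sigma_finite_subalgebraI: "subalgebra M F \<Longrightarrow> sigma_finite_subalgebra M F"
  by (rule finite_measure_subalgebra_is_sigma_finite)
    (simp add: finite_measure_subalgebra_def finite_measure_subalgebra_axioms_def finite_measure_axioms)

text \<open>A bounded weight known to \<open>F\<close> can be pulled into the conditional
  expectation. Conditional success probabilities thereby become inequalities between plain
  expectations, used later with the weights \<epsilon> and 1 / \<Delta>.\<close>

lemma expectation_failure_le:
  assumes sub: "subalgebra M F" and cond: "cond_prob_ge M F E (1 - p)"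
    and h: "h \<in> borel_measurable F" "\<And>\<omega>. \<omega> \<in> space M \<Longrightarrow> 0 \<le> h \<omega> \<and> h \<omega> \<le> B"
  shows "integrable M (\<lambda>\<omega>. h \<omega> * indicat_real {\<omega> \<in> space M. \<not> E \<omega>} \<omega>)"
    "(\<integral>\<omega>. h \<omega> * indicat_real {\<omega> \<in> space M. \<not> E \<omega>} \<omega> \<partial>M) \<le> p * (\<integral>\<omega>. h \<omega> \<partial>M)"
proof -
  interpret sigma_finite_subalgebra M F by (rule sigma_finite_subalgebraI[OF sub])
  let ?A = "{\<omega> \<in> space M. E \<omega>}" and ?B = "{\<omega> \<in> space M. \<not> E \<omega>}"
  have A [measurable]: "?A \<in> sets M" using cond by (simp add: cond_prob_ge_def)
  have "?B = space M - ?A" by auto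
  then have B [measurable]: "?B \<in> sets M" using A by simp
  have hM [measurable]: "h \<in> borel_measurable M" by (rule measurable_from_subalg[OF sub h(1)])
  have int_h: "integrable M h"
    by (rule integrable_const_bound[of _ B]) (use h(2) in auto)
  have bound: "norm (h \<omega> * indicat_real C \<omega>) \<le> B" if "\<omega> \<in> space M" for C \<omega>
    using h(2)[OF that] by (auto simp: indicator_def)
  have int_A: "integrable M (\<lambda>\<omega>. h \<omega> * indicat_real ?A \<omega>)"
    by (rule integrable_const_bound[of _ B], rule AE_I2, rule bound) auto
  show int_B: "integrable M (\<lambda>\<omega>. h \<omega> * indicat_real ?B \<omega>)"
    by (rule integrable_const_bound[of _ B], rule AE_I2, rule bound) auto
  have "(1 - p) * (\<integral>\<omega>. h \<omega> \<partial>M) = (\<integral>\<omega>. h \<omega> * (1 - p) \<partial>M)" by simp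
  also have "\<dots> \<le> (\<integral>\<omega>. h \<omega> * real_cond_exp M F (indicat_real ?A) \<omega> \<partial>M)"
  proof (rule integral_mono_AE)
    show "integrable M (\<lambda>\<omega>. h \<omega> * (1 - p))" using int_h by simp
    show "integrable M (\<lambda>\<omega>. h \<omega> * real_cond_exp M F (indicat_real ?A) \<omega>)"
      by (rule real_cond_exp_intg[OF int_A h(1)]) simp
    show "AE \<omega> in M. h \<omega> * (1 - p) \<le> h \<omega> * real_cond_exp M F (indicat_real ?A) \<omega>"
      using conjunct2[OF cond[unfolded cond_prob_ge_def]]
      by (rule AE_mp) (intro AE_I2 impI mult_left_mono, use h(2) in auto)
  qed
  also have "\<dots> = (\<integral>\<omega>. h \<omega> * indicat_real ?A \<omega> \<partial>M)"
    by (rule real_cond_exp_intg[OF int_A h(1)]) simp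
  also have "\<dots> = (\<integral>\<omega>. h \<omega> - h \<omega> * indicat_real ?B \<omega> \<partial>M)"
    by (rule Bochner_Integration.integral_cong) (auto simp: indicator_def)
  also have "\<dots> = (\<integral>\<omega>. h \<omega> \<partial>M) - (\<integral>\<omega>. h \<omega> * indicat_real ?B \<omega> \<partial>M)"
    by (rule Bochner_Integration.integral_diff[OF int_h int_B])
  finally show "(\<integral>\<omega>. h \<omega> * indicat_real ?B \<omega> \<partial>M) \<le> p * (\<integral>\<omega>. h \<omega> \<partial>M)" by (simp add: algebra_simps)
qed

text \<open>Division by the \<open>F\<close>-measurable \<open>e\<close> makes the bound linear in
  \<open>e\<close>, as the Lyapunov balance requires. The nonnegative conditional expectation is
  used first, since integrability of the quotient is itself a conclusion.\<close>

lemma expectation_scaled_second_moment_le: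
  assumes sub: "subalgebra M F" and mom: "cond_second_moment_le M F X (\<lambda>\<omega>. (e \<omega>)\<^sup>2)"
    and e: "e \<in> borel_measurable F" "\<And>\<omega>. \<omega> \<in> space M \<Longrightarrow> 0 < e \<omega> \<and> e \<omega> \<le> B"
  shows "integrable M (\<lambda>\<omega>. (X \<omega>)\<^sup>2 / e \<omega>)" "(\<integral>\<omega>. (X \<omega>)\<^sup>2 / e \<omega> \<partial>M) \<le> (\<integral>\<omega>. e \<omega> \<partial>M)"
proof -
  interpret sigma_finite_subalgebra M F by (rule sigma_finite_subalgebraI[OF sub])
  have X [measurable]: "X \<in> borel_measurable M" using mom by (simp add: cond_second_moment_le_def)
  have eM [measurable]: "e \<in> borel_measurable M" by (rule measurable_from_subalg[OF sub e(1)])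
  have int_e: "integrable M e"
    by (rule integrable_const_bound[of _ B]) (use e(2) in \<open>auto simp: less_imp_le abs_of_pos\<close>)
  have "(\<integral>\<^sup>+\<omega>. ennreal ((X \<omega>)\<^sup>2 / e \<omega>) \<partial>M) = (\<integral>\<^sup>+\<omega>. ennreal (1 / e \<omega>) * ennreal ((X \<omega>)\<^sup>2) \<partial>M)"
    by (rule nn_integral_cong) (use e(2) in \<open>simp add: ennreal_mult'[symmetric] less_imp_le\<close>)
  also have "\<dots> = (\<integral>\<^sup>+\<omega>. ennreal (1 / e \<omega>) * nn_cond_exp M F (\<lambda>\<omega>. ennreal ((X \<omega>)\<^sup>2)) \<omega> \<partial>M)"
    using e(1) by (intro nn_cond_exp_intg[symmetric]) auto
  also have "\<dots> \<le> (\<integral>\<^sup>+\<omega>. ennreal (1 / e \<omega>) * ennreal ((e \<omega>)\<^sup>2) \<partial>M)"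
    using mom unfolding cond_second_moment_le_def
    by (intro nn_integral_mono_AE) (auto elim!: eventually_mono intro!: mult_left_mono)
  also have "\<dots> = (\<integral>\<^sup>+\<omega>. ennreal (e \<omega>) \<partial>M)"
    by (rule nn_integral_cong) (use e(2) in \<open>simp add: ennreal_mult'[symmetric] less_imp_le power2_eq_square\<close>)
  also have "\<dots> = ennreal (\<integral>\<omega>. e \<omega> \<partial>M)"
    by (rule nn_integral_eq_integral[OF int_e]) (use e(2) in \<open>auto simp: less_imp_le\<close>)
  finally have le: "(\<integral>\<^sup>+\<omega>. ennreal ((X \<omega>)\<^sup>2 / e \<omega>) \<partial>M) \<le> ennreal (\<integral>\<omega>. e \<omega> \<partial>M)" .
  have nonneg: "AE \<omega> in M. 0 \<le> (X \<omega>)\<^sup>2 / e \<omega>" using e(2) by (auto simp: less_imp_le)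
  show int: "integrable M (\<lambda>\<omega>. (X \<omega>)\<^sup>2 / e \<omega>)"
    by (rule integrableI_nonneg) (use le nonneg in \<open>auto simp: top.not_eq_extremum less_top intro: le_less_trans\<close>)
  have "0 \<le> (\<integral>\<omega>. e \<omega> \<partial>M)" using e(2) by (intro integral_nonneg_AE) (auto simp: less_imp_le)
  then show "(\<integral>\<omega>. (X \<omega>)\<^sup>2 / e \<omega> \<partial>M) \<le> (\<integral>\<omega>. e \<omega> \<partial>M)"
    using le unfolding nn_integral_eq_integral[OF int nonneg] by (simp add: ennreal_le_iff)
qed

end

lemma am_gm_scaled: "0 < t \<Longrightarrow> 0 < e \<Longrightarrow> x \<le> t / 2 * (x\<^sup>2 / e) + e / (2 * t)" for x e t :: real
proof -
  assume "0 < t" "0 < e"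
  have "0 \<le> (t * x - e)\<^sup>2 / (2 * t * e)" using \<open>0 < t\<close> \<open>0 < e\<close> by simp
  also have "\<dots> = t / 2 * (x\<^sup>2 / e) + e / (2 * t) - x"
    using \<open>0 < t\<close> \<open>0 < e\<close> by (simp add: field_simps power2_eq_square)
  finally show ?thesis by simp
qed

text \<open>Thresholds \<open>1 / real (Suc n)\<close> suffice, so only countably many null sets
  have to be discarded.\<close>

lemma liminf_eq_0I:
  fixes X :: "nat \<Rightarrow> real"
  assumes nonneg: "\<And>k. 0 \<le> X k" and freq: "\<And>n. \<not> (\<exists>K. \<forall>k\<ge>K. 1 / real (Suc n) \<le> X k)"
  shows "liminf (\<lambda>k. ereal (X k)) = 0"
proof (rule antisym)
  show "0 \<le> liminf (\<lambda>k. ereal (X k))" using nonneg by (intro Liminf_bounded) auto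
  show "liminf (\<lambda>k. ereal (X k)) \<le> 0"
  proof (rule ccontr)
    assume "\<not> liminf (\<lambda>k. ereal (X k)) \<le> 0"
    then have "0 < liminf (\<lambda>k. ereal (X k))" by simp
    then obtain r where r: "0 < ereal r" "ereal r < liminf (\<lambda>k. ereal (X k))" using ereal_dense2 by blast
    then obtain n where n: "1 / real (Suc n) < r" using reals_Archimedean[of r] by (auto simp: inverse_eq_divide)
    have "eventually (\<lambda>k. ereal r < ereal (X k)) sequentially" using r(2) by (rule less_LiminfD)
    then have "\<exists>K. \<forall>k\<ge>K. 1 / real (Suc n) \<le> X k"
      unfolding eventually_sequentially using n by (auto intro: less_imp_le less_trans)
    then show False using freq by blast
  qed
qed

section \<open>The stochastic process\<close>

locale storm_process = storm_regularity P f c R \<Omega> \<mu>hat + prob_space M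
  for P :: "'d::finite storm_params" and f and c :: "real^'d \<Rightarrow> real^'m::finite"
    and R \<Omega> \<mu>hat and M :: "'w measure" +
  fixes Fpre Fmid :: "nat \<Rightarrow> 'w measure" and S :: "nat \<Rightarrow> 'w \<Rightarrow> ('d, 'z::finite) storm_iter" and \<nu> :: real
  assumes filtration: "storm_filtration M Fpre Fmid"
    and adapted: "storm_adapted P c Fpre Fmid S"
    and algorithm: "\<forall>\<omega>\<in>space M. storm_path P c (\<lambda>k. S k \<omega>)"
    and accuracy: "probabilistic_accuracy P f c M Fpre Fmid S"
    and regular: "regularity P f c R \<Omega> M S"
    and stabilization: "merit_stabilization M S \<mu>hat"
    and nu: "0 < \<nu>" "\<nu> < 1"
    and nu_large: "\<nu> / (1 - \<nu>) \<ge> 2 * gamma P / eta P"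
    and p_small: "p_h P + p_g P + 2 * p_f P \<le> (1 - \<nu>)\<^sup>2 / (16 * \<nu>\<^sup>2) * (1 - 1 / gamma P)\<^sup>2"
begin

section \<open>Bounds along sample paths\<close>

lemma path:
  assumes "\<omega> \<in> space M"
  shows "it_x (S 0 \<omega>) = x_init P" "it_Delta (S 0 \<omega>) = Delta_init P" "it_eps (S 0 \<omega>) = eps_init P"
    "it_mu_in (S 0 \<omega>) = mu_init P" "iteration_ok P c (S k \<omega>)" "transition P c (S k \<omega>) (S (Suc k) \<omega>)"
  using algorithm assms by (auto simp: storm_path_def)

lemma initial_bounds: "0 < Delta_init P" "Delta_init P < Delta_max P" "0 < eps_init P" "0 < mu_init P"
  "0 < p_h P" "0 < p_g P" "0 < p_f P"
  using params by (auto simp: valid_params_def)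

lemma mu_increasing:
  assumes "\<omega> \<in> space M" "0 < it_mu_in (S k \<omega>)"
  shows "it_mu_in (S k \<omega>) \<le> it_mu (S k \<omega>)"
proof (cases "computes_trial P c (S k \<omega>)")
  case True
  then obtain n where "it_mu (S k \<omega>) = rho P ^ n * it_mu_in (S k \<omega>)"
    using path(5)[OF assms(1), of k] by (auto simp: iteration_ok_def merit_update_def)
  then show ?thesis using parameter_bounds(12) assms(2) by (simp add: one_le_power less_imp_le)
next
  case False
  then show ?thesis using path(5)[OF assms(1), of k] by (simp add: iteration_ok_def)
qed

text \<open>The geometric bounds degrade with \<open>k\<close> but are deterministic, which is
  enough for integrability of \<epsilon> and of 1 / \<Delta> at each fixed index.\<close>

lemma state_bounds:
  assumes "\<omega> \<in> space M"
  shows "Delta_init P / gamma P ^ k \<le> it_Delta (S k \<omega>)" "it_Delta (S k \<omega>) \<le> Delta_max P"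
    "0 < it_eps (S k \<omega>)" "it_eps (S k \<omega>) \<le> eps_init P * gamma P ^ k" "0 < it_mu_in (S k \<omega>)"
proof -
  have g: "gamma P > 1" by (rule parameter_bounds)
  have "Delta_init P / gamma P ^ k \<le> it_Delta (S k \<omega>) \<and> it_Delta (S k \<omega>) \<le> Delta_max P \<and>
    0 < it_eps (S k \<omega>) \<and> it_eps (S k \<omega>) \<le> eps_init P * gamma P ^ k \<and> 0 < it_mu_in (S k \<omega>)"
  proof (induction k)
    case 0
    then show ?case using initial_bounds by (simp add: path[OF assms])
  next
    case (Suc k)
    note tr = path(6)[OF assms, of k]
    have pos: "0 < Delta_init P / gamma P ^ k" using initial_bounds g by simp
    have low: "Delta_init P / gamma P ^ Suc k \<le> it_Delta (S k \<omega>) / gamma P"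
      using Suc divide_right_mono[of "Delta_init P / gamma P ^ k" "it_Delta (S k \<omega>)" "gamma P"] g
      by (simp add: power_Suc2 del: power_Suc)
    have Dpos: "0 < it_Delta (S k \<omega>)" using Suc pos by (auto elim: less_le_trans)
    then have "it_Delta (S k \<omega>) / gamma P \<le> it_Delta (S k \<omega>) * 1"
      using g by (simp add: pos_divide_le_eq)
    moreover have "it_Delta (S k \<omega>) * 1 \<le> it_Delta (S k \<omega>) * gamma P"
      using Dpos g by (intro mult_left_mono) auto
    ultimately have D: "it_Delta (S k \<omega>) / gamma P \<le> it_Delta (S k \<omega>)"
      "it_Delta (S k \<omega>) \<le> gamma P * it_Delta (S k \<omega>)" by (simp_all add: mult.commute)
    have Delta: "it_Delta (S (Suc k) \<omega>) \<in> {it_Delta (S k \<omega>) / gamma P, min (gamma P * it_Delta (S k \<omega>)) (Delta_max P)}"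
      using tr by (auto simp: transition_def split: if_splits)
    have "it_eps (S k \<omega>) / gamma P \<le> it_eps (S k \<omega>) * 1" using Suc g by (simp add: pos_divide_le_eq)
    moreover have "it_eps (S k \<omega>) * 1 \<le> it_eps (S k \<omega>) * gamma P"
      using Suc g by (intro mult_left_mono) auto
    ultimately have E: "it_eps (S k \<omega>) / gamma P \<le> gamma P * it_eps (S k \<omega>)" by (simp add: mult.commute)
    have eps: "it_eps (S (Suc k) \<omega>) \<in> {it_eps (S k \<omega>) / gamma P, gamma P * it_eps (S k \<omega>)}"
      using tr by (auto simp: transition_def split: if_splits)
    have up: "gamma P * it_eps (S k \<omega>) \<le> eps_init P * gamma P ^ Suc k"
      using Suc g by (simp add: mult.left_commute)
    have "0 < it_mu_in (S (Suc k) \<omega>)"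
      using mu_increasing[OF assms] Suc tr by (fastforce simp: transition_def)
    moreover have "0 < it_eps (S (Suc k) \<omega>)" using eps Suc g by auto
    moreover have "it_eps (S (Suc k) \<omega>) \<le> eps_init P * gamma P ^ Suc k"
      using eps order_trans[OF E up] up by (auto simp del: power_Suc)
    moreover have "Delta_init P / gamma P ^ Suc k \<le> it_Delta (S (Suc k) \<omega>)"
      "it_Delta (S (Suc k) \<omega>) \<le> Delta_max P"
      using Delta D low Suc by auto
    ultimately show ?case by blast
  qed
  then show "Delta_init P / gamma P ^ k \<le> it_Delta (S k \<omega>)" "it_Delta (S k \<omega>) \<le> Delta_max P"
    "0 < it_eps (S k \<omega>)" "it_eps (S k \<omega>) \<le> eps_init P * gamma P ^ k" "0 < it_mu_in (S k \<omega>)" by auto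
qed

lemma Delta_pos: "\<omega> \<in> space M \<Longrightarrow> 0 < it_Delta (S k \<omega>)"
  using state_bounds(1)[of \<omega> k] initial_bounds(1) parameter_bounds(11)
  by (meson divide_pos_pos less_le_trans less_trans zero_less_one zero_less_power)

lemma regular_iter_path: "\<omega> \<in> space M \<Longrightarrow> regular_iter (S k \<omega>)"
  using regular state_bounds[of \<omega> k] Delta_pos[of \<omega> k] path(5)[of \<omega> k] mu_increasing[of \<omega> k]
  unfolding regularity_def regular_iter_def Let_def by (auto intro: less_le_trans)

text \<open>The merit parameter is nondecreasing, so the bound valid after stabilization extends
  back to every earlier index.\<close>

lemma mu_bounded: "AE \<omega> in M. \<forall>k. it_mu (S k \<omega>) \<le> \<mu>hat"
  using stabilization unfolding merit_stabilization_def
proof (rule AE_mp, intro AE_I2 impI allI)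
  fix \<omega> k assume w: "\<omega> \<in> space M"
    and "\<exists>K. \<forall>k\<ge>K. it_mu (S k \<omega>) = it_mu (S K \<omega>) \<and> it_mu (S K \<omega>) \<le> \<mu>hat"
  then obtain K where K: "\<And>k. k \<ge> K \<Longrightarrow> it_mu (S k \<omega>) \<le> \<mu>hat" by force
  have mono: "it_mu (S n \<omega>) \<le> it_mu (S (Suc n) \<omega>)" for n
    using mu_increasing[OF w state_bounds(5)[OF w], of "Suc n"] path(6)[OF w, of n]
    by (simp add: transition_def)
  have "it_mu (S k \<omega>) \<le> it_mu (S (max k K) \<omega>)"
    by (rule lift_Suc_mono_le[of "\<lambda>n. it_mu (S n \<omega>)", OF mono]) simp
  then show "it_mu (S k \<omega>) \<le> \<mu>hat" using K[of "max k K"] by simp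
qed

lemma subalgebras: "subalgebra M (Fpre k)" "subalgebra M (Fmid k)" "subalgebra (Fmid k) (Fpre k)"
  "subalgebra (Fpre (Suc k)) (Fmid k)"
  using filtration by (auto simp: storm_filtration_def)

lemma adapted_measurable:
  "(\<lambda>\<omega>. it_x (S k \<omega>)) \<in> borel_measurable (Fpre k)"
  "(\<lambda>\<omega>. it_Delta (S k \<omega>)) \<in> borel_measurable (Fpre k)"
  "(\<lambda>\<omega>. it_eps (S k \<omega>)) \<in> borel_measurable (Fpre k)"
  using adapted by (auto simp: storm_adapted_def)

lemma adapted_measurable_M [measurable]:
  "(\<lambda>\<omega>. it_x (S k \<omega>)) \<in> borel_measurable M"
  "(\<lambda>\<omega>. it_Delta (S k \<omega>)) \<in> borel_measurable M"
  "(\<lambda>\<omega>. it_eps (S k \<omega>)) \<in> borel_measurable M"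
  by (rule measurable_from_subalg[OF subalgebras(1)], rule adapted_measurable)+

lemma conditions:
  "alpha P = 1 \<Longrightarrow> cond_prob_ge M (Fpre k) (\<lambda>\<omega>. event_A P f (S k \<omega>)) (1 - p_h P)"
  "cond_prob_ge M (Fpre k) (\<lambda>\<omega>. event_B P f (S k \<omega>)) (1 - p_g P)"
  "cond_prob_ge M (Fmid k) (\<lambda>\<omega>. event_C P f c (S k \<omega>)) (1 - p_f P)"
  "cond_prob_ge M (Fmid k) (\<lambda>\<omega>. event_C' P f c (S k \<omega>)) (1 - p_f P)"
  "cond_second_moment_le M (Fmid k) (\<lambda>\<omega>. err_f P f c (S k \<omega>)) (\<lambda>\<omega>. (it_eps (S k \<omega>))\<^sup>2)"
  "cond_second_moment_le M (Fmid k) (\<lambda>\<omega>. err_fs P f c (S k \<omega>)) (\<lambda>\<omega>. (it_eps (S k \<omega>))\<^sup>2)"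
  "cond_second_moment_le M (Fmid k) (\<lambda>\<omega>. err_soc P f c (S k \<omega>)) (\<lambda>\<omega>. (it_eps (S k \<omega>))\<^sup>2)"
  using accuracy by (auto simp: probabilistic_accuracy_def)

lemma eps_integrable: "integrable M (\<lambda>\<omega>. it_eps (S k \<omega>))"
  by (rule integrable_const_bound[of _ "eps_init P * gamma P ^ k"])
    (use state_bounds(3,4) in \<open>auto simp: less_imp_le abs_of_pos\<close>)

subsection \<open>Vanishing trust-region radius\<close>

text \<open>The optimal trade-off in the arithmetic-geometric mean inequality between the second moment of the
  error and the probability \<open>p_f\<close> of an inaccurate estimate.\<close>

definition error_majorant :: "nat \<Rightarrow> 'w \<Rightarrow> real" where
  "error_majorant k \<omega> =
    (let s = S k \<omega>; t = sqrt (p_f P) in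
      t / 2 * (2 * ((err_f P f c s)\<^sup>2 / it_eps s) + (err_fs P f c s)\<^sup>2 / it_eps s + (err_soc P f c s)\<^sup>2 / it_eps s)
      + 1 / t * (it_eps s * indicat_real {\<omega> \<in> space M. \<not> event_C P f c (S k \<omega>)} \<omega>
               + it_eps s * indicat_real {\<omega> \<in> space M. \<not> event_C' P f c (S k \<omega>)} \<omega>))"

text \<open>\<open>am_gm_scaled\<close> splits each error into a square and a multiple of
  \<epsilon>. Only the latter keeps the indicator of inaccuracy; the squares are bounded without it
  so that their conditional second moments can be used.\<close>

lemma accepted_error_le_majorant:
  assumes w: "\<omega> \<in> space M"
  shows "accepted_error (S k \<omega>) \<le> error_majorant k \<omega>"
proof -
  define s where "s = S k \<omega>"
  define t where "t = sqrt (p_f P)"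
  have t: "t > 0" using initial_bounds by (simp add: t_def)
  have e: "it_eps s > 0" using state_bounds(3)[OF w] by (simp add: s_def)
  define F1 F2 F3 where "F1 = (err_f P f c s)\<^sup>2 / it_eps s" and "F2 = (err_fs P f c s)\<^sup>2 / it_eps s"
    and "F3 = (err_soc P f c s)\<^sup>2 / it_eps s"
  define g where "g = it_eps s / (2 * t)"
  have nonneg: "0 \<le> t / 2 * F1" "0 \<le> t / 2 * F2" "0 \<le> t / 2 * F3" "0 \<le> g"
    using e t by (simp_all add: F1_def F2_def F3_def g_def)
  have err: "err_f P f c s \<le> t / 2 * F1 + g" "err_fs P f c s \<le> t / 2 * F2 + g" "err_soc P f c s \<le> t / 2 * F3 + g"
    unfolding F1_def F2_def F3_def g_def by (rule am_gm_scaled[OF t e])+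
  have maj: "error_majorant k \<omega> = 2 * (t / 2 * F1) + t / 2 * F2 + t / 2 * F3
      + (2 * g) * indicat_real {\<omega> \<in> space M. \<not> event_C P f c (S k \<omega>)} \<omega>
      + (2 * g) * indicat_real {\<omega> \<in> space M. \<not> event_C' P f c (S k \<omega>)} \<omega>"
    unfolding error_majorant_def Let_def s_def[symmetric] t_def[symmetric] F1_def F2_def F3_def g_def
    by (simp add: algebra_simps)
  show ?thesis
    unfolding maj using w err nonneg trial_soc_exclusive[of s]
    by (simp add: accepted_error_def indicator_def s_def[symmetric])
qed

text \<open>The four squares and the two failure indicators contribute
  \<open>2 * sqrt (p_f P)\<close> times the expectation of \<epsilon> each as a group; the weight
  \<open>sqrt (p_f P)\<close> balances them.\<close>

lemma expectation_error_majorant: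
  "integrable M (error_majorant k)"
  "(\<integral>\<omega>. error_majorant k \<omega> \<partial>M) \<le> 4 * sqrt (p_f P) * (\<integral>\<omega>. it_eps (S k \<omega>) \<partial>M)"
proof -
  let ?e = "\<lambda>\<omega>. it_eps (S k \<omega>)" and ?E = "\<integral>\<omega>. it_eps (S k \<omega>) \<partial>M" and ?t = "sqrt (p_f P)"
  have emid: "?e \<in> borel_measurable (Fmid k)"
    by (rule measurable_from_subalg[OF subalgebras(3) adapted_measurable(3)])
  have eb: "0 < ?e \<omega> \<and> ?e \<omega> \<le> eps_init P * gamma P ^ k" if "\<omega> \<in> space M" for \<omega>
    using state_bounds[OF that] by simp
  then have eb': "0 \<le> ?e \<omega> \<and> ?e \<omega> \<le> eps_init P * gamma P ^ k" if "\<omega> \<in> space M" for \<omega>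
    using that by (simp add: less_imp_le)
  note mom = expectation_scaled_second_moment_le[OF subalgebras(2) _ emid eb]
  note fail = expectation_failure_le[OF subalgebras(2) _ emid eb']
  define F1 F2 F3 I1 I2 where
    "F1 \<omega> = (err_f P f c (S k \<omega>))\<^sup>2 / ?e \<omega>" and "F2 \<omega> = (err_fs P f c (S k \<omega>))\<^sup>2 / ?e \<omega>" and
    "F3 \<omega> = (err_soc P f c (S k \<omega>))\<^sup>2 / ?e \<omega>" and
    "I1 \<omega> = ?e \<omega> * indicat_real {\<omega> \<in> space M. \<not> event_C P f c (S k \<omega>)} \<omega>" and
    "I2 \<omega> = ?e \<omega> * indicat_real {\<omega> \<in> space M. \<not> event_C' P f c (S k \<omega>)} \<omega>" for \<omega>
  have int: "integrable M F1" "integrable M F2" "integrable M F3" "integrable M I1" "integrable M I2"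
    unfolding F1_def F2_def F3_def I1_def I2_def using mom(1) fail(1) conditions by blast+
  have le: "(\<integral>\<omega>. F1 \<omega> \<partial>M) \<le> ?E" "(\<integral>\<omega>. F2 \<omega> \<partial>M) \<le> ?E" "(\<integral>\<omega>. F3 \<omega> \<partial>M) \<le> ?E"
    "(\<integral>\<omega>. I1 \<omega> \<partial>M) \<le> p_f P * ?E" "(\<integral>\<omega>. I2 \<omega> \<partial>M) \<le> p_f P * ?E"
    unfolding F1_def F2_def F3_def I1_def I2_def using mom(2) fail(2) conditions by blast+
  have eq: "error_majorant k = (\<lambda>\<omega>. ?t / 2 * (2 * F1 \<omega> + F2 \<omega> + F3 \<omega>) + 1 / ?t * (I1 \<omega> + I2 \<omega>))"
    by (simp add: error_majorant_def Let_def F1_def F2_def F3_def I1_def I2_def fun_eq_iff)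
  show "integrable M (error_majorant k)" unfolding eq using int by simp
  have "(\<integral>\<omega>. error_majorant k \<omega> \<partial>M) = ?t / 2 * (2 * (\<integral>\<omega>. F1 \<omega> \<partial>M) + (\<integral>\<omega>. F2 \<omega> \<partial>M) + (\<integral>\<omega>. F3 \<omega> \<partial>M))
      + 1 / ?t * ((\<integral>\<omega>. I1 \<omega> \<partial>M) + (\<integral>\<omega>. I2 \<omega> \<partial>M))"
    unfolding eq using int by simp
  also have "\<dots> \<le> ?t / 2 * (2 * ?E + ?E + ?E) + 1 / ?t * (p_f P * ?E + p_f P * ?E)"
    using le initial_bounds(7) by (intro add_mono mult_left_mono) auto
  also have "\<dots> = 2 * ?t * ?E + 2 * (p_f P / ?t) * ?E" by (simp add: algebra_simps)
  also have "p_f P / ?t = ?t" using initial_bounds(7) by (simp add: real_div_sqrt)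
  finally show "(\<integral>\<omega>. error_majorant k \<omega> \<partial>M) \<le> 4 * ?t * ?E" by simp
qed

text \<open>The square root of the smallness condition on the failure probabilities: the factor 16
  there is the square of the factor 4 in the expected error.\<close>

lemma noise_dominated: "\<nu> * (4 * sqrt (p_f P)) \<le> (1 - 1 / gamma P) * (1 - \<nu>)"
proof -
  let ?X = "(1 - \<nu>) / \<nu> * (1 - 1 / gamma P)"
  have X: "0 \<le> ?X" using nu parameter_bounds(11) by simp
  have "16 * p_f P \<le> ?X\<^sup>2"
    using p_small initial_bounds by (simp add: power_mult_distrib power_divide)
  then have "sqrt (16 * p_f P) \<le> \<bar>?X\<bar>" using real_sqrt_le_mono[of "16 * p_f P" "?X\<^sup>2"] by (simp only: real_sqrt_abs)
  then have "sqrt (16 * p_f P) \<le> ?X" using X by (simp only: abs_of_nonneg)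
  then have "4 * sqrt (p_f P) \<le> ?X" by (simp add: real_sqrt_mult)
  then have "\<nu> * (4 * sqrt (p_f P)) \<le> \<nu> * ?X" using nu by (intro mult_left_mono) auto
  also have "\<nu> * ?X = (1 - 1 / gamma P) * (1 - \<nu>)" using nu by (simp add: field_simps)
  finally show ?thesis .
qed

text \<open>Since \<open>norm (c x) - kappa_c R\<close> is never positive at an iterate, an increase
  of the merit parameter can only lower the value; the constant \<open>kappa_c R * \<mu>hat\<close>
  restores nonnegativity. The incoming parameter \<open>it_mu_in\<close> is used because it is the
  updated parameter of the previous iteration.\<close>

definition lyapunov :: "nat \<Rightarrow> 'w \<Rightarrow> real" where
  "lyapunov k \<omega> = \<nu> * (f (it_x (S k \<omega>)) - f_inf R
      + it_mu_in (S k \<omega>) * (norm (c (it_x (S k \<omega>))) - kappa_c R) + kappa_c R * \<mu>hat)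
    + radius_weight \<nu> * it_Delta (S k \<omega>) ^ (alpha P + 2) + (1 - \<nu>) * it_eps (S k \<omega>)"

lemma radius_weight_pos: "0 < radius_weight \<nu>"
  using parameter_bounds nu by (simp add: radius_weight_def)

lemma lyapunov_nonneg:
  assumes w: "\<omega> \<in> space M" and mu: "it_mu (S k \<omega>) \<le> \<mu>hat"
  shows "0 \<le> lyapunov k \<omega>"
proof -
  note r = regular_iterD[OF regular_iter_path[OF w, of k]]
  have m: "0 < it_mu_in (S k \<omega>)" "it_mu_in (S k \<omega>) \<le> \<mu>hat"
    using state_bounds(5)[OF w] mu_increasing[OF w] mu order_trans by blast+
  have "f_inf R \<le> f (it_x (S k \<omega>))" using f_lower r(1) by simp
  moreover have "it_mu_in (S k \<omega>) * kappa_c R \<le> \<mu>hat * kappa_c R"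
    using m constants_pos by (intro mult_right_mono) auto
  moreover have "0 \<le> it_mu_in (S k \<omega>) * norm (c (it_x (S k \<omega>)))" using m by simp
  ultimately have "0 \<le> f (it_x (S k \<omega>)) - f_inf R
      + it_mu_in (S k \<omega>) * (norm (c (it_x (S k \<omega>))) - kappa_c R) + kappa_c R * \<mu>hat"
    by (simp add: algebra_simps)
  from mult_nonneg_nonneg[OF less_imp_le[OF nu(1)] this] show ?thesis
    unfolding lyapunov_def using nu radius_weight_pos r(8,10) by (intro add_nonneg_nonneg) auto
qed

lemma lyapunov_decrease:
  assumes w: "\<omega> \<in> space M"
  shows "lyapunov (Suc k) \<omega> + (1 - 1 / gamma P) * (radius_weight \<nu> * it_Delta (S k \<omega>) ^ (alpha P + 2)
      + (1 - \<nu>) * it_eps (S k \<omega>)) \<le> lyapunov k \<omega> + \<nu> * error_majorant k \<omega>"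
proof -
  define s s' where "s = S k \<omega>" and "s' = S (Suc k) \<omega>"
  note r = regular_iterD[OF regular_iter_path[OF w, of k], folded s_def]
  have tr: "transition P c s s'" using path(6)[OF w] by (simp add: s_def s'_def)
  have mu': "it_mu_in s' = it_mu s" using tr by (simp add: transition_def)
  \<comment> \<open>The update of the merit parameter at the fixed point \<open>it_x s\<close> comes
    before the step and does not increase the Lyapunov value.\<close>
  have "(it_mu s - it_mu_in s) * (norm (c (it_x s)) - kappa_c R) \<le> 0"
    using mu_increasing[OF w state_bounds(5)[OF w]] r(4) by (intro mult_nonneg_nonpos) (auto simp: s_def)
  from mult_nonneg_nonpos[OF less_imp_le[OF nu(1)] this]
  have "\<nu> * ((it_mu s - it_mu_in s) * (norm (c (it_x s)) - kappa_c R)) \<le> 0" .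
  moreover have "\<nu> * accepted_error s \<le> \<nu> * error_majorant k \<omega>"
    using accepted_error_le_majorant[OF w, of k] nu by (intro mult_left_mono) (auto simp: s_def)
  moreover note lyapunov_step[OF regular_iter_path[OF w, of k, folded s_def] tr nu nu_large]
  ultimately show ?thesis
    unfolding lyapunov_def s_def[symmetric] s'_def[symmetric] mu' by (simp add: algebra_simps)
qed

lemma Delta_power_integrable: "integrable M (\<lambda>\<omega>. it_Delta (S k \<omega>) ^ (alpha P + 2))"
proof (rule integrable_const_bound[of _ "Delta_max P ^ (alpha P + 2)"])
  show "AE \<omega> in M. norm (it_Delta (S k \<omega>) ^ (alpha P + 2)) \<le> Delta_max P ^ (alpha P + 2)"
  proof (rule AE_I2)
    fix \<omega> assume w: "\<omega> \<in> space M"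
    show "norm (it_Delta (S k \<omega>) ^ (alpha P + 2)) \<le> Delta_max P ^ (alpha P + 2)"
      unfolding norm_power using Delta_pos[OF w, of k] state_bounds(2)[OF w, of k] by (intro power_mono) auto
  qed
qed simp

text \<open>Telescoping is done pathwise before integrating, so the Lyapunov function itself is
  never integrated: its initial value is deterministic and its final value is dropped by
  nonnegativity.\<close>

lemma expected_radius_sum:
  "\<exists>B. \<forall>n. (\<Sum>k<n. \<integral>\<omega>. it_Delta (S k \<omega>) ^ (alpha P + 2) \<partial>M) \<le> B"
proof -
  let ?g = "1 - 1 / gamma P" and ?a = "radius_weight \<nu>"
  define B0 where "B0 = \<nu> * (f (x_init P) - f_inf R + mu_init P * (norm (c (x_init P)) - kappa_c R) + kappa_c R * \<mu>hat)
    + ?a * Delta_init P ^ (alpha P + 2) + (1 - \<nu>) * eps_init P"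
  have g: "?g > 0" using parameter_bounds(11) by simp
  have init: "lyapunov 0 \<omega> = B0" if "\<omega> \<in> space M" for \<omega>
    by (simp only: lyapunov_def path[OF that] B0_def)
  define X E where "X k \<omega> = it_Delta (S k \<omega>) ^ (alpha P + 2)" and "E k \<omega> = it_eps (S k \<omega>)" for k \<omega>
  have intX: "integrable M (X k)" and intE: "integrable M (E k)" for k
    using Delta_power_integrable[of k] eps_integrable[of k] unfolding X_def E_def .
  have "(\<Sum>k<n. \<integral>\<omega>. X k \<omega> \<partial>M) \<le> B0 / (?g * ?a)" for n
  proof -
    have "AE \<omega> in M. (\<Sum>k<n. ?g * (?a * X k \<omega> + (1 - \<nu>) * E k \<omega>) - \<nu> * error_majorant k \<omega>) \<le> B0"
      using mu_bounded
    proof (rule AE_mp, intro AE_I2 impI)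
      fix \<omega> assume w: "\<omega> \<in> space M" and mu: "\<forall>k. it_mu (S k \<omega>) \<le> \<mu>hat"
      have "(\<Sum>k<n. ?g * (?a * X k \<omega> + (1 - \<nu>) * E k \<omega>) - \<nu> * error_majorant k \<omega>)
          \<le> (\<Sum>k<n. lyapunov k \<omega> - lyapunov (Suc k) \<omega>)"
      proof (rule sum_mono)
        fix k
        show "?g * (?a * X k \<omega> + (1 - \<nu>) * E k \<omega>) - \<nu> * error_majorant k \<omega> \<le> lyapunov k \<omega> - lyapunov (Suc k) \<omega>"
          using lyapunov_decrease[OF w, of k] unfolding X_def E_def by linarith
      qed
      also have "\<dots> = lyapunov 0 \<omega> - lyapunov n \<omega>" by (rule sum_lessThan_telescope')
      also have "\<dots> \<le> B0" using init[OF w] lyapunov_nonneg[OF w, of n] mu by simp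
      finally show "(\<Sum>k<n. ?g * (?a * X k \<omega> + (1 - \<nu>) * E k \<omega>) - \<nu> * error_majorant k \<omega>) \<le> B0" .
    qed
    then have "(\<integral>\<omega>. (\<Sum>k<n. ?g * (?a * X k \<omega> + (1 - \<nu>) * E k \<omega>) - \<nu> * error_majorant k \<omega>) \<partial>M) \<le> (\<integral>\<omega>. B0 \<partial>M)"
      using intX intE expectation_error_majorant(1)
      by (intro integral_mono_AE Bochner_Integration.integrable_sum Bochner_Integration.integrable_diff) auto
    moreover have "(\<integral>\<omega>. (\<Sum>k<n. ?g * (?a * X k \<omega> + (1 - \<nu>) * E k \<omega>) - \<nu> * error_majorant k \<omega>) \<partial>M)
      = (\<Sum>k<n. ?g * (?a * (\<integral>\<omega>. X k \<omega> \<partial>M) + (1 - \<nu>) * (\<integral>\<omega>. E k \<omega> \<partial>M)) - \<nu> * (\<integral>\<omega>. error_majorant k \<omega> \<partial>M))"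
      using intX intE expectation_error_majorant(1) by (simp add: Bochner_Integration.integral_sum)
    \<comment> \<open>By \<open>noise_dominated\<close> the decrease of the \<epsilon>-terms covers
      the expected errors, which leaves the radius terms.\<close>
    moreover have "(\<Sum>k<n. ?g * ?a * (\<integral>\<omega>. X k \<omega> \<partial>M)) \<le>
      (\<Sum>k<n. ?g * (?a * (\<integral>\<omega>. X k \<omega> \<partial>M) + (1 - \<nu>) * (\<integral>\<omega>. E k \<omega> \<partial>M)) - \<nu> * (\<integral>\<omega>. error_majorant k \<omega> \<partial>M))"
    proof (rule sum_mono)
      fix k
      have E0: "0 \<le> (\<integral>\<omega>. E k \<omega> \<partial>M)"
        unfolding E_def by (intro integral_nonneg_AE AE_I2) (use state_bounds(3) in \<open>auto simp: less_imp_le\<close>)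
      have "\<nu> * (\<integral>\<omega>. error_majorant k \<omega> \<partial>M) \<le> \<nu> * (4 * sqrt (p_f P) * (\<integral>\<omega>. E k \<omega> \<partial>M))"
        using expectation_error_majorant(2)[of k] nu unfolding E_def by (intro mult_left_mono) auto
      also have "\<dots> = \<nu> * (4 * sqrt (p_f P)) * (\<integral>\<omega>. E k \<omega> \<partial>M)" by simp
      also have "\<dots> \<le> ?g * (1 - \<nu>) * (\<integral>\<omega>. E k \<omega> \<partial>M)" using noise_dominated E0 by (rule mult_right_mono)
      finally show "?g * ?a * (\<integral>\<omega>. X k \<omega> \<partial>M) \<le>
          ?g * (?a * (\<integral>\<omega>. X k \<omega> \<partial>M) + (1 - \<nu>) * (\<integral>\<omega>. E k \<omega> \<partial>M)) - \<nu> * (\<integral>\<omega>. error_majorant k \<omega> \<partial>M)"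
        by (simp only: distrib_left mult.assoc)
    qed
    ultimately have "?g * ?a * (\<Sum>k<n. \<integral>\<omega>. X k \<omega> \<partial>M) \<le> B0"
      by (simp add: prob_space sum_distrib_left)
    then show ?thesis using g radius_weight_pos by (simp add: pos_le_divide_eq mult.commute)
  qed
  then show ?thesis unfolding X_def by blast
qed

text \<open>Tonelli turns bounded expected partial sums into an almost surely convergent series,
  whose terms tend to 0.\<close>

lemma radius_vanishes: "AE \<omega> in M. (\<lambda>k. it_Delta (S k \<omega>)) \<longlonglongrightarrow> 0"
proof -
  define X where "X k \<omega> = it_Delta (S k \<omega>) ^ (alpha P + 2)" for k \<omega>
  have X0: "0 \<le> X k \<omega>" if "\<omega> \<in> space M" for k \<omega> using Delta_pos[OF that, of k] by (simp add: X_def less_imp_le)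
  have [measurable]: "X k \<in> borel_measurable M" for k unfolding X_def by measurable
  have intX: "integrable M (X k)" for k using Delta_power_integrable[of k] unfolding X_def .
  obtain B where B: "\<And>n. (\<Sum>k<n. \<integral>\<omega>. X k \<omega> \<partial>M) \<le> B" using expected_radius_sum unfolding X_def by blast
  have "(\<integral>\<^sup>+\<omega>. (\<Sum>k. ennreal (X k \<omega>)) \<partial>M) = (\<Sum>k. \<integral>\<^sup>+\<omega>. ennreal (X k \<omega>) \<partial>M)"
    by (rule nn_integral_suminf) simp
  also have "\<dots> = (\<Sum>k. ennreal (\<integral>\<omega>. X k \<omega> \<partial>M))"
    by (intro suminf_cong nn_integral_eq_integral intX AE_I2 X0)
  also have "\<dots> \<le> ennreal B"
  proof (rule suminf_le_const)
    fix n
    have "(\<Sum>k<n. ennreal (\<integral>\<omega>. X k \<omega> \<partial>M)) = ennreal (\<Sum>k<n. \<integral>\<omega>. X k \<omega> \<partial>M)"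
      by (intro sum_ennreal integral_nonneg_AE AE_I2 X0)
    then show "(\<Sum>k<n. ennreal (\<integral>\<omega>. X k \<omega> \<partial>M)) \<le> ennreal B" using B[of n] by (simp add: ennreal_leI)
  qed simp
  finally have "(\<integral>\<^sup>+\<omega>. (\<Sum>k. ennreal (X k \<omega>)) \<partial>M) \<noteq> \<infinity>" by (auto simp: top_unique)
  then have "AE \<omega> in M. (\<Sum>k. ennreal (X k \<omega>)) \<noteq> \<infinity>" by (intro nn_integral_noteq_infinite) auto
  then show ?thesis
  proof (rule AE_mp, intro AE_I2 impI)
    fix \<omega> assume w: "\<omega> \<in> space M" and fin: "(\<Sum>k. ennreal (X k \<omega>)) \<noteq> \<infinity>"
    have "summable (\<lambda>k. X k \<omega>)" using fin X0[OF w] by (intro summable_suminf_not_top) auto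
    then have lim: "(\<lambda>k. X k \<omega>) \<longlonglongrightarrow> 0" by (rule summable_LIMSEQ_zero)
    show "(\<lambda>k. it_Delta (S k \<omega>)) \<longlonglongrightarrow> 0"
    proof (rule LIMSEQ_I)
      fix r :: real assume r: "0 < r"
      then obtain K where K: "\<And>k. k \<ge> K \<Longrightarrow> X k \<omega> < r ^ (alpha P + 2)"
        using LIMSEQ_D[OF lim, of "r ^ (alpha P + 2)"] X0[OF w] by auto
      have "it_Delta (S k \<omega>) < r" if "k \<ge> K" for k
        using K[OF that] r power_less_imp_less_base[of "it_Delta (S k \<omega>)" "alpha P + 2" r] unfolding X_def by simp
      then show "\<exists>K. \<forall>k\<ge>K. norm (it_Delta (S k \<omega>) - 0) < r" using Delta_pos[OF w] by (auto simp: abs_of_pos)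
    qed
  qed
qed

end

context storm_process
begin

subsection \<open>Stationarity\<close>

definition failure_rate :: real where
  "failure_rate = p_h P + p_g P + 2 * p_f P"

text \<open>The expected factor by which \<open>1 / \<Delta>\<close> changes while accurate iterations are successful.\<close>

lemma contraction_factor: "0 \<le> 1 / gamma P + gamma P * failure_rate" "1 / gamma P + gamma P * failure_rate < 1"
proof -
  define g where "g = gamma P"
  have g: "1 < g" using parameter_bounds by (simp add: g_def)
  show "0 \<le> 1 / gamma P + gamma P * failure_rate"
    using g initial_bounds by (simp add: failure_rate_def g_def)
  \<comment> \<open>The lower bound on \<open>\<nu> / (1 - \<nu>)\<close> makes \<open>X\<close> at
    most \<open>1 / (2 * g)\<close>, so \<open>X\<^sup>2 * g\<close> is at most 1. Then
    \<open>g * failure_rate\<close> is at most a sixteenth of the square of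
    \<open>1 - 1 / g\<close>, hence below \<open>1 - 1 / g\<close>.\<close>
  define X where "X = (1 - \<nu>) / \<nu>"
  have "2 * g \<le> 2 * g / eta P" using parameter_bounds g by (simp add: pos_le_divide_eq mult_left_le)
  then have "2 * g \<le> \<nu> / (1 - \<nu>)" using nu_large by (simp add: g_def)
  then have "2 * g * X \<le> \<nu> / (1 - \<nu>) * X" using nu by (intro mult_right_mono) (auto simp: X_def)
  then have "2 * g * X \<le> 1" using nu by (simp add: X_def)
  moreover have X: "0 \<le> X" using nu by (simp add: X_def)
  ultimately have "X \<le> 1 / (2 * g)" using g by (simp add: field_simps)
  then have "X\<^sup>2 \<le> (1 / (2 * g))\<^sup>2" using X by (rule power_mono)
  then have "X\<^sup>2 * g \<le> (1 / (2 * g))\<^sup>2 * g" using g by (intro mult_right_mono) auto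
  also have "\<dots> = 1 / (4 * g)" using g by (simp add: power2_eq_square field_simps)
  also have "\<dots> \<le> 1" using g by simp
  finally have Xg: "X\<^sup>2 * g \<le> 1" .
  define t where "t = 1 - 1 / g"
  have t: "0 < t" "t \<le> 1" using g by (auto simp: t_def)
  have "failure_rate \<le> X\<^sup>2 / 16 * t\<^sup>2"
    using p_small nu by (simp add: failure_rate_def X_def t_def g_def power_divide)
  then have "g * failure_rate \<le> g * (X\<^sup>2 / 16 * t\<^sup>2)" using g by (intro mult_left_mono) auto
  also have "\<dots> = (X\<^sup>2 * g) * (t\<^sup>2 / 16)" by simp
  also have "\<dots> \<le> 1 * (t\<^sup>2 / 16)" using Xg by (intro mult_right_mono) auto
  also have "\<dots> < t" using t by (simp add: power2_eq_square)
  finally show "1 / gamma P + gamma P * failure_rate < 1" by (simp add: t_def g_def)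
qed

text \<open>While the path stays, an accurate iteration divides 1 / \<Delta> by
  \<open>gamma P\<close>, and any other multiplies it by at most \<open>gamma P\<close>. The
  condition \<open>gamma P * \<zeta> \<le> Delta_max P\<close> keeps the cap on the radius from
  spoiling the first case. The expectation of 1 / \<Delta> on the paths still staying thus decays
  geometrically, although on the paths that never leave it is at least
  \<open>1 / \<zeta>\<close>.\<close>

lemma radius_escapes:
  fixes Q :: "(real^'d) set"
  assumes Q: "Q \<in> sets borel" and \<zeta>: "0 < \<zeta>" "gamma P * \<zeta> \<le> Delta_max P"
    and accept: "\<And>s :: ('d, 'z) storm_iter. s \<in> accurate \<Longrightarrow> event_C P f c s \<Longrightarrow> event_C' P f c s \<Longrightarrow>
      it_x s \<in> Q \<Longrightarrow> it_Delta s \<le> \<zeta> \<Longrightarrow> accepts_trial P c s \<or> accepts_soc P c s"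
  shows "AE \<omega> in M. \<not> (\<forall>k\<ge>K. it_x (S k \<omega>) \<in> Q \<and> it_Delta (S k \<omega>) \<le> \<zeta>)"
proof -
  have g: "1 < gamma P" by (rule parameter_bounds)
  define small where "small k \<omega> \<longleftrightarrow> it_x (S k \<omega>) \<in> Q \<and> it_Delta (S k \<omega>) \<le> \<zeta>" for k \<omega>
  \<comment> \<open>Only indices below \<open>k\<close> are tested: membership in
    \<open>stay (Suc k)\<close> provides smallness at \<open>k\<close>, which is what acceptance in
    iteration \<open>k\<close> requires.\<close>
  define stay where "stay k = {\<omega> \<in> space M. \<forall>j\<in>{K..<k}. small j \<omega>}" for k
  have space: "space (Fpre k) = space M" for k using subalgebras(1) by (simp add: subalgebra_def)
  have small_meas: "{\<omega> \<in> space M. small k \<omega>} \<in> sets (Fpre k)" for k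
  proof -
    have [measurable]: "(\<lambda>\<omega>. it_x (S k \<omega>)) \<in> borel_measurable (Fpre k)"
      "(\<lambda>\<omega>. it_Delta (S k \<omega>)) \<in> borel_measurable (Fpre k)" "Q \<in> sets borel"
      using adapted_measurable Q by auto
    have "{\<omega> \<in> space (Fpre k). small k \<omega>} \<in> sets (Fpre k)" unfolding small_def by measurable
    then show ?thesis by (simp add: space)
  qed
  have sub_sets: "sets (Fpre k) \<subseteq> sets (Fpre (Suc k))" for k
    using subalgebras(3)[of k] subalgebras(4)[of k] unfolding subalgebra_def by blast
  have stay_meas: "stay k \<in> sets (Fpre k)" for k
  proof (induction k)
    case 0
    have "stay 0 = space (Fpre 0)" by (auto simp: stay_def space)
    then show ?case by simp
  next
    case (Suc k)
    have "stay (Suc k) = (if k < K then space (Fpre (Suc k)) else stay k \<inter> {\<omega> \<in> space M. small k \<omega>})"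
      by (auto simp: stay_def space less_Suc_eq)
    moreover have "stay k \<inter> {\<omega> \<in> space M. small k \<omega>} \<in> sets (Fpre (Suc k))"
      using Suc small_meas[of k] sub_sets[of k] by blast
    ultimately show ?case by simp
  qed
  define y where "y k \<omega> = indicat_real (stay k) \<omega> * (1 / it_Delta (S k \<omega>))" for k \<omega>
  define B where "B k = gamma P ^ k / Delta_init P" for k
  have y_meas: "y k \<in> borel_measurable (Fpre k)" for k
    unfolding y_def using stay_meas[of k] adapted_measurable(2)[of k] by measurable
  have y_bounds: "0 \<le> y k \<omega> \<and> y k \<omega> \<le> B k" if "\<omega> \<in> space M" for k \<omega>
  proof -
    have "1 / it_Delta (S k \<omega>) \<le> 1 / (Delta_init P / gamma P ^ k)"
      using state_bounds(1)[OF that, of k] Delta_pos[OF that, of k] initial_bounds(1) g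
      by (intro divide_left_mono) auto
    then show ?thesis
      using Delta_pos[OF that, of k] initial_bounds(1) g by (auto simp: y_def B_def indicator_def)
  qed
  have y_measM [measurable]: "y k \<in> borel_measurable M" for k
    by (rule measurable_from_subalg[OF subalgebras(1) y_meas])
  have y_int: "integrable M (y k)" for k
    by (rule integrable_const_bound[of _ "B k"]) (use y_bounds in auto)
  define bad where "bad E k = {\<omega> \<in> space M. \<not> E (S k \<omega>)}" for E and k
  \<comment> \<open>The weight is known before the iteration, hence also after its derivative
    estimates. It may therefore accompany \<open>event_A\<close> and \<open>event_B\<close> as well
    as the later function-value events.\<close>
  note fails_pre = expectation_failure_le[OF subalgebras(1) _ y_meas y_bounds]
  note fails_mid = expectation_failure_le[OF subalgebras(2) _ measurable_from_subalg[OF subalgebras(3) y_meas] y_bounds]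
  have A: "integrable M (\<lambda>\<omega>. y k \<omega> * indicat_real (bad (event_A P f) k) \<omega>)"
    "(\<integral>\<omega>. y k \<omega> * indicat_real (bad (event_A P f) k) \<omega> \<partial>M) \<le> p_h P * (\<integral>\<omega>. y k \<omega> \<partial>M)" for k
  proof -
    have "integrable M (\<lambda>\<omega>. y k \<omega> * indicat_real (bad (event_A P f) k) \<omega>) \<and>
      (\<integral>\<omega>. y k \<omega> * indicat_real (bad (event_A P f) k) \<omega> \<partial>M) \<le> p_h P * (\<integral>\<omega>. y k \<omega> \<partial>M)"
    proof (cases "alpha P = 1")
      case True
      then show ?thesis using fails_pre[OF conditions(1)[OF True]] by (simp add: bad_def)
    next
      case False
      then have "bad (event_A P f) k = {}" by (auto simp: bad_def event_A_def)
      moreover have "0 \<le> (\<integral>\<omega>. y k \<omega> \<partial>M)" using y_bounds by (intro integral_nonneg_AE AE_I2) auto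
      ultimately show ?thesis using initial_bounds by simp
    qed
    then show "integrable M (\<lambda>\<omega>. y k \<omega> * indicat_real (bad (event_A P f) k) \<omega>)"
      "(\<integral>\<omega>. y k \<omega> * indicat_real (bad (event_A P f) k) \<omega> \<partial>M) \<le> p_h P * (\<integral>\<omega>. y k \<omega> \<partial>M)" by auto
  qed
  have B: "integrable M (\<lambda>\<omega>. y k \<omega> * indicat_real (bad (event_B P f) k) \<omega>)"
    "(\<integral>\<omega>. y k \<omega> * indicat_real (bad (event_B P f) k) \<omega> \<partial>M) \<le> p_g P * (\<integral>\<omega>. y k \<omega> \<partial>M)" for k
    using fails_pre[OF conditions(2)] by (simp_all add: bad_def)
  have C: "integrable M (\<lambda>\<omega>. y k \<omega> * indicat_real (bad (event_C P f c) k) \<omega>)"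
    "(\<integral>\<omega>. y k \<omega> * indicat_real (bad (event_C P f c) k) \<omega> \<partial>M) \<le> p_f P * (\<integral>\<omega>. y k \<omega> \<partial>M)" for k
    using fails_mid[OF conditions(3)] by (simp_all add: bad_def)
  have C': "integrable M (\<lambda>\<omega>. y k \<omega> * indicat_real (bad (event_C' P f c) k) \<omega>)"
    "(\<integral>\<omega>. y k \<omega> * indicat_real (bad (event_C' P f c) k) \<omega> \<partial>M) \<le> p_f P * (\<integral>\<omega>. y k \<omega> \<partial>M)" for k
    using fails_mid[OF conditions(4)] by (simp_all add: bad_def)
  define Y where "Y k \<omega> = y k \<omega> * indicat_real (bad (event_A P f) k) \<omega> + y k \<omega> * indicat_real (bad (event_B P f) k) \<omega>
    + y k \<omega> * indicat_real (bad (event_C P f c) k) \<omega> + y k \<omega> * indicat_real (bad (event_C' P f c) k) \<omega>" for k \<omega>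
  have Y_int: "integrable M (Y k)" for k
    unfolding Y_def using A(1) B(1) C(1) C'(1) by (intro Bochner_Integration.integrable_add)
  have Y_le: "(\<integral>\<omega>. Y k \<omega> \<partial>M) \<le> failure_rate * (\<integral>\<omega>. y k \<omega> \<partial>M)" for k
  proof -
    have "(\<integral>\<omega>. Y k \<omega> \<partial>M) = (\<integral>\<omega>. y k \<omega> * indicat_real (bad (event_A P f) k) \<omega> \<partial>M)
        + (\<integral>\<omega>. y k \<omega> * indicat_real (bad (event_B P f) k) \<omega> \<partial>M)
        + (\<integral>\<omega>. y k \<omega> * indicat_real (bad (event_C P f c) k) \<omega> \<partial>M)
        + (\<integral>\<omega>. y k \<omega> * indicat_real (bad (event_C' P f c) k) \<omega> \<partial>M)"
      unfolding Y_def using A(1)[of k] B(1)[of k] C(1)[of k] C'(1)[of k] by simp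
    also have "\<dots> \<le> p_h P * (\<integral>\<omega>. y k \<omega> \<partial>M) + p_g P * (\<integral>\<omega>. y k \<omega> \<partial>M)
        + p_f P * (\<integral>\<omega>. y k \<omega> \<partial>M) + p_f P * (\<integral>\<omega>. y k \<omega> \<partial>M)"
      by (intro add_mono A B C C')
    finally show ?thesis by (simp add: failure_rate_def algebra_simps)
  qed
  \<comment> \<open>Paths that leave satisfy this trivially because their weight drops to 0, so no
    stopping time is needed. The term \<open>Y k\<close> charges each inaccurate iteration at least
    \<open>y k\<close>.\<close>
  have step: "y (Suc k) \<omega> \<le> 1 / gamma P * y k \<omega> + gamma P * Y k \<omega>"
    if w: "\<omega> \<in> space M" and mu: "it_mu (S k \<omega>) \<le> \<mu>hat" and k: "K \<le> k" for k \<omega>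
  proof (cases "\<omega> \<in> stay (Suc k)")
    case False
    have "0 \<le> Y k \<omega>" using y_bounds[OF w, of k] by (simp add: Y_def)
    moreover have "y (Suc k) \<omega> = 0" using False by (simp add: y_def)
    ultimately show ?thesis using y_bounds[OF w, of k] g by simp
  next
    case True
    then have "\<omega> \<in> stay k" and sm: "small k \<omega>" using k by (auto simp: stay_def)
    then have y: "y k \<omega> = 1 / it_Delta (S k \<omega>)" "y (Suc k) \<omega> = 1 / it_Delta (S (Suc k) \<omega>)"
      using True by (auto simp: y_def)
    have d: "0 < it_Delta (S k \<omega>)" "it_Delta (S k \<omega>) \<le> Delta_max P"
      using Delta_pos[OF w] state_bounds(2)[OF w] by auto
    note tr = path(6)[OF w, of k]
    show ?thesis
    proof (cases "event_A P f (S k \<omega>) \<and> event_B P f (S k \<omega>) \<and> event_C P f c (S k \<omega>) \<and> event_C' P f c (S k \<omega>)")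
      case True
      then have "S k \<omega> \<in> accurate" using regular_iter_path[OF w] mu by (simp add: accurate_def)
      then have "accepts_trial P c (S k \<omega>) \<or> accepts_soc P c (S k \<omega>)"
        using accept True sm by (auto simp: small_def)
      moreover have "gamma P * it_Delta (S k \<omega>) \<le> gamma P * \<zeta>"
        using sm g by (intro mult_left_mono) (auto simp: small_def)
      ultimately have "it_Delta (S (Suc k) \<omega>) = gamma P * it_Delta (S k \<omega>)"
        using tr \<zeta> by (auto simp: transition_def)
      then have "y (Suc k) \<omega> = 1 / gamma P * y k \<omega>" by (simp add: y)
      moreover have "0 \<le> gamma P * Y k \<omega>" using y_bounds[OF w, of k] g by (simp add: Y_def)
      ultimately show ?thesis by simp
    next
      case False
      have shrink: "it_Delta (S k \<omega>) / gamma P \<le> it_Delta (S k \<omega>) * 1" using d g by (simp add: pos_divide_le_eq)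
      also have "it_Delta (S k \<omega>) * 1 \<le> it_Delta (S k \<omega>) * gamma P" using d g by (intro mult_left_mono) auto
      finally have "it_Delta (S k \<omega>) / gamma P \<le> it_Delta (S (Suc k) \<omega>)"
        using tr d shrink by (auto simp: transition_def mult.commute split: if_splits)
      then have "1 / it_Delta (S (Suc k) \<omega>) \<le> 1 / (it_Delta (S k \<omega>) / gamma P)"
        using d g Delta_pos[OF w, of "Suc k"] by (intro divide_left_mono) auto
      then have "y (Suc k) \<omega> \<le> gamma P * y k \<omega>" by (simp add: y)
      moreover have "y k \<omega> \<le> Y k \<omega>"
        using False w y_bounds[OF w, of k] by (auto simp: Y_def bad_def indicator_def)
      then have "gamma P * y k \<omega> \<le> gamma P * Y k \<omega>" using g by (intro mult_left_mono) auto
      moreover have "0 \<le> 1 / gamma P * y k \<omega>" using y_bounds[OF w, of k] g by simp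
      ultimately show ?thesis by linarith
    qed
  qed
  define q where "q = 1 / gamma P + gamma P * failure_rate"
  have contract: "(\<integral>\<omega>. y (Suc k) \<omega> \<partial>M) \<le> q * (\<integral>\<omega>. y k \<omega> \<partial>M)" if k: "K \<le> k" for k
  proof -
    have "(\<integral>\<omega>. y (Suc k) \<omega> \<partial>M) \<le> (\<integral>\<omega>. 1 / gamma P * y k \<omega> + gamma P * Y k \<omega> \<partial>M)"
    proof (rule integral_mono_AE)
      show "integrable M (\<lambda>\<omega>. 1 / gamma P * y k \<omega> + gamma P * Y k \<omega>)"
        using y_int Y_int by (intro Bochner_Integration.integrable_add integrable_mult_right) auto
      show "AE \<omega> in M. y (Suc k) \<omega> \<le> 1 / gamma P * y k \<omega> + gamma P * Y k \<omega>"
        using mu_bounded by (rule AE_mp) (intro AE_I2 impI step k; simp)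
    qed (rule y_int)
    also have "\<dots> = 1 / gamma P * (\<integral>\<omega>. y k \<omega> \<partial>M) + gamma P * (\<integral>\<omega>. Y k \<omega> \<partial>M)"
      using y_int[of k] Y_int[of k] by simp
    also have "\<dots> \<le> 1 / gamma P * (\<integral>\<omega>. y k \<omega> \<partial>M) + gamma P * (failure_rate * (\<integral>\<omega>. y k \<omega> \<partial>M))"
      using Y_le[of k] g by (intro add_left_mono mult_left_mono) auto
    finally show ?thesis by (simp add: q_def algebra_simps)
  qed
  have q: "0 \<le> q" "q < 1" unfolding q_def by (rule contraction_factor)+
  have geometric: "(\<integral>\<omega>. y (K + n) \<omega> \<partial>M) \<le> q ^ n * (\<integral>\<omega>. y K \<omega> \<partial>M)" for n
  proof (induction n)
    case (Suc n)
    have "(\<integral>\<omega>. y (K + Suc n) \<omega> \<partial>M) \<le> q * (\<integral>\<omega>. y (K + n) \<omega> \<partial>M)" using contract[of "K + n"] by simp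
    also have "\<dots> \<le> q * (q ^ n * (\<integral>\<omega>. y K \<omega> \<partial>M))" using Suc q by (intro mult_left_mono) auto
    finally show ?case by (simp add: mult.assoc)
  qed simp
  define N where "N = {\<omega> \<in> space M. \<forall>k\<in>{K..}. small k \<omega>}"
  have small_M: "{\<omega> \<in> space M. small k \<omega>} \<in> sets M" for k
    using small_meas[of k] subalgebras(1)[of k] unfolding subalgebra_def by blast
  have N [measurable]: "N \<in> sets M"
    unfolding N_def by (rule sets.sets_Collect_countable_Ball[of _ _ "{K..}"]) (use small_M in auto)
  \<comment> \<open>On \<open>N\<close> the radius never exceeds \<zeta>, so
    \<open>\<zeta> * y (K + n)\<close> is at least 1 there: Markov's inequality at every
    index.\<close>
  have "prob N \<le> \<zeta> * (q ^ n * (\<integral>\<omega>. y K \<omega> \<partial>M))" for n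
  proof -
    have "prob N = (\<integral>\<omega>. indicat_real N \<omega> \<partial>M)" by simp
    also have "\<dots> \<le> (\<integral>\<omega>. \<zeta> * y (K + n) \<omega> \<partial>M)"
    proof (rule integral_mono_AE)
      show "integrable M (indicat_real N)" by (rule integrable_const_bound[of _ 1]) auto
      show "AE \<omega> in M. indicat_real N \<omega> \<le> \<zeta> * y (K + n) \<omega>"
      proof (rule AE_I2)
        fix \<omega> assume w: "\<omega> \<in> space M"
        show "indicat_real N \<omega> \<le> \<zeta> * y (K + n) \<omega>"
        proof (cases "\<omega> \<in> N")
          case True
          then have "\<omega> \<in> stay (K + n)" "it_Delta (S (K + n) \<omega>) \<le> \<zeta>" by (auto simp: N_def stay_def small_def)
          then show ?thesis using True Delta_pos[OF w, of "K + n"] by (simp add: y_def)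
        next
          case False
          then show ?thesis using y_bounds[OF w, of "K + n"] \<zeta> by simp
        qed
      qed
    qed (use y_int in auto)
    also have "\<dots> = \<zeta> * (\<integral>\<omega>. y (K + n) \<omega> \<partial>M)" by simp
    also have "\<dots> \<le> \<zeta> * (q ^ n * (\<integral>\<omega>. y K \<omega> \<partial>M))" using geometric \<zeta> by (intro mult_left_mono) auto
    finally show ?thesis .
  qed
  moreover have "(\<lambda>n. \<zeta> * (q ^ n * (\<integral>\<omega>. y K \<omega> \<partial>M))) \<longlonglongrightarrow> \<zeta> * (0 * (\<integral>\<omega>. y K \<omega> \<partial>M))"
    using q by (intro tendsto_intros LIMSEQ_power_zero) auto
  ultimately have "prob N \<le> 0" by (intro LIMSEQ_le_const[of _ _ "prob N"]) auto
  then have "prob N = 0" using measure_nonneg[of M N] by linarith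
  then have "AE \<omega> in M. \<omega> \<notin> N" by (simp add: prob_eq_0)
  then show ?thesis by (rule AE_mp) (auto simp: N_def small_def)
qed

text \<open>Vanishing radii make the smallness condition hold from some index on, and
  \<open>radius_escapes\<close> excludes each of the countably many starting indices. Cutting
  \<zeta> at \<open>Delta_max P / gamma P\<close> leaves room for one full expansion of the
  radius.\<close>

lemma not_eventually_in:
  fixes Q :: "(real^'d) set"
  assumes Q: "Q \<in> sets borel"
    and accept: "\<exists>\<zeta>>0. \<forall>s\<in>(accurate :: ('d, 'z) storm_iter set). event_C P f c s \<and> event_C' P f c s \<and>
      it_x s \<in> Q \<and> it_Delta s \<le> \<zeta> \<longrightarrow> accepts_trial P c s \<or> accepts_soc P c s"
  shows "AE \<omega> in M. \<not> (\<exists>K. \<forall>k\<ge>K. it_x (S k \<omega>) \<in> Q)"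
proof -
  obtain \<zeta>0 where \<zeta>0: "0 < \<zeta>0" and acc: "\<And>s :: ('d, 'z) storm_iter. s \<in> accurate \<Longrightarrow> event_C P f c s \<Longrightarrow>
      event_C' P f c s \<Longrightarrow> it_x s \<in> Q \<Longrightarrow> it_Delta s \<le> \<zeta>0 \<Longrightarrow> accepts_trial P c s \<or> accepts_soc P c s"
    using accept by blast
  define \<zeta> where "\<zeta> = min \<zeta>0 (Delta_max P / gamma P)"
  have g: "1 < gamma P" "0 < Delta_max P" using parameter_bounds by auto
  have z: "0 < \<zeta>" using \<zeta>0 g by (simp add: \<zeta>_def)
  have "gamma P * \<zeta> \<le> gamma P * (Delta_max P / gamma P)" using g by (intro mult_left_mono) (auto simp: \<zeta>_def)
  then have z': "gamma P * \<zeta> \<le> Delta_max P" using g by simp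
  have "AE \<omega> in M. \<forall>K. \<not> (\<forall>k\<ge>K. it_x (S k \<omega>) \<in> Q \<and> it_Delta (S k \<omega>) \<le> \<zeta>)"
    unfolding AE_all_countable
    by (intro allI radius_escapes[OF Q z z'] acc) (auto simp: \<zeta>_def)
  then show ?thesis using radius_vanishes
  proof eventually_elim
    case (elim \<omega>)
    obtain L where L: "\<And>k. k \<ge> L \<Longrightarrow> it_Delta (S k \<omega>) \<le> \<zeta>"
      using order_tendstoD(2)[OF elim(2) z] unfolding eventually_sequentially by (meson less_imp_le)
    show ?case
    proof
      assume "\<exists>K. \<forall>k\<ge>K. it_x (S k \<omega>) \<in> Q"
      then obtain K where "\<And>k. k \<ge> K \<Longrightarrow> it_x (S k \<omega>) \<in> Q" by blast
      then have "\<forall>k\<ge>max K L. it_x (S k \<omega>) \<in> Q \<and> it_Delta (S k \<omega>) \<le> \<zeta>" using L by simp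
      then show False using elim(1) by blast
    qed
  qed
qed

end

section \<open>Closedness of the non-stationary sets\<close>

lemma continuous_on_matrix_vector_mult [continuous_intros]:
  fixes A :: "'a::topological_space \<Rightarrow> real^'n^'m"
  assumes "continuous_on S A" "continuous_on S v"
  shows "continuous_on S (\<lambda>x. A x *v v x)"
  unfolding matrix_vector_mult_def by (intro continuous_intros assms)

lemma continuous_on_transpose [continuous_intros]:
  fixes A :: "'a::topological_space \<Rightarrow> real^'n^'m"
  assumes "continuous_on S A"
  shows "continuous_on S (\<lambda>x. transpose (A x))"
  unfolding transpose_def by (intro continuous_intros assms)

context storm_regularity
begin

text \<open>Continuity is available only on the domain, so the sets are closed relative to it;
  openness of the domain makes them Borel.\<close>

lemma closedin_borel: "closedin (top_of_set \<Omega>) Q \<Longrightarrow> Q \<in> sets borel"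
  using domain(1) by (auto simp: closedin_closed)

lemma continuous_data:
  "continuous_on \<Omega> (grad f)" "continuous_on \<Omega> (hess f)" "continuous_on \<Omega> c" "continuous_on \<Omega> (jac c)"
  "continuous_on \<Omega> (hess (\<lambda>y. c y $ i))"
  using lipschitz_on_continuous_on[OF lip_grad_f] f_C2 c_C2 op_lipschitz_on_continuous[OF lip_jac_c]
  by (auto simp: twice_cont_diff_on_def intro!: differentiable_imp_continuous_on differentiable_at_imp_differentiable_on
      differentiability)

text \<open>The least-squares residual is the minimum of \<open>\<parallel>g + G\<^sup>T y\<parallel>\<close> over \<open>y\<close>, which avoids the inverse of the
  Gram matrix away from the iterates.\<close>

definition nonstationary1 :: "real \<Rightarrow> (real^'d) set" where
  "nonstationary1 \<delta> = {x \<in> \<Omega>. \<forall>y. \<delta>\<^sup>2 \<le> (norm (grad f x + transpose (jac c x) *v y))\<^sup>2 + (norm (c x))\<^sup>2}"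

text \<open>The intersection over \<open>y\<close> is uncountable, so measurability is obtained
  through closedness.\<close>

lemma nonstationary1_borel: "nonstationary1 \<delta> \<in> sets borel"
proof (rule closedin_borel)
  let ?F = "\<lambda>y x. (norm (grad f x + transpose (jac c x) *v y))\<^sup>2 + (norm (c x))\<^sup>2"
  have "nonstationary1 \<delta> = (\<Inter>y. \<Omega> \<inter> ?F y -` {\<delta>\<^sup>2..})" by (auto simp: nonstationary1_def)
  moreover have "closedin (top_of_set \<Omega>) (\<Omega> \<inter> ?F y -` {\<delta>\<^sup>2..})" for y
    by (intro continuous_closedin_preimage continuous_intros continuous_data closed_atLeast)
  ultimately show "closedin (top_of_set \<Omega>) (nonstationary1 \<delta>)" by (simp only:) (rule closedin_INT; simp)
qed

lemma mem_nonstationary1: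
  assumes "x \<in> \<Omega>" "gram_bounds (jac c x) \<kappa>" "0 \<le> \<delta>"
  shows "x \<in> nonstationary1 \<delta> \<longleftrightarrow> \<delta> \<le> norm (grad_Lagr f c x)"
proof -
  interpret gram_bounds "jac c x" \<kappa> by fact
  let ?r = "grad f x + transpose (jac c x) *v multiplier (jac c x) (grad f x)"
  have "(norm ?r)\<^sup>2 \<le> (norm (grad f x + transpose (jac c x) *v y))\<^sup>2" for y
    using residual_pythagoras[of "grad f x" y] by simp
  then have "x \<in> nonstationary1 \<delta> \<longleftrightarrow> \<delta>\<^sup>2 \<le> (norm ?r)\<^sup>2 + (norm (c x))\<^sup>2"
    using assms(1) unfolding nonstationary1_def by (force intro: order_trans)
  also have "\<dots> \<longleftrightarrow> \<delta>\<^sup>2 \<le> (norm (grad_Lagr f c x))\<^sup>2" by (simp add: grad_Lagr_def norm_Pair)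
  also have "\<dots> \<longleftrightarrow> \<delta> \<le> norm (grad_Lagr f c x)"
    using assms(3) by (metis norm_ge_zero power2_le_imp_le power_mono)
  finally show ?thesis .
qed

text \<open>\<open>fst z\<close> is a unit direction in the kernel and \<open>snd z\<close> a
  multiplier solving the normal equations, which determine it wherever the Gram matrix is
  invertible. The ball contains the true multipliers at regular iterates. Both range over compact
  sets, so projecting the closed condition onto \<open>x\<close> preserves closedness.\<close>

definition nonstationary2 :: "real \<Rightarrow> (real^'d) set" where
  "nonstationary2 \<delta> = {x \<in> \<Omega>. \<exists>z. z \<in> sphere 0 1 \<times> cball 0 (kappa_grad_f R / sqrt (kappa_1G R)) \<and>
     jac c x *v fst z = 0 \<and> jac c x *v (transpose (jac c x) *v snd z) + jac c x *v grad f x = 0 \<and>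
     fst z \<bullet> (add_constraint_hess (hess f x) c (snd z) x *v fst z) \<le> - \<delta>}"

lemma nonstationary2_borel: "nonstationary2 \<delta> \<in> sets borel"
proof (rule closedin_borel)
  let ?T = "sphere (0::real^'d) 1 \<times> cball (0::real^'m) (kappa_grad_f R / sqrt (kappa_1G R))"
  let ?F = "\<lambda>p :: ((real^'d) \<times> (real^'m)) \<times> (real^'d). (jac c (snd p) *v fst (fst p),
    jac c (snd p) *v (transpose (jac c (snd p)) *v snd (fst p)) + jac c (snd p) *v grad f (snd p),
    fst (fst p) \<bullet> (add_constraint_hess (hess f (snd p)) c (snd (fst p)) (snd p) *v fst (fst p)))"
  have comp: "continuous_on (?T \<times> \<Omega>) (\<lambda>p. F (snd p))" if "continuous_on \<Omega> F"
    for F :: "real^'d \<Rightarrow> 'b::topological_space"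
    by (rule continuous_on_compose2[OF that continuous_on_snd[OF continuous_on_id]]) auto
  have "continuous_on (?T \<times> \<Omega>) ?F"
    unfolding add_constraint_hess_def
    by (intro continuous_intros comp[OF continuous_data(1)] comp[OF continuous_data(2)]
        comp[OF continuous_data(4)] comp[OF continuous_data(5)])
  then have "closedin (top_of_set (?T \<times> \<Omega>)) ((?T \<times> \<Omega>) \<inter> ?F -` ({0} \<times> {0} \<times> {..- \<delta>}))"
    by (intro continuous_closedin_preimage closed_Times) auto
  then have "closedin (top_of_set \<Omega>) {x. \<exists>z. z \<in> ?T \<and> (z, x) \<in> (?T \<times> \<Omega>) \<inter> ?F -` ({0} \<times> {0} \<times> {..- \<delta>})}"
    by (intro closedin_compact_projection compact_Times) auto
  moreover have "nonstationary2 \<delta> = {x. \<exists>z. z \<in> ?T \<and> (z, x) \<in> (?T \<times> \<Omega>) \<inter> ?F -` ({0} \<times> {0} \<times> {..- \<delta>})}"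
    by (auto simp: nonstationary2_def)
  ultimately show "closedin (top_of_set \<Omega>) (nonstationary2 \<delta>)" by simp
qed

lemma mem_nonstationary2:
  fixes s :: "('d, 'z::finite) storm_iter"
  assumes s: "regular_iter s" and \<delta>: "0 < \<delta>"
  shows "it_x s \<in> nonstationary2 \<delta> \<longleftrightarrow> \<delta> \<le> tau_plus f c (it_x s) (it_Z s)"
proof -
  note r = regular_iterD[OF s]
  interpret gram_bounds "jac c (it_x s)" "kappa_1G R" by (rule r)
  let ?l = "multiplier (jac c (it_x s)) (grad f (it_x s))"
  have "jac c (it_x s) *v (transpose (jac c (it_x s)) *v l) + jac c (it_x s) *v grad f (it_x s) = 0 \<longleftrightarrow>
      (jac c (it_x s) ** transpose (jac c (it_x s))) *v l = (jac c (it_x s) ** transpose (jac c (it_x s))) *v ?l" for l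
    by (simp only: gram_vector[symmetric] multiplier_normal eq_neg_iff_add_eq_0)
  then have "jac c (it_x s) *v (transpose (jac c (it_x s)) *v l) + jac c (it_x s) *v grad f (it_x s) = 0 \<longleftrightarrow> l = ?l" for l
    using gram_inj[of l ?l] by blast
  then have "it_x s \<in> nonstationary2 \<delta> \<longleftrightarrow> (\<exists>v. norm v = 1 \<and> jac c (it_x s) *v v = 0 \<and>
      v \<bullet> (hess_Lagr f c (it_x s) *v v) \<le> - \<delta>)"
    using r(1) norm_multiplier_true_le[OF s] by (auto simp: nonstationary2_def hess_Lagr_def)
  also have "\<dots> \<longleftrightarrow> \<delta> \<le> tau_plus f c (it_x s) (it_Z s)"
    by (rule tau_plus_witness[OF r(1,12) \<delta>, symmetric])
  finally show ?thesis .
qed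

end

section \<open>Stationarity along almost every path\<close>

context storm_process
begin

text \<open>Membership in \<open>nonstationary1\<close> matches the size of the Lagrangian gradient
  only where the Gram bound holds, which the iterates guarantee; the exclusion of eventual
  membership then transfers for every threshold.\<close>

lemma first_order_stationarity: "AE \<omega> in M. liminf (\<lambda>k. ereal (norm (grad_Lagr f c (it_x (S k \<omega>))))) = 0"
proof -
  have "AE \<omega> in M. \<not> (\<exists>K. \<forall>k\<ge>K. it_x (S k \<omega>) \<in> nonstationary1 (1 / real (Suc n)))" for n
  proof (rule not_eventually_in[OF nonstationary1_borel])
    have "0 < 1 / real (Suc n)" by simp
    from first_order_acceptance[OF this, where 'z = 'z]
    show "\<exists>\<zeta>>0. \<forall>s\<in>(accurate :: ('d, 'z) storm_iter set). event_C P f c s \<and> event_C' P f c s \<and>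
      it_x s \<in> nonstationary1 (1 / real (Suc n)) \<and> it_Delta s \<le> \<zeta> \<longrightarrow> accepts_trial P c s \<or> accepts_soc P c s"
      using mem_nonstationary1[OF regular_iterD(1,6)[OF accurateD(1)], of _ "1 / real (Suc n)"] by fastforce
  qed
  then have "AE \<omega> in M. \<forall>n. \<not> (\<exists>K. \<forall>k\<ge>K. it_x (S k \<omega>) \<in> nonstationary1 (1 / real (Suc n)))"
    unfolding AE_all_countable by blast
  then show ?thesis
  proof (rule AE_mp, intro AE_I2 impI liminf_eq_0I)
    fix \<omega> n assume w: "\<omega> \<in> space M"
      and "\<forall>n. \<not> (\<exists>K. \<forall>k\<ge>K. it_x (S k \<omega>) \<in> nonstationary1 (1 / real (Suc n)))"
    moreover have "it_x (S k \<omega>) \<in> nonstationary1 (1 / real (Suc n)) \<longleftrightarrow>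
        1 / real (Suc n) \<le> norm (grad_Lagr f c (it_x (S k \<omega>)))" for k
      by (rule mem_nonstationary1[OF regular_iterD(1,6)[OF regular_iter_path[OF w]]]) simp
    ultimately show "\<not> (\<exists>K. \<forall>k\<ge>K. 1 / real (Suc n) \<le> norm (grad_Lagr f c (it_x (S k \<omega>))))" by blast
  qed simp
qed

lemma second_order_stationarity:
  assumes a: "alpha P = 1"
  shows "AE \<omega> in M. liminf (\<lambda>k. ereal (tau_plus f c (it_x (S k \<omega>)) (it_Z (S k \<omega>)))) = 0"
proof -
  have "AE \<omega> in M. \<not> (\<exists>K. \<forall>k\<ge>K. it_x (S k \<omega>) \<in> nonstationary2 (1 / real (Suc n)))" for n
  proof (rule not_eventually_in[OF nonstationary2_borel])
    have pos: "0 < 1 / real (Suc n)" by simp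
    from second_order_acceptance[OF a this, where 'z = 'z]
    show "\<exists>\<zeta>>0. \<forall>s\<in>(accurate :: ('d, 'z) storm_iter set). event_C P f c s \<and> event_C' P f c s \<and>
      it_x s \<in> nonstationary2 (1 / real (Suc n)) \<and> it_Delta s \<le> \<zeta> \<longrightarrow> accepts_trial P c s \<or> accepts_soc P c s"
      using mem_nonstationary2[OF accurateD(1) pos] by blast
  qed
  then have "AE \<omega> in M. \<forall>n. \<not> (\<exists>K. \<forall>k\<ge>K. it_x (S k \<omega>) \<in> nonstationary2 (1 / real (Suc n)))"
    unfolding AE_all_countable by blast
  then show ?thesis
  proof (rule AE_mp, intro AE_I2 impI liminf_eq_0I)
    fix \<omega> n assume w: "\<omega> \<in> space M"
      and "\<forall>n. \<not> (\<exists>K. \<forall>k\<ge>K. it_x (S k \<omega>) \<in> nonstationary2 (1 / real (Suc n)))"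
    moreover have "it_x (S k \<omega>) \<in> nonstationary2 (1 / real (Suc n)) \<longleftrightarrow>
        1 / real (Suc n) \<le> tau_plus f c (it_x (S k \<omega>)) (it_Z (S k \<omega>))" for k
      by (rule mem_nonstationary2[OF regular_iter_path[OF w]]) simp
    ultimately show "\<not> (\<exists>K. \<forall>k\<ge>K. 1 / real (Suc n) \<le> tau_plus f c (it_x (S k \<omega>)) (it_Z (S k \<omega>)))" by blast
  qed (simp add: tau_plus_def)
qed

end

theorem theorem4p15:
  fixes P :: "'d::finite storm_params"
    and D :: "'xi measure" and F :: "real^'d \<Rightarrow> 'xi \<Rightarrow> real"
    and f :: "real^'d \<Rightarrow> real"
    and c :: "real^'d \<Rightarrow> real^'m::finite"
    and R :: reg_consts and \<Omega> :: "(real^'d) set"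
    and M :: "'w measure" and Fpre Fmid :: "nat \<Rightarrow> 'w measure"
    and S :: "nat \<Rightarrow> 'w \<Rightarrow> ('d, 'z::finite) storm_iter"
    and \<mu>hat \<nu> :: real
  assumes dims: "CARD('d) = CARD('m) + CARD('z)"
    and objective: "stochastic_objective D F f"
    and params: "valid_params P"
    and prob: "prob_space M"
    and filtration: "storm_filtration M Fpre Fmid"
    and adapted: "storm_adapted P c Fpre Fmid S"
    and algorithm: "\<forall>\<omega>\<in>space M. storm_path P c (\<lambda>k. S k \<omega>)"
    and accuracy: "probabilistic_accuracy P f c M Fpre Fmid S"
    and regular: "regularity P f c R \<Omega> M S"
    and stabilization: "merit_stabilization M S \<mu>hat"
    and nu: "0 < \<nu>" "\<nu> < 1"
    and nu_large: "\<nu> / (1 - \<nu>) \<ge>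
          max (4 * gamma P ^ 3 * max 1 (Delta_max P)
                 / min (eta P ^ 3 * kappa_fcd P) (Upsilon3 P R \<mu>hat))
              (2 * gamma P / eta P)"
    and p_small: "p_h P + p_g P + 2 * p_f P \<le> (1 - \<nu>)\<^sup>2 / (16 * \<nu>\<^sup>2) * (1 - 1 / gamma P)\<^sup>2"
  shows "(AE \<omega> in M. liminf (\<lambda>k. ereal (norm (grad_Lagr f c (it_x (S k \<omega>))))) = 0) \<and>
         (alpha P = 1 \<longrightarrow>
           (AE \<omega> in M. liminf (\<lambda>k. ereal (tau_plus f c (it_x (S k \<omega>)) (it_Z (S k \<omega>)))) = 0))"
proof -
  interpret prob_space M by fact
  interpret storm_regularity P f c R \<Omega> \<mu>hat
    by (unfold_locales) (use params regular in \<open>simp_all add: regularity_def\<close>)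
  interpret storm_process P f c R \<Omega> \<mu>hat M Fpre Fmid S \<nu>
    by unfold_locales (use assms in auto)
  show ?thesis using first_order_stationarity second_order_stationarity by blast
qed

end
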